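(* Let $\gamma\in\mathbb R$ be such that $\gamma\neq0$, $|\gamma|\neq1$, and let $s\ge1/2$. Then $$\|uv\|_{X^{s,-1/2+}_{per}}\lesssim\|u\|_{Y^{s-1/2,1/2}_{\gamma,per}}\|v\|_{X^{s,1/2}_{per}},$$ $$\|\partial_x(u\bar v)\|_{Y^{s-1/2,-1/2+}_{\gamma,per}}\lesssim\|u\|_{X^{s,1/2}_{per}}\|v\|_{X^{s,1/2}_{per}},$$ where the implicit constants depend on $\gamma$ (and on $s$ and the exponents) but not on $u,v$.
   Context: Functions $u(t,x)$ are complex-valued on $\mathbb R\times\mathbb T$, with $\mathbb T=\mathbb R/L\mathbb Z$ and $L>0$ a fixed period; $\widehat u(\tau,n)$ ($\tau\in\mathbb R,n\in\mathbb Z$) is the Fourier transform in $t$ and the $n$-th Fourier coefficient in $x$ (with respect to $e^{2\pi inx/L}$). With $\langle x\rangle=1+|x|$, $$\|u\|_{X^{s,b}_{per}}=\Big(\sum_{n\in\mathbb Z}\int_{\mathbb R}\langle\tau+n^2\rangle^{2b}\langle n\rangle^{2s}|\widehat u(\tau,n)|^2d\tau\Big)^{1/2},$$ $$\|u\|_{Y^{s,b}_{\gamma,per}}=\Big(\sum_{n\in\mathbb Z}\int_{\mathbb R}\langle\tau+\gamma|n|n\rangle^{2b}\langle n\rangle^{2s}|\widehat u(\tau,n)|^2d\tau\Big)^{1/2}.$$ The exponent $-1/2+$ denotes a number slightly larger than $-1/2$: the estimates hold with $-1/2+$ replaced by $-1/2+\epsilon$ for every sufficiently small $\epsilon>0$.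 $A\lesssim B$ means $A\le CB$ for a constant $C>0$. The estimates are understood for all smooth functions on $\mathbb R\times\mathbb T$ rapidly decreasing in $t$ (and hence by density). *)

theory Defs
  imports "HOL-Analysis.Analysis"
begin

text \<open>
  A function on \<open>\<real> \<times> \<real>/L\<int>\<close> is a function \<open>u t x\<close> of two real variables that has period \<open>L\<close> in \<open>x\<close>.
\<close>

definition deriv_t :: "(real \<Rightarrow> real \<Rightarrow> complex) \<Rightarrow> real \<Rightarrow> real \<Rightarrow> complex" where
  "deriv_t u t x = vector_derivative (\<lambda>r. u r x) (at t)"

definition deriv_x :: "(real \<Rightarrow> real \<Rightarrow> complex) \<Rightarrow> real \<Rightarrow> real \<Rightarrow> complex" where
  "deriv_x u t x = vector_derivative (\<lambda>y. u t y) (at x)"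

text \<open>
  Joint (Frechet) differentiability of all the iterated partial derivatives makes them continuous
  and, by the symmetry of mixed second derivatives, independent of the order in which the
  derivatives are taken; so this is the usual class of infinitely differentiable functions.
\<close>

definition smooth :: "(real \<Rightarrow> real \<Rightarrow> complex) \<Rightarrow> bool" where
  "smooth u \<longleftrightarrow>
     (\<forall>j k. (\<lambda>(t, x). (deriv_t ^^ j) ((deriv_x ^^ k) u) t x) differentiable_on UNIV)"

definition rapidly_decreasing :: "(real \<Rightarrow> real \<Rightarrow> complex) \<Rightarrow> bool" where
  "rapidly_decreasing u \<longleftrightarrow>
     (\<forall>j k m. \<exists>C. \<forall>t x. (1 + \<bar>t\<bar>) ^ m * cmod ((deriv_t ^^ j) ((deriv_x ^^ k) u) t x) \<le> C)"

definition schwartz_per :: "real \<Rightarrow> (real \<Rightarrow> real \<Rightarrow> complex) set" where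
  "schwartz_per L =
     {u. (\<forall>t x. u t (x + L) = u t x) \<and> smooth u \<and> rapidly_decreasing u}"

definition fourier_coeff :: "real \<Rightarrow> (real \<Rightarrow> complex) \<Rightarrow> int \<Rightarrow> complex" where
  "fourier_coeff L w n =
     (CLINT x:{0..L}|lborel. cis (- (2 * pi * of_int n * x / L)) * w x) / of_real L"

text \<open>
  The transform in \<open>t\<close> uses the kernel \<open>exp (- \<i> \<tau> t)\<close>, without a normalising factor.
\<close>

definition spacetime_fourier ::
    "real \<Rightarrow> (real \<Rightarrow> real \<Rightarrow> complex) \<Rightarrow> real \<Rightarrow> int \<Rightarrow> complex" where
  "spacetime_fourier L u \<tau> n = (CLINT t|lborel. cis (- (\<tau> * t)) * fourier_coeff L (u t) n)"

definition bracket :: "real \<Rightarrow> real" where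
  "bracket x = 1 + \<bar>x\<bar>"

definition ennreal_sqrt :: "ennreal \<Rightarrow> ennreal" where
  "ennreal_sqrt a = (if a = top then top else ennreal (sqrt (enn2real a)))"

text \<open>
  The norms take values in \<open>[0, \<infinity>]\<close>, so that a bound by a finite quantity includes finiteness.
  The function \<open>h\<close> is the dispersion symbol; the sum over \<open>n\<close> is the integral with respect to
  counting measure.
\<close>

definition bourgain_norm ::
    "(int \<Rightarrow> real) \<Rightarrow> real \<Rightarrow> real \<Rightarrow> real \<Rightarrow> (real \<Rightarrow> real \<Rightarrow> complex) \<Rightarrow> ennreal" where
  "bourgain_norm h L s b u = ennreal_sqrt
     (\<integral>\<^sup>+ n. (\<integral>\<^sup>+ \<tau>. ennreal (bracket (\<tau> + h n) powr (2 * b) * bracket (of_int n) powr (2 * s)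
        * (cmod (spacetime_fourier L u \<tau> n))\<^sup>2) \<partial>lborel) \<partial>count_space UNIV)"

definition X_norm :: "real \<Rightarrow> real \<Rightarrow> real \<Rightarrow> (real \<Rightarrow> real \<Rightarrow> complex) \<Rightarrow> ennreal" where
  "X_norm L s b u = bourgain_norm (\<lambda>n. (of_int n)\<^sup>2) L s b u"

definition Y_norm :: "real \<Rightarrow> real \<Rightarrow> real \<Rightarrow> real \<Rightarrow> (real \<Rightarrow> real \<Rightarrow> complex) \<Rightarrow> ennreal" where
  "Y_norm \<gamma> L s b u = bourgain_norm (\<lambda>n. \<gamma> * \<bar>of_int n\<bar> * of_int n) L s b u"

end

theory Submission
  imports Defs "HOL-Probability.Probability"
begin

text \<open>
  By duality both inequalities are bounds for one and the same trilinear form on the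
  frequency space \<open>\<int> \<times> \<real>\<close>, in a frequency \<open>y = (k, \<tau>\<^sub>0)\<close> of the \<open>Y\<close> function and the frequencies \<open>p\<close> and
  \<open>y + p\<close> of the two \<open>X\<close> functions; the derivatives cost at most the factor
  \<open>\<langle>k\<rangle>\<^sup>1\<^sup>/\<^sup>2 (\<langle>p\<rangle>\<^sup>-\<^sup>1\<^sup>/\<^sup>2 + \<langle>k + p\<rangle>\<^sup>-\<^sup>1\<^sup>/\<^sup>2)\<close>. That factor is bounded unless \<open>\<bar>k\<bar>\<close> is much larger than
  one of the other two frequencies, and then, as \<open>\<bar>\<gamma>\<bar> \<noteq> 1\<close>, the resonance function
  \<open>k (k + 2 p - \<gamma> \<bar>k\<bar>)\<close> is of size \<open>k\<^sup>2\<close>, so one of the three modulations is at least of that size and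
  pays for the loss. In every case one modulation weight may be discarded, and Cauchy-Schwarz with
  the discarded variable fixed leaves a one-parameter sum that converges uniformly: for a discarded
  \<open>X\<close> modulation it runs over \<open>\<langle>q(k)\<rangle>\<^sup>-\<^sup>5\<^sup>/\<^sup>8\<close> with quadratic polynomials \<open>q\<close> of leading coefficients
  \<open>\<plusminus>1 \<plusminus> \<gamma> \<noteq> 0\<close>, and for the \<open>Y\<close> modulation \<open>q\<close> is linear but the weight \<open>\<langle>p\<rangle>\<^sup>-\<^sup>1 + \<langle>k + p\<rangle>\<^sup>-\<^sup>1\<close> is left over.
\<close>

section \<open>Integrals and sums of powers of the bracket\<close>

text \<open>All exponents come from one budget. Only the output has the spare \<epsilon>, yet all
  three modulation weights are lowered from 1/2 to 7/16, so that a single kernel dominates both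
  estimates. After squaring, two weights 7/8 are convolved in the time frequency; the integral must
  keep an exponent above 1 for itself, here 9/8, and 7/8 + 7/8 - 9/8 = 5/8 survives. A quadratic
  polynomial grows like the square of the distance to its roots, which turns 5/8 into 5/4 > 1; a
  linear one needs a second 5/8 from the leftover weight. The resonance gains the power 2 * 7/16 =
  7/8 of the bracket of \<open>k\<close>, more than the 1/2 that is lost. The linear phase has slope
  \<open>2 * k\<close> up to sign and degenerates at \<open>k = 0\<close>, but \<open>k = 0\<close>
  is never in the resonant case, so the kernel tested there may be set to 0. The other half of the
  work is to dominate the transform of a product by a convolution. Inversion of the series and of
  the integral is applied to one factor only; the other factor, possibly a conjugate, enters with
  continuity and quadratic decay in \<open>t\<close> alone.\<close>

lemma bracket_ge_1 [simp]: "1 \<le> bracket x"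
  by (simp add: bracket_def)

lemma bracket_pos [simp]: "0 < bracket x"
  by (simp add: bracket_def add_pos_nonneg)

lemma bracket_nonneg [simp]: "0 \<le> bracket x"
  by (simp add: bracket_def)

lemma bracket_minus [simp]: "bracket (- x) = bracket x"
  by (simp add: bracket_def)

lemma bracket_add_le: "bracket (x + y) \<le> bracket x + bracket y"
  by (simp add: bracket_def)

lemma bracket_diff_le: "bracket (x - y) \<le> bracket x + bracket y"
  by (simp add: bracket_def)

lemma borel_measurable_bracket [measurable]: "bracket \<in> borel_measurable borel"
  by (simp add: bracket_def[abs_def])

text \<open>With both bases replaced by the smaller one the product becomes a single power. This
  decouples brackets centred at different points, whose powers can then be integrated or summed
  separately.\<close>

lemma powr_mult_le_sum_powr:
  fixes x y :: real
  assumes "x > 0" "y > 0" "a \<ge> 0" "b \<ge> 0"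
  shows "x powr (- a) * y powr (- b) \<le> x powr (- (a + b)) + y powr (- (a + b))"
proof (cases "x \<le> y")
  case True
  then have "y powr (- b) \<le> x powr (- b)"
    using assms by (intro powr_mono2') auto
  then have "x powr (- a) * y powr (- b) \<le> x powr (- a) * x powr (- b)"
    by (rule mult_left_mono) simp
  also have "\<dots> = x powr (- (a + b))"
    by (simp add: powr_add[symmetric])
  finally show ?thesis
    using powr_ge_zero[of y "- (a + b)"] by linarith
next
  case False
  then have "x powr (- a) \<le> y powr (- a)"
    using assms by (intro powr_mono2') auto
  then have "x powr (- a) * y powr (- b) \<le> y powr (- a) * y powr (- b)"
    by (rule mult_right_mono) simp
  also have "\<dots> = y powr (- (a + b))"
    by (simp add: powr_add[symmetric])
  finally show ?thesis
    using powr_ge_zero[of x "- (a + b)"] by linarith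
qed

lemma bracket_integral_finite:
  assumes "a > 1"
  shows "(\<integral>\<^sup>+x. ennreal (bracket x powr (- a)) \<partial>lborel) < \<infinity>"
proof -
  let ?h = "\<lambda>x::real. ennreal ((1 + \<bar>x\<bar>) powr (- a)) * indicator {0..} x"
  have h: "(\<integral>\<^sup>+x. ?h x \<partial>lborel) = ennreal (0 - (1 + 0) powr (1 - a) / (1 - a))"
  proof -
    have lim: "((\<lambda>x::real. (1 + x) powr (1 - a) / (1 - a)) \<longlongrightarrow> 0) at_top"
      using assms by real_asymp
    have deriv: "((\<lambda>x. (1 + x) powr (1 - a) / (1 - a)) has_real_derivative (1 + \<bar>x\<bar>) powr (- a)) (at x)"
      if "0 \<le> x" for x
    proof -
      have "((\<lambda>x. (1 + x) powr (1 - a) / (1 - a)) has_real_derivative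
          ((1 - a) * (1 + x) powr (1 - a - 1)) / (1 - a)) (at x)"
        using that by (auto intro!: derivative_eq_intros)
      then show ?thesis
        using assms that by simp
    qed
    show ?thesis
      by (rule nn_integral_FTC_atLeast[where F = "\<lambda>x. (1 + x) powr (1 - a) / (1 - a)", OF _ deriv _ lim]) auto
  qed
  have "(\<integral>\<^sup>+x. ennreal (bracket x powr (- a)) \<partial>lborel) \<le> (\<integral>\<^sup>+x. ?h x + ?h (- x) \<partial>lborel)"
    by (intro nn_integral_mono) (auto simp: bracket_def split: split_indicator)
  also have "\<dots> = (\<integral>\<^sup>+x. ?h x \<partial>lborel) + (\<integral>\<^sup>+x. ?h (- x) \<partial>lborel)"
    by (intro nn_integral_add) auto
  also have "(\<integral>\<^sup>+x. ?h (- x) \<partial>lborel) = (\<integral>\<^sup>+x. ?h x \<partial>lborel)"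
    by (subst nn_integral_real_affine[of ?h "-1" 0]) auto
  finally show ?thesis
    unfolding h by (auto simp: order_le_less_trans)
qed

text \<open>A real number, for use in real inequalities. It is the genuine integral only for
  \<open>a > 1\<close>, since \<open>enn2real\<close> sends an infinite value to 0.\<close>

definition bracket_integral :: "real \<Rightarrow> real" where
  "bracket_integral a = enn2real (\<integral>\<^sup>+x. ennreal (bracket x powr (- a)) \<partial>lborel)"

lemma bracket_integral_nonneg [simp]: "0 \<le> bracket_integral a"
  by (simp add: bracket_integral_def)

lemma nn_integral_bracket_shift:
  assumes "a > 1"
  shows "(\<integral>\<^sup>+x. ennreal (bracket (x + r) powr (- a)) \<partial>lborel) = ennreal (bracket_integral a)"
proof -
  have "(\<integral>\<^sup>+x. ennreal (bracket x powr (- a)) \<partial>lborel) = (\<integral>\<^sup>+x. ennreal (bracket (x + r) powr (- a)) \<partial>lborel)"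
    by (subst nn_integral_real_affine[of _ 1 r]) (auto simp: add.commute)
  then show ?thesis
    using bracket_integral_finite[OF assms] by (simp add: bracket_integral_def)
qed

section \<open>Sums over the integers by comparison with integrals\<close>

interpretation int_lborel: pair_sigma_finite "count_space (UNIV :: int set)" "lborel :: real measure"
  by (rule pair_sigma_finite.intro[OF sigma_finite_measure_count_space lborel.sigma_finite_measure_axioms])

text \<open>Each integer owns the unit interval to its right, so by Tonelli a sum over the integers
  is the integral of a step function. Convergence of sums is thereby inherited from
  integrals.\<close>

lemma nn_integral_count_space_int_eq_floor:
  fixes g :: "int \<Rightarrow> ennreal"
  shows "(\<integral>\<^sup>+n. g n \<partial>count_space UNIV) = (\<integral>\<^sup>+x. g \<lfloor>x::real\<rfloor> \<partial>lborel)"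
proof -
  have ind: "indicator {of_int n ..< of_int n + 1} (x::real) = (indicator {\<lfloor>x\<rfloor>} n :: ennreal)" for n and x :: real
  proof -
    have "of_int n \<le> x \<and> x < of_int n + 1 \<longleftrightarrow> n = \<lfloor>x\<rfloor>"
      by (metis floor_eq_iff)
    then show ?thesis
      by (simp add: indicator_def)
  qed
  have [measurable]: "(\<lambda>(n, x). g n * indicator {of_int n ..< of_int n + 1} (x::real))
      \<in> borel_measurable (count_space (UNIV :: int set) \<Otimes>\<^sub>M lborel)"
    by (intro measurable_pair_measure_countable1) auto
  have "(\<integral>\<^sup>+n. g n \<partial>count_space UNIV)
      = (\<integral>\<^sup>+n. (\<integral>\<^sup>+x. g n * indicator {of_int n ..< of_int n + 1} (x::real) \<partial>lborel) \<partial>count_space UNIV)"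
    by (simp add: nn_integral_cmult)
  also have "\<dots> = (\<integral>\<^sup>+x. (\<integral>\<^sup>+n. g n * indicator {of_int n ..< of_int n + 1} (x::real) \<partial>count_space UNIV) \<partial>lborel)"
    by (rule int_lborel.Fubini'[symmetric]) measurable
  also have "\<dots> = (\<integral>\<^sup>+x. g \<lfloor>x::real\<rfloor> \<partial>lborel)"
    unfolding ind by (intro nn_integral_cong) (simp add: nn_integral_indicator_singleton)
  finally show ?thesis .
qed

text \<open>A point and its integer part differ by less than 1, which changes the bracket by a
  factor of at most 2. Translation invariance of the integral makes the bound uniform in
  \<open>r\<close>.\<close>

lemma bracket_sum_le:
  assumes "a > 1"
  shows "(\<integral>\<^sup>+n. ennreal (bracket (of_int n - r) powr (- a)) \<partial>count_space UNIV)
    \<le> ennreal (2 powr a * bracket_integral a)"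
proof -
  have *: "bracket (of_int \<lfloor>x\<rfloor> - r) powr (- a) \<le> 2 powr a * bracket (x - r) powr (- a)" for x :: real
  proof -
    have "bracket (x - r) \<le> 2 * bracket (of_int \<lfloor>x\<rfloor> - r)"
    proof -
      have "1 + \<bar>x - r\<bar> \<le> 2 * (1 + \<bar>y - r\<bar>)" if "y \<le> x" "x < y + 1" for y :: real
        using that by (simp add: abs_if)
      from this[of "of_int \<lfloor>x\<rfloor>"] show ?thesis
        by (simp add: bracket_def)
    qed
    then have "(2 * bracket (of_int \<lfloor>x\<rfloor> - r)) powr (- a) \<le> bracket (x - r) powr (- a)"
      using assms by (intro powr_mono2') auto
    then have "2 powr a * (2 powr (- a) * bracket (of_int \<lfloor>x\<rfloor> - r) powr (- a)) \<le> 2 powr a * bracket (x - r) powr (- a)"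
      by (simp add: powr_mult)
    moreover have "2 powr a * (2::real) powr (- a) = 1"
      by (simp add: powr_add[symmetric])
    ultimately show ?thesis
      by (simp add: mult.assoc[symmetric])
  qed
  have "(\<integral>\<^sup>+n. ennreal (bracket (of_int n - r) powr (- a)) \<partial>count_space UNIV)
      \<le> (\<integral>\<^sup>+x. ennreal (2 powr a) * ennreal (bracket (x + - r) powr (- a)) \<partial>lborel)"
    unfolding nn_integral_count_space_int_eq_floor
    using * by (intro nn_integral_mono) (simp add: ennreal_mult[symmetric])
  also have "\<dots> = ennreal (2 powr a) * ennreal (bracket_integral a)"
    by (subst nn_integral_cmult) (auto simp only: nn_integral_bracket_shift[OF assms] measurable_lborel1, measurable)
  finally show ?thesis
    by (simp add: ennreal_mult)
qed

text \<open>Here \<open>r1\<close> and \<open>r2\<close> are the real parts of the roots.\<close>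

lemma quadratic_ge_dist_squared:
  fixes A B c :: real
  assumes "c \<noteq> 0"
  obtains r1 r2 where "\<And>x. \<bar>A + B * x + c * x\<^sup>2\<bar> \<ge> \<bar>c\<bar> * (min \<bar>x - r1\<bar> \<bar>x - r2\<bar>)\<^sup>2"
proof -
  \<comment> \<open>Completing the square; when \<open>D \<ge> 0\<close> the maximum in
    \<open>d\<close> merges both centres into \<open>h\<close>.\<close>
  define h where "h = - B / (2 * c)"
  define D where "D = A / c - h\<^sup>2"
  define d where "d = sqrt (max 0 (- D))"
  have eq: "A + B * x + c * x\<^sup>2 = c * ((x - h)\<^sup>2 + D)" for x
    using assms unfolding D_def h_def by (simp add: field_simps power2_eq_square)
  have d: "d \<ge> 0" "d\<^sup>2 = max 0 (- D)"
    by (auto simp: d_def)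
  have "(min \<bar>x - (h + d)\<bar> \<bar>x - (h - d)\<bar>)\<^sup>2 \<le> \<bar>(x - h)\<^sup>2 + D\<bar>" for x
  proof (cases "D \<ge> 0")
    case True
    then have "d = 0" by (simp add: d_def)
    then show ?thesis using True by simp
  next
    case False
    then have "D = - d\<^sup>2" using d by simp
    then have "(x - h)\<^sup>2 + D = (x - (h + d)) * (x - (h - d))"
      by (simp add: algebra_simps power2_eq_square)
    moreover have "(min \<bar>x - (h + d)\<bar> \<bar>x - (h - d)\<bar>)\<^sup>2 \<le> \<bar>x - (h + d)\<bar> * \<bar>x - (h - d)\<bar>"
      unfolding power2_eq_square by (intro mult_mono) auto
    ultimately show ?thesis
      by (simp add: abs_mult)
  qed
  then have "\<bar>A + B * x + c * x\<^sup>2\<bar> \<ge> \<bar>c\<bar> * (min \<bar>x - (h + d)\<bar> \<bar>x - (h - d)\<bar>)\<^sup>2" for x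
    unfolding eq abs_mult by (intro mult_left_mono) auto
  then show ?thesis by (rule that)
qed

text \<open>The bracket is at least a multiple of \<open>(1 + y)\<^sup>2\<close>, with
  \<open>y\<close> the distance to the nearer of two points, so the exponent \<open>a\<close> acts
  as \<open>2 * a > 1\<close>. Only the leading coefficient enters the constant; \<open>A\<close>
  and \<open>B\<close> merely move the two points.\<close>

lemma bracket_quadratic_sum:
  assumes "c \<noteq> 0" "a > 1/2"
  shows "\<exists>S\<ge>0. \<forall>A B. (\<integral>\<^sup>+n. ennreal (bracket (A + B * of_int n + c * (of_int n)\<^sup>2) powr (- a)) \<partial>count_space UNIV)
    \<le> ennreal S"
proof -
  \<comment> \<open>The half compensates \<open>(1 + y)\<^sup>2 \<le> 2 + 2 * y\<^sup>2\<close>: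
    \<open>2 * m\<close> is at most the constant 1 in the bracket and at most
    \<open>\<bar>c\<bar>\<close>.\<close>
  define m where "m = min 1 \<bar>c\<bar> / 2"
  have m: "m > 0" "m \<le> 1/2" "2 * m \<le> \<bar>c\<bar>" using assms by (auto simp: m_def min_def)
  define S where "S = m powr (- a) * (2 * (2 powr (2 * a) * bracket_integral (2 * a)))"
  have "(\<integral>\<^sup>+n. ennreal (bracket (A + B * of_int n + c * (of_int n)\<^sup>2) powr (- a)) \<partial>count_space UNIV)
    \<le> ennreal S" for A B
  proof -
    obtain r1 r2 where r: "\<And>x. \<bar>A + B * x + c * x\<^sup>2\<bar> \<ge> \<bar>c\<bar> * (min \<bar>x - r1\<bar> \<bar>x - r2\<bar>)\<^sup>2"
      using quadratic_ge_dist_squared[OF assms(1)] by blast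
    let ?q = "\<lambda>x. bracket (A + B * x + c * x\<^sup>2)"
    have *: "?q x powr (- a) \<le> m powr (- a) * (bracket (x - r1) powr (- (2 * a)) + bracket (x - r2) powr (- (2 * a)))" for x
    proof -
      define y where "y = min \<bar>x - r1\<bar> \<bar>x - r2\<bar>"
      have y: "y \<ge> 0" by (simp add: y_def)
      have "m * (1 + y)\<^sup>2 \<le> m * (2 + 2 * y\<^sup>2)"
        using m(1) zero_le_power2[of "1 - y"]
        by (intro mult_left_mono) (auto simp: power2_sum power2_diff)
      also have "\<dots> \<le> 1 + \<bar>c\<bar> * y\<^sup>2"
        using m mult_right_mono[OF m(3), of "y\<^sup>2"] by (simp add: algebra_simps)
      also have "\<dots> \<le> ?q x"
        using r[of x] by (simp add: bracket_def y_def)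
      finally have "?q x powr (- a) \<le> (m * (1 + y)\<^sup>2) powr (- a)"
        using m y assms by (intro powr_mono2') auto
      also have "\<dots> = m powr (- a) * (1 + y) powr (- (2 * a))"
      proof -
        have "(1 + y)\<^sup>2 = (1 + y) powr 2"
          using y by simp
        then show ?thesis
          using m y by (simp only: powr_mult powr_powr) simp
      qed
      also have "(1 + y) powr (- (2 * a)) \<le> bracket (x - r1) powr (- (2 * a)) + bracket (x - r2) powr (- (2 * a))"
        by (auto simp: y_def min_def bracket_def)
      finally show ?thesis by (simp add: mult_left_mono)
    qed
    have "(\<integral>\<^sup>+n. ennreal (?q (of_int n) powr (- a)) \<partial>count_space UNIV)
      \<le> (\<integral>\<^sup>+n. ennreal (m powr (- a)) * (ennreal (bracket (of_int n - r1) powr (- (2 * a))) + ennreal (bracket (of_int n - r2) powr (- (2 * a)))) \<partial>count_space UNIV)"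
      using * by (intro nn_integral_mono) (simp add: ennreal_mult[symmetric] ennreal_plus[symmetric] del: ennreal_plus)
    also have "\<dots> = ennreal (m powr (- a)) * ((\<integral>\<^sup>+n. ennreal (bracket (of_int n - r1) powr (- (2 * a))) \<partial>count_space UNIV) + (\<integral>\<^sup>+n. ennreal (bracket (of_int n - r2) powr (- (2 * a))) \<partial>count_space UNIV))"
      by (simp add: nn_integral_cmult nn_integral_add)
    also have "\<dots> \<le> ennreal (m powr (- a)) * (ennreal (2 powr (2 * a) * bracket_integral (2 * a)) + ennreal (2 powr (2 * a) * bracket_integral (2 * a)))"
      using assms by (intro mult_left_mono add_mono bracket_sum_le) auto
    also have "\<dots> = ennreal S"
      by (simp add: S_def ennreal_mult[symmetric] ennreal_plus[symmetric] del: ennreal_plus)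
    finally show ?thesis .
  qed
  moreover have "S \<ge> 0"
    by (simp add: S_def)
  ultimately show ?thesis
    by blast
qed

text \<open>The bracket of \<open>A - B\<close> is at most the sum of the two brackets in the
  integrand, so a power 5/8 of it can be bought from one of the factors. That factor keeps 1/4,
  which together with the 7/8 of the other leaves the integrable exponent 9/8.\<close>

lemma bracket_convolution_le:
  "(\<integral>\<^sup>+x. ennreal (bracket (x + A) powr (-7/8) * bracket (x + B) powr (-7/8)) \<partial>lborel)
    \<le> ennreal (8 * bracket_integral (9/8)) * ennreal (bracket (A - B) powr (-5/8))"
proof -
  have *: "bracket (x + A) powr (-7/8) * bracket (x + B) powr (-7/8)
      \<le> (4 * bracket (A - B) powr (-5/8)) * (bracket (x + A) powr (- (9/8)) + bracket (x + B) powr (- (9/8)))" for x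
  proof -
    define p q D where "p = bracket (x + A)" "q = bracket (x + B)" "D = bracket (A - B)"
    have pos: "p \<ge> 1" "q \<ge> 1" "D \<ge> 1" by (auto simp: p_q_D_def)
    have "A - B = (x + A) - (x + B)" by simp
    then have "D \<le> p + q" unfolding p_q_D_def by (metis bracket_diff_le)
    then have "D \<le> 2 * max p q" by linarith
    then have "D powr (5/8) \<le> (2 * max p q) powr (5/8)"
      using pos by (intro powr_mono2) auto
    also have "\<dots> = 2 powr (5/8) * max p q powr (5/8)"
      using pos by (simp add: powr_mult)
    also have "\<dots> \<le> 2 * (p powr (5/8) + q powr (5/8))"
      using powr_mono[of "5/8" 1 "2::real"] by (intro mult_mono) (auto simp: max_def)
    finally have D: "D powr (5/8) \<le> 2 * (p powr (5/8) + q powr (5/8))" .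
    have e1: "p powr (5/8) * p powr (-7/8) = p powr (-(1/4))" "q powr (5/8) * q powr (-7/8) = q powr (-(1/4))"
      using pos by (simp_all add: powr_add[symmetric])
    have e2: "D powr (5/8) * D powr (-5/8) = 1"
      using pos by (simp add: powr_add[symmetric])
    have "2 * (p powr (5/8) + q powr (5/8)) * (p powr (-7/8) * q powr (-7/8))
        = 2 * ((p powr (5/8) * p powr (-7/8)) * q powr (-7/8) + (q powr (5/8) * q powr (-7/8)) * p powr (-7/8))"
      by (simp add: algebra_simps)
    also have "\<dots> = 2 * (p powr (-(1/4)) * q powr (-(7/8)) + q powr (-(1/4)) * p powr (-(7/8)))"
      unfolding e1 by simp
    also have "\<dots> \<le> 2 * ((p powr (-(1/4 + 7/8)) + q powr (-(1/4 + 7/8))) + (q powr (-(1/4 + 7/8)) + p powr (-(1/4 + 7/8))))"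
      using pos by (intro mult_left_mono add_mono powr_mult_le_sum_powr) auto
    also have "\<dots> = 4 * (p powr (- (9/8)) + q powr (- (9/8)))" by simp
    finally have "2 * (p powr (5/8) + q powr (5/8)) * (p powr (-7/8) * q powr (-7/8))
        \<le> 4 * (p powr (- (9/8)) + q powr (- (9/8)))" .
    note inner = this
    have "p powr (-7/8) * q powr (-7/8) = D powr (-5/8) * (D powr (5/8) * (p powr (-7/8) * q powr (-7/8)))"
    proof -
      have "D powr (-5/8) * (D powr (5/8) * z) = (D powr (5/8) * D powr (-5/8)) * z" for z
        by (simp only: ac_simps)
      then show ?thesis
        by (simp only: e2 mult_1)
    qed
    also have "\<dots> \<le> D powr (-5/8) * (2 * (p powr (5/8) + q powr (5/8)) * (p powr (-7/8) * q powr (-7/8)))"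
      using D by (intro mult_left_mono mult_right_mono) auto
    also have "\<dots> \<le> D powr (-5/8) * (4 * (p powr (- (9/8)) + q powr (- (9/8))))"
      by (rule mult_left_mono[OF inner]) simp
    finally show ?thesis
      unfolding p_q_D_def by (simp only: ac_simps)
  qed
  have "(\<integral>\<^sup>+x. ennreal (bracket (x + A) powr (-7/8) * bracket (x + B) powr (-7/8)) \<partial>lborel)
    \<le> (\<integral>\<^sup>+x. ennreal (4 * bracket (A - B) powr (-5/8)) * (ennreal (bracket (x + A) powr (- (9/8))) + ennreal (bracket (x + B) powr (- (9/8)))) \<partial>lborel)"
    using * by (intro nn_integral_mono) (simp add: ennreal_mult[symmetric] ennreal_plus[symmetric] del: ennreal_plus)
  also have "\<dots> = ennreal (4 * bracket (A - B) powr (-5/8)) * (ennreal (bracket_integral (9/8)) + ennreal (bracket_integral (9/8)))"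
    by (simp add: nn_integral_cmult nn_integral_add nn_integral_bracket_shift)
  also have "\<dots> = ennreal (8 * bracket_integral (9/8)) * ennreal (bracket (A - B) powr (-5/8))"
    by (simp add: ennreal_mult[symmetric] ennreal_plus[symmetric] del: ennreal_plus)
  finally show ?thesis .
qed

section \<open>Trilinear forms on the frequency space\<close>

text \<open>Spatial and time frequency form one variable, so that componentwise addition of pairs
  describes the frequency of a product and Tonelli treats sums and integrals at once.\<close>

definition freq :: "(int \<times> real) measure" where
  "freq = count_space UNIV \<Otimes>\<^sub>M lborel"

lemma space_freq [simp]: "space freq = UNIV"
  by (simp add: freq_def space_pair_measure)

lemma sets_freq [measurable_cong]: "sets freq = sets (count_space UNIV \<Otimes>\<^sub>M borel)"
  unfolding freq_def by (intro sets_pair_measure_cong) auto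

interpretation freq: sigma_finite_measure freq
  unfolding freq_def by (rule int_lborel.sigma_finite_measure_axioms)

interpretation freq_pair: pair_sigma_finite freq freq
  by (rule pair_sigma_finite.intro) (rule freq.sigma_finite_measure_axioms)+

text \<open>The first factor is countable, so measurability of the slices is enough.\<close>

lemma borel_measurable_freqI:
  assumes "\<And>n. (\<lambda>\<tau>. f (n, \<tau>)) \<in> borel_measurable borel"
  shows "f \<in> borel_measurable freq"
  unfolding freq_def by (intro measurable_pair_measure_countable1) (use assms in auto)

lemma nn_integral_freq:
  assumes "f \<in> borel_measurable freq"
  shows "(\<integral>\<^sup>+z. f z \<partial>freq) = (\<integral>\<^sup>+n. (\<integral>\<^sup>+\<tau>. f (n, \<tau>) \<partial>lborel) \<partial>count_space UNIV)"
  using assms unfolding freq_def by (rule lborel.nn_integral_fst[symmetric])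

section \<open>Translations of the frequency space\<close>

lemma measurable_int_add [measurable (raw)]:
  fixes f g :: "'a \<Rightarrow> int"
  assumes "f \<in> measurable M (count_space UNIV)" "g \<in> measurable M (count_space UNIV)"
  shows "(\<lambda>x. f x + g x) \<in> measurable M (count_space UNIV)"
  by (rule measurable_compose_countable[OF _ assms(1)])
     (rule measurable_compose[OF assms(2)], simp)

lemma measurable_int_diff [measurable (raw)]:
  fixes f g :: "'a \<Rightarrow> int"
  assumes "f \<in> measurable M (count_space UNIV)" "g \<in> measurable M (count_space UNIV)"
  shows "(\<lambda>x. f x - g x) \<in> measurable M (count_space UNIV)"
  by (rule measurable_compose_countable[OF _ assms(1)])
     (rule measurable_compose[OF assms(2)], simp)

lemma measurable_freq_add [measurable (raw)]:
  assumes [measurable]: "f \<in> measurable M freq" "g \<in> measurable M freq"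
  shows "(\<lambda>x. f x + g x) \<in> measurable M freq"
proof -
  have [measurable]: "f \<in> measurable M (count_space UNIV \<Otimes>\<^sub>M borel)"
      "g \<in> measurable M (count_space UNIV \<Otimes>\<^sub>M borel)"
    using assms by (simp_all add: measurable_cong_sets[OF refl sets_freq])
  have "(\<lambda>x. (fst (f x) + fst (g x), snd (f x) + snd (g x))) \<in> measurable M (count_space UNIV \<Otimes>\<^sub>M borel)"
    by measurable
  then have "(\<lambda>x. (fst (f x) + fst (g x), snd (f x) + snd (g x))) \<in> measurable M freq"
    by (simp add: measurable_cong_sets[OF refl sets_freq])
  then show ?thesis
    by (simp add: plus_prod_def)
qed

lemma measurable_freq_diff [measurable (raw)]:
  assumes [measurable]: "f \<in> measurable M freq" "g \<in> measurable M freq"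
  shows "(\<lambda>x. f x - g x) \<in> measurable M freq"
proof -
  have [measurable]: "f \<in> measurable M (count_space UNIV \<Otimes>\<^sub>M borel)"
      "g \<in> measurable M (count_space UNIV \<Otimes>\<^sub>M borel)"
    using assms by (simp_all add: measurable_cong_sets[OF refl sets_freq])
  have "(\<lambda>x. (fst (f x) - fst (g x), snd (f x) - snd (g x))) \<in> measurable M (count_space UNIV \<Otimes>\<^sub>M borel)"
    by measurable
  then have "(\<lambda>x. (fst (f x) - fst (g x), snd (f x) - snd (g x))) \<in> measurable M freq"
    by (simp add: measurable_cong_sets[OF refl sets_freq])
  then show ?thesis
    by (simp add: minus_prod_def)
qed

lemma nn_integral_freq_shift:
  assumes [measurable]: "f \<in> borel_measurable freq"
  shows "(\<integral>\<^sup>+z. f (a + z) \<partial>freq) = (\<integral>\<^sup>+z. f z \<partial>freq)"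
proof -
  have [measurable]: "(\<lambda>\<tau>. f (n, \<tau>)) \<in> borel_measurable borel" for n
    by measurable
  have "bij_betw (\<lambda>n. fst a + n) UNIV UNIV"
    by (intro bij_betwI[where g = "\<lambda>n. n - fst a"]) auto
  then have "(\<integral>\<^sup>+z. f z \<partial>freq) = (\<integral>\<^sup>+n. (\<integral>\<^sup>+\<tau>. f (fst a + n, \<tau>) \<partial>lborel) \<partial>count_space UNIV)"
    by (subst nn_integral_freq) (auto intro!: nn_integral_bij_count_space[symmetric])
  also have "\<dots> = (\<integral>\<^sup>+n. (\<integral>\<^sup>+\<tau>. f (fst a + n, snd a + \<tau>) \<partial>lborel) \<partial>count_space UNIV)"
  proof (rule nn_integral_cong)
    fix n
    show "(\<integral>\<^sup>+\<tau>. f (fst a + n, \<tau>) \<partial>lborel) = (\<integral>\<^sup>+\<tau>. f (fst a + n, snd a + \<tau>) \<partial>lborel)"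
      by (subst nn_integral_real_affine[of _ 1 "snd a"]) auto
  qed
  also have "\<dots> = (\<integral>\<^sup>+z. f (a + z) \<partial>freq)"
    by (subst nn_integral_freq) (auto intro!: borel_measurable_freqI simp: plus_prod_def)
  finally show ?thesis ..
qed

text \<open>Squares of norms are used until the Bourgain norms return at the end, so that duality
  and Cauchy-Schwarz involve no square root of a possibly infinite value.\<close>

definition l2sq :: "(int \<times> real \<Rightarrow> ennreal) \<Rightarrow> ennreal" where
  "l2sq f = (\<integral>\<^sup>+z. (f z)\<^sup>2 \<partial>freq)"

text \<open>In the applications \<open>f\<close> sits at the frequency of the Y function,
  \<open>g\<close> and \<open>h\<close> at those of the two X functions, and \<open>K\<close>
  collects the weights.\<close>

definition trilinear ::
    "(int \<times> real \<Rightarrow> int \<times> real \<Rightarrow> ennreal) \<Rightarrow> (int \<times> real \<Rightarrow> ennreal) \<Rightarrow> (int \<times> real \<Rightarrow> ennreal)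
      \<Rightarrow> (int \<times> real \<Rightarrow> ennreal) \<Rightarrow> ennreal" where
  "trilinear K f g h = (\<integral>\<^sup>+y. (\<integral>\<^sup>+p. K y p * f y * g p * h (y + p) \<partial>freq) \<partial>freq)"

text \<open>Cauchy-Schwarz twice: in \<open>y\<close> to split off \<open>f\<close>, then in
  \<open>x\<close> to split \<open>K\<close> from \<open>R\<close>. With \<open>R\<close> arbitrary,
  any of the three frequencies can play the part of \<open>y\<close>.\<close>

lemma trilinear_Cauchy_Schwarz:
  assumes [measurable]: "case_prod K \<in> borel_measurable (freq \<Otimes>\<^sub>M freq)"
    "f \<in> borel_measurable freq" "case_prod R \<in> borel_measurable (freq \<Otimes>\<^sub>M freq)"
  assumes K: "\<And>y. (\<integral>\<^sup>+x. (K y x)\<^sup>2 \<partial>freq) \<le> S"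
  shows "(\<integral>\<^sup>+y. (\<integral>\<^sup>+x. K y x * f y * R y x \<partial>freq) \<partial>freq)\<^sup>2
    \<le> S * l2sq f * (\<integral>\<^sup>+y. (\<integral>\<^sup>+x. (R y x)\<^sup>2 \<partial>freq) \<partial>freq)"
proof -
  have [measurable]: "K y \<in> borel_measurable freq" "R y \<in> borel_measurable freq" for y
    using measurable_Pair2[OF assms(1), of y] measurable_Pair2[OF assms(3), of y] by simp_all
  have "(\<integral>\<^sup>+y. (\<integral>\<^sup>+x. K y x * f y * R y x \<partial>freq) \<partial>freq)\<^sup>2
      = (\<integral>\<^sup>+y. f y * (\<integral>\<^sup>+x. K y x * R y x \<partial>freq) \<partial>freq)\<^sup>2"
    by (subst nn_integral_cmult[symmetric]) (auto simp: ac_simps intro!: arg_cong[where f="\<lambda>x. x\<^sup>2"] nn_integral_cong)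
  also have "\<dots> \<le> l2sq f * (\<integral>\<^sup>+y. (\<integral>\<^sup>+x. K y x * R y x \<partial>freq)\<^sup>2 \<partial>freq)"
    unfolding l2sq_def by (rule Cauchy_Schwarz_nn_integral) measurable
  also have "\<dots> \<le> l2sq f * (\<integral>\<^sup>+y. S * (\<integral>\<^sup>+x. (R y x)\<^sup>2 \<partial>freq) \<partial>freq)"
  proof (intro mult_left_mono nn_integral_mono)
    fix y
    have "(\<integral>\<^sup>+x. K y x * R y x \<partial>freq)\<^sup>2 \<le> (\<integral>\<^sup>+x. (K y x)\<^sup>2 \<partial>freq) * (\<integral>\<^sup>+x. (R y x)\<^sup>2 \<partial>freq)"
      by (rule Cauchy_Schwarz_nn_integral) measurable
    also have "\<dots> \<le> S * (\<integral>\<^sup>+x. (R y x)\<^sup>2 \<partial>freq)"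
      by (intro mult_right_mono K) simp
    finally show "(\<integral>\<^sup>+x. K y x * R y x \<partial>freq)\<^sup>2 \<le> S * (\<integral>\<^sup>+x. (R y x)\<^sup>2 \<partial>freq)" .
  qed simp
  also have "(\<integral>\<^sup>+y. S * (\<integral>\<^sup>+x. (R y x)\<^sup>2 \<partial>freq) \<partial>freq) = S * (\<integral>\<^sup>+y. (\<integral>\<^sup>+x. (R y x)\<^sup>2 \<partial>freq) \<partial>freq)"
    by (rule nn_integral_cmult) measurable
  finally show ?thesis
    by (simp add: ac_simps)
qed

text \<open>For fixed \<open>x\<close> the shift \<open>y + x\<close> preserves the measure, so the
  double integral factorises.\<close>

lemma l2sq_tensor_shear:
  assumes [measurable]: "g \<in> borel_measurable freq" "h \<in> borel_measurable freq"
  shows "(\<integral>\<^sup>+y. (\<integral>\<^sup>+x. (g x * h (y + x))\<^sup>2 \<partial>freq) \<partial>freq) = l2sq g * l2sq h"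
proof -
  have "(\<integral>\<^sup>+y. (\<integral>\<^sup>+x. (g x * h (y + x))\<^sup>2 \<partial>freq) \<partial>freq)
      = (\<integral>\<^sup>+x. (\<integral>\<^sup>+y. (g x * h (y + x))\<^sup>2 \<partial>freq) \<partial>freq)"
    by (rule freq_pair.Fubini') measurable
  also have "\<dots> = (\<integral>\<^sup>+x. (g x)\<^sup>2 * (\<integral>\<^sup>+y. (h (x + y))\<^sup>2 \<partial>freq) \<partial>freq)"
    by (intro nn_integral_cong) (simp add: power_mult_distrib nn_integral_cmult add.commute)
  also have "\<dots> = (\<integral>\<^sup>+x. (g x)\<^sup>2 * l2sq h \<partial>freq)"
    unfolding l2sq_def by (subst nn_integral_freq_shift[where f = "\<lambda>z. (h z)\<^sup>2"]) auto
  also have "\<dots> = l2sq g * l2sq h"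
    unfolding l2sq_def by (rule nn_integral_multc) measurable
  finally show ?thesis .
qed

text \<open>The frequency held fixed is the one whose modulation was discarded. This bound,
  \<open>trilinear_bound_snd\<close> and \<open>trilinear_bound_output\<close> fix \<open>y\<close>,
  \<open>p\<close> and \<open>y + p\<close> in turn.\<close>

lemma trilinear_bound_fst:
  assumes "case_prod K \<in> borel_measurable (freq \<Otimes>\<^sub>M freq)"
    and [measurable]: "f \<in> borel_measurable freq" "g \<in> borel_measurable freq" "h \<in> borel_measurable freq"
    and "\<And>y. (\<integral>\<^sup>+p. (K y p)\<^sup>2 \<partial>freq) \<le> S"
  shows "(trilinear K f g h)\<^sup>2 \<le> S * l2sq f * l2sq g * l2sq h"
proof -
  have "(\<lambda>(y, x). g x * h (y + x)) \<in> borel_measurable (freq \<Otimes>\<^sub>M freq)"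
    by measurable
  from trilinear_Cauchy_Schwarz[OF assms(1,2) this assms(5)] show ?thesis
    by (simp add: trilinear_def l2sq_tensor_shear mult.assoc)
qed

lemma trilinear_bound_snd:
  assumes [measurable]: "case_prod K \<in> borel_measurable (freq \<Otimes>\<^sub>M freq)"
    "f \<in> borel_measurable freq" "g \<in> borel_measurable freq" "h \<in> borel_measurable freq"
  assumes "\<And>p. (\<integral>\<^sup>+y. (K y p)\<^sup>2 \<partial>freq) \<le> S"
  shows "(trilinear K f g h)\<^sup>2 \<le> S * l2sq f * l2sq g * l2sq h"
proof -
  \<comment> \<open>The form is symmetric under exchange of \<open>y\<close> and \<open>p\<close>
    together with \<open>f\<close> and \<open>g\<close>, because \<open>h\<close> sees only their
    sum.\<close>
  have "trilinear K f g h = trilinear (\<lambda>p y. K y p) g f h"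
    unfolding trilinear_def
    by (subst freq_pair.Fubini') (measurable, simp add: ac_simps)
  moreover have "(\<lambda>(p, y). K y p) \<in> borel_measurable (freq \<Otimes>\<^sub>M freq)"
    by measurable
  ultimately show ?thesis
    using trilinear_bound_fst[of "\<lambda>p y. K y p" g f h S] assms by (simp add: ac_simps)
qed

text \<open>The substitution \<open>q = y + p\<close> at fixed \<open>y\<close>, followed by
  Tonelli, makes the argument of \<open>h\<close> the outer variable. Both the test at fixed output
  and the duality argument for the X norm start from this form.\<close>

lemma trilinear_eq_output:
  assumes [measurable]: "case_prod K \<in> borel_measurable (freq \<Otimes>\<^sub>M freq)"
    "f \<in> borel_measurable freq" "g \<in> borel_measurable freq" "h \<in> borel_measurable freq"
  shows "trilinear K f g h = (\<integral>\<^sup>+q. (\<integral>\<^sup>+y. K y (q - y) * f y * g (q - y) * h q \<partial>freq) \<partial>freq)"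
proof -
  have [measurable]: "K y \<in> borel_measurable freq" for y
    using measurable_Pair2[OF assms(1), of y] by simp
  have [measurable]: "(\<lambda>q. K y (q - y)) \<in> borel_measurable freq" for y
    by (rule measurable_compose[of "\<lambda>q. q - y"]) measurable
  have "(\<integral>\<^sup>+p. K y p * f y * g p * h (y + p) \<partial>freq)
      = (\<integral>\<^sup>+q. K y (q - y) * f y * g (q - y) * h q \<partial>freq)" for y
  proof -
    have "(\<lambda>q. K y (q - y) * f y * g (q - y) * h q) \<in> borel_measurable freq"
      by measurable
    from nn_integral_freq_shift[OF this, of y] show ?thesis
      by simp
  qed
  then have "trilinear K f g h = (\<integral>\<^sup>+y. (\<integral>\<^sup>+q. K y (q - y) * f y * g (q - y) * h q \<partial>freq) \<partial>freq)"
    by (simp add: trilinear_def)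
  also have "\<dots> = (\<integral>\<^sup>+q. (\<integral>\<^sup>+y. K y (q - y) * f y * g (q - y) * h q \<partial>freq) \<partial>freq)"
    by (rule freq_pair.Fubini') measurable
  finally show ?thesis .
qed

lemma trilinear_bound_output:
  assumes [measurable]: "case_prod K \<in> borel_measurable (freq \<Otimes>\<^sub>M freq)"
    "f \<in> borel_measurable freq" "g \<in> borel_measurable freq" "h \<in> borel_measurable freq"
  assumes "\<And>q. (\<integral>\<^sup>+y. (K y (q - y))\<^sup>2 \<partial>freq) \<le> S"
  shows "(trilinear K f g h)\<^sup>2 \<le> S * l2sq f * l2sq g * l2sq h"
proof -
  have K': "(\<lambda>(q, y). K y (q - y)) \<in> borel_measurable (freq \<Otimes>\<^sub>M freq)"
    and R: "(\<lambda>(q, y). f y * g (q - y)) \<in> borel_measurable (freq \<Otimes>\<^sub>M freq)"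
    by measurable
  have "(\<integral>\<^sup>+q. (\<integral>\<^sup>+y. (f y * g (q - y))\<^sup>2 \<partial>freq) \<partial>freq)
      = (\<integral>\<^sup>+y. (\<integral>\<^sup>+q. (f y)\<^sup>2 * (g (q - y))\<^sup>2 \<partial>freq) \<partial>freq)"
    unfolding power_mult_distrib by (rule freq_pair.Fubini') measurable
  also have "\<dots> = (\<integral>\<^sup>+y. (f y)\<^sup>2 * (\<integral>\<^sup>+q. (g (q - y))\<^sup>2 \<partial>freq) \<partial>freq)"
    by (intro nn_integral_cong nn_integral_cmult) measurable
  also have "\<dots> = (\<integral>\<^sup>+y. (f y)\<^sup>2 * l2sq g \<partial>freq)"
  proof (rule nn_integral_cong)
    fix y
    have "(\<integral>\<^sup>+q. (g (q - y))\<^sup>2 \<partial>freq) = l2sq g"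
      using nn_integral_freq_shift[where f = "\<lambda>z. (g z)\<^sup>2" and a = "- y"] by (simp add: l2sq_def)
    then show "(f y)\<^sup>2 * (\<integral>\<^sup>+q. (g (q - y))\<^sup>2 \<partial>freq) = (f y)\<^sup>2 * l2sq g"
      by simp
  qed
  also have "\<dots> = l2sq f * l2sq g"
    unfolding l2sq_def by (rule nn_integral_multc) measurable
  finally have R2: "(\<integral>\<^sup>+q. (\<integral>\<^sup>+y. (f y * g (q - y))\<^sup>2 \<partial>freq) \<partial>freq) = l2sq f * l2sq g" .
  have "trilinear K f g h = (\<integral>\<^sup>+q. (\<integral>\<^sup>+y. K y (q - y) * h q * (f y * g (q - y)) \<partial>freq) \<partial>freq)"
    using trilinear_eq_output[OF assms(1-4)] by (simp add: ac_simps)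
  with trilinear_Cauchy_Schwarz[OF K' assms(4) R assms(5)] show ?thesis
    by (simp add: R2 ac_simps)
qed

lemma trilinear_mono:
  assumes "\<And>y p. K y p \<le> K' y p"
  shows "trilinear K f g h \<le> trilinear K' f g h"
  unfolding trilinear_def by (intro nn_integral_mono mult_right_mono assms) auto

lemma trilinear_add:
  assumes [measurable]: "case_prod K \<in> borel_measurable (freq \<Otimes>\<^sub>M freq)"
    "case_prod K' \<in> borel_measurable (freq \<Otimes>\<^sub>M freq)"
    "f \<in> borel_measurable freq" "g \<in> borel_measurable freq" "h \<in> borel_measurable freq"
  shows "trilinear (\<lambda>y p. K y p + K' y p) f g h = trilinear K f g h + trilinear K' f g h"
  unfolding trilinear_def
proof -
  have [measurable]: "K y \<in> borel_measurable freq" "K' y \<in> borel_measurable freq" for y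
    using measurable_Pair2[OF assms(1), of y] measurable_Pair2[OF assms(2), of y] by simp_all
  show "(\<integral>\<^sup>+y. (\<integral>\<^sup>+p. (K y p + K' y p) * f y * g p * h (y + p) \<partial>freq) \<partial>freq)
    = (\<integral>\<^sup>+y. (\<integral>\<^sup>+p. K y p * f y * g p * h (y + p) \<partial>freq) \<partial>freq)
      + (\<integral>\<^sup>+y. (\<integral>\<^sup>+p. K' y p * f y * g p * h (y + p) \<partial>freq) \<partial>freq)"
    by (simp add: distrib_right nn_integral_add)
qed

lemma trilinear_cmult:
  assumes [measurable]: "case_prod K \<in> borel_measurable (freq \<Otimes>\<^sub>M freq)"
    "f \<in> borel_measurable freq" "g \<in> borel_measurable freq" "h \<in> borel_measurable freq"
  shows "trilinear (\<lambda>y p. c * K y p) f g h = c * trilinear K f g h"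
  unfolding trilinear_def
proof -
  have [measurable]: "K y \<in> borel_measurable freq" for y
    using measurable_Pair2[OF assms(1), of y] by simp
  show "(\<integral>\<^sup>+y. (\<integral>\<^sup>+p. c * K y p * f y * g p * h (y + p) \<partial>freq) \<partial>freq)
    = c * (\<integral>\<^sup>+y. (\<integral>\<^sup>+p. K y p * f y * g p * h (y + p) \<partial>freq) \<partial>freq)"
    by (simp add: mult.assoc nn_integral_cmult)
qed

text \<open>Testing against truncations of \<open>F\<close> itself avoids assuming that \<open>F\<close> is square integrable.\<close>

lemma l2sq_le_by_duality:
  assumes [measurable]: "F \<in> borel_measurable freq"
    and dual: "\<And>h. h \<in> borel_measurable freq \<Longrightarrow> (\<integral>\<^sup>+z. F z * h z \<partial>freq)\<^sup>2 \<le> A * l2sq h"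
  shows "l2sq F \<le> A"
proof -
  obtain E :: "nat \<Rightarrow> (int \<times> real) set" where E: "range E \<subseteq> sets freq" "(\<Union>i. E i) = space freq"
      "\<And>i. emeasure freq (E i) \<noteq> \<infinity>" "incseq E"
    by (rule freq.sigma_finite_incseq) (rule that)
  have [measurable]: "E i \<in> sets freq" for i using E by auto
  define h where "h i z = min (F z) (of_nat i) * indicator (E i) z" for i z
  have [measurable]: "h i \<in> borel_measurable freq" for i
    unfolding h_def by measurable
  have le: "l2sq (h i) \<le> A" for i
  proof -
    have "l2sq (h i) \<le> (\<integral>\<^sup>+z. (of_nat i)\<^sup>2 * indicator (E i) z \<partial>freq)"
      unfolding l2sq_def h_def
      by (intro nn_integral_mono) (auto split: split_indicator intro!: power_mono_ennreal)
    also have "\<dots> = (of_nat i)\<^sup>2 * emeasure freq (E i)"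
      by (simp add: nn_integral_cmult)
    also have "\<dots> < \<infinity>"
      using E(3)[of i] by (simp add: ennreal_mult_less_top power_less_top_ennreal less_top of_nat_less_top)
    finally have fin: "l2sq (h i) < \<infinity>" .
    have "l2sq (h i) \<le> (\<integral>\<^sup>+z. F z * h i z \<partial>freq)"
      unfolding l2sq_def h_def power2_eq_square
      by (intro nn_integral_mono mult_right_mono) (auto split: split_indicator)
    then have "(l2sq (h i))\<^sup>2 \<le> (\<integral>\<^sup>+z. F z * h i z \<partial>freq)\<^sup>2"
      by (rule power_mono_ennreal)
    also have "\<dots> \<le> A * l2sq (h i)"
      by (rule dual) measurable
    finally have *: "l2sq (h i) * l2sq (h i) \<le> A * l2sq (h i)"
      by (simp add: power2_eq_square)
    \<comment> \<open>One factor \<open>l2sq (h i)\<close> is cancelled from \<open>*\<close>. It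
      has to be finite for that, which is why \<open>h i\<close> is cut off both in height and in
      support.\<close>
    show ?thesis
    proof (rule ccontr)
      assume "\<not> l2sq (h i) \<le> A"
      then have "A < l2sq (h i)" by simp
      then have "A * l2sq (h i) < l2sq (h i) * l2sq (h i)"
        using fin by (intro ennreal_mult_strict_right_mono) (auto simp: order_le_less_trans[OF zero_le])
      with * show False by simp
    qed
  qed
  have mono: "incseq (\<lambda>i z. (h i z)\<^sup>2)"
  proof (intro monoI le_funI power_mono_ennreal)
    fix i j :: nat and z assume "i \<le> j"
    then have "of_nat i \<le> (of_nat j :: ennreal)" "indicator (E i) z \<le> (indicator (E j) z :: ennreal)"
      using E(4) by (auto simp: incseq_def split: split_indicator)
    then show "h i z \<le> h j z"
      unfolding h_def by (intro mult_mono min.mono) auto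
  qed
  have sup: "(SUP i. (h i z)\<^sup>2) = (F z)\<^sup>2" for z
  proof -
    have "(\<lambda>i. min (F z) (of_nat i) * indicator (E i) z) \<longlonglongrightarrow> F z"
    proof -
      obtain i0 where i0: "z \<in> E i0" using E(2) by auto
      have ev: "eventually (\<lambda>i. min (F z) (of_nat i) = min (F z) (of_nat i) * indicator (E i) z) sequentially"
        using E(4) i0 by (intro eventually_sequentiallyI[of i0]) (auto simp: incseq_def split: split_indicator)
      have "(\<lambda>i. min (F z) (of_nat i)) \<longlonglongrightarrow> min (F z) top"
        by (intro tendsto_intros of_nat_tendsto_top_ennreal)
      from Lim_transform_eventually[OF this ev] show ?thesis
        by simp
    qed
    then have "(\<lambda>i. (h i z)\<^sup>2) \<longlonglongrightarrow> (F z)\<^sup>2"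
      unfolding h_def power2_eq_square by (intro tendsto_mult_ennreal) auto
    moreover have "incseq (\<lambda>i. (h i z)\<^sup>2)"
      using mono unfolding incseq_def le_fun_def by blast
    ultimately show ?thesis
      using LIMSEQ_SUP LIMSEQ_unique by blast
  qed
  have "l2sq F = (\<integral>\<^sup>+z. (SUP i. (h i z)\<^sup>2) \<partial>freq)"
    by (simp add: l2sq_def sup)
  also have "\<dots> = (SUP i. l2sq (h i))"
    unfolding l2sq_def by (rule nn_integral_monotone_convergence_SUP[OF mono]) measurable
  also have "\<dots> \<le> A"
    by (intro SUP_least le)
  finally show ?thesis .
qed

section \<open>Resonance\<close>

lemma powr_nonpos_le_1: "1 \<le> x \<Longrightarrow> a \<le> 0 \<Longrightarrow> x powr a \<le> (1::real)"
  using powr_mono[of a 0 x] by (cases "x = 0") auto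

text \<open>Vanishes on the spectral curve of the free Schroedinger evolution.\<close>

definition modX :: "int \<times> real \<Rightarrow> real" where
  "modX z = snd z + (of_int (fst z))\<^sup>2"

text \<open>Vanishes on the spectral curve of the free Benjamin-Ono evolution with coefficient
  \<gamma>.\<close>

definition modY :: "real \<Rightarrow> int \<times> real \<Rightarrow> real" where
  "modY \<gamma> z = snd z + \<gamma> * \<bar>of_int (fst z)\<bar> * of_int (fst z)"

lemma borel_measurable_modX [measurable]: "modX \<in> borel_measurable freq"
  by (rule borel_measurable_freqI) (simp add: modX_def)

lemma borel_measurable_modY [measurable]: "modY \<gamma> \<in> borel_measurable freq"
  by (rule borel_measurable_freqI) (simp add: modY_def)

definition bracket_freq :: "int \<times> real \<Rightarrow> real" where
  "bracket_freq z = bracket (of_int (fst z))"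

lemma borel_measurable_bracket_freq [measurable]: "bracket_freq \<in> borel_measurable freq"
  by (rule borel_measurable_freqI) (simp add: bracket_freq_def)

lemma bracket_freq_ge_1 [simp]: "1 \<le> bracket_freq z"
  by (simp add: bracket_freq_def)

lemma bracket_freq_pos [simp]: "0 < bracket_freq z" "0 \<le> bracket_freq z"
  by (simp_all add: bracket_freq_def)

text \<open>The three modulations of an interaction cannot all be small: their combination is the
  resonance function \<open>k (k + 2 p - \<gamma> \<bar>k\<bar>)\<close>.\<close>

lemma resonance_identity:
  fixes y p :: "int \<times> real"
  shows "modX (y + p) - modY \<gamma> y - modX p
    = of_int (fst y) * (of_int (fst y) + 2 * of_int (fst p) - \<gamma> * \<bar>of_int (fst y)\<bar>)"
  by (simp add: modX_def modY_def power2_eq_square algebra_simps)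

text \<open>If \<open>p\<close> is small, the second factor is close to
  \<open>k - \<gamma> * \<bar>k\<bar>\<close>. If \<open>k + p\<close> is small,
  \<open>2 * p\<close> is close to \<open>- 2 * k\<close> and the factor is close to
  \<open>- (k + \<gamma> * \<bar>k\<bar>)\<close>. Both limits have size at least
  \<open>\<delta> * \<bar>k\<bar>\<close>, and the smallness condition keeps the error below half of
  that.\<close>

lemma resonance_lower_bound:
  fixes k p \<gamma> \<delta> :: real
  assumes "\<delta> > 0" "\<delta> \<le> \<bar>1 - \<gamma>\<bar>" "\<delta> \<le> \<bar>1 + \<gamma>\<bar>"
    and "4 * bracket p < \<delta> * \<bar>k\<bar> \<or> 4 * bracket (k + p) < \<delta> * \<bar>k\<bar>"
  shows "\<delta> / 2 * k\<^sup>2 \<le> \<bar>k * (k + 2 * p - \<gamma> * \<bar>k\<bar>)\<bar>"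
proof -
  \<comment> \<open>The sign of \<open>k\<close> exchanges the coefficients
    \<open>1 - \<gamma>\<close> and \<open>1 + \<gamma>\<close>, so each bound needs both of them
    away from 0.\<close>
  have lin: "\<delta> * \<bar>k\<bar> \<le> \<bar>k - \<gamma> * \<bar>k\<bar>\<bar>" "\<delta> * \<bar>k\<bar> \<le> \<bar>k + \<gamma> * \<bar>k\<bar>\<bar>"
  proof -
    have "\<bar>k - \<gamma> * \<bar>k\<bar>\<bar> = \<bar>1 - \<gamma>\<bar> * \<bar>k\<bar> \<and> \<bar>k + \<gamma> * \<bar>k\<bar>\<bar> = \<bar>1 + \<gamma>\<bar> * \<bar>k\<bar>" if "k \<ge> 0"
    proof -
      have "k - \<gamma> * \<bar>k\<bar> = (1 - \<gamma>) * k" "k + \<gamma> * \<bar>k\<bar> = (1 + \<gamma>) * k"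
        using that by (simp_all add: algebra_simps)
      then show ?thesis
        by (simp add: abs_mult)
    qed
    moreover have "\<bar>k - \<gamma> * \<bar>k\<bar>\<bar> = \<bar>1 + \<gamma>\<bar> * \<bar>k\<bar> \<and> \<bar>k + \<gamma> * \<bar>k\<bar>\<bar> = \<bar>1 - \<gamma>\<bar> * \<bar>k\<bar>" if "k < 0"
    proof -
      have "k - \<gamma> * \<bar>k\<bar> = (1 + \<gamma>) * k" "k + \<gamma> * \<bar>k\<bar> = (1 - \<gamma>) * k"
        using that by (simp_all add: algebra_simps)
      then show ?thesis
        by (simp add: abs_mult)
    qed
    moreover have "\<delta> * \<bar>k\<bar> \<le> \<bar>1 - \<gamma>\<bar> * \<bar>k\<bar>" "\<delta> * \<bar>k\<bar> \<le> \<bar>1 + \<gamma>\<bar> * \<bar>k\<bar>"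
      using assms by (auto intro: mult_right_mono)
    ultimately show "\<delta> * \<bar>k\<bar> \<le> \<bar>k - \<gamma> * \<bar>k\<bar>\<bar>" "\<delta> * \<bar>k\<bar> \<le> \<bar>k + \<gamma> * \<bar>k\<bar>\<bar>"
      by (cases "k \<ge> 0"; simp)+
  qed
  have "\<delta> / 2 * \<bar>k\<bar> \<le> \<bar>k + 2 * p - \<gamma> * \<bar>k\<bar>\<bar>"
    using assms(4)
  proof
    assume "4 * bracket p < \<delta> * \<bar>k\<bar>"
    then have "4 * \<bar>p\<bar> < \<delta> * \<bar>k\<bar>" by (simp add: bracket_def)
    with lin(1) show ?thesis by linarith
  next
    assume "4 * bracket (k + p) < \<delta> * \<bar>k\<bar>"
    then have "4 * \<bar>k + p\<bar> < \<delta> * \<bar>k\<bar>" by (simp add: bracket_def)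
    moreover have "\<bar>k + x\<bar> \<le> \<bar>k + 2 * p - x\<bar> + 2 * \<bar>k + p\<bar>" for x
      by (simp add: abs_if)
    from this[of "\<gamma> * \<bar>k\<bar>"] have "\<bar>k + \<gamma> * \<bar>k\<bar>\<bar> \<le> \<bar>k + 2 * p - \<gamma> * \<bar>k\<bar>\<bar> + 2 * \<bar>k + p\<bar>" .
    ultimately show ?thesis using lin(2) by linarith
  qed
  then have "\<bar>k\<bar> * (\<delta> / 2 * \<bar>k\<bar>) \<le> \<bar>k\<bar> * \<bar>k + 2 * p - \<gamma> * \<bar>k\<bar>\<bar>"
    by (intro mult_left_mono) auto
  moreover have "\<bar>k\<bar> * (\<delta> / 2 * \<bar>k\<bar>) = \<delta> / 2 * k\<^sup>2"
    by (simp add: power2_eq_square)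
  ultimately show ?thesis
    by (simp only: abs_mult)
qed

text \<open>The exponent \<open>7/16\<close> is below \<open>1/2\<close>, which leaves room for \<open>\<epsilon>\<close>, but so large that
  \<open>bracket_convolution_le\<close> retains a decay rate \<open>5/8 > 1/2\<close>, summable along quadratic polynomials.\<close>

definition decayX :: "int \<times> real \<Rightarrow> real" where
  "decayX z = bracket (modX z) powr (-7/16)"

definition decayY :: "real \<Rightarrow> int \<times> real \<Rightarrow> real" where
  "decayY \<gamma> z = bracket (modY \<gamma> z) powr (-7/16)"

lemma borel_measurable_decay [measurable]:
  "decayX \<in> borel_measurable freq" "decayY \<gamma> \<in> borel_measurable freq"
  by (simp_all add: decayX_def[abs_def] decayY_def[abs_def])

lemma decay_bounds [simp]: "0 \<le> decayX z" "0 \<le> decayY \<gamma> z" "decayX z \<le> 1" "decayY \<gamma> z \<le> 1"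
  by (auto simp: decayX_def decayY_def intro!: powr_nonpos_le_1)

lemma decay_squared:
  "(decayX z)\<^sup>2 = bracket (modX z) powr (-7/8)" "(decayY \<gamma> z)\<^sup>2 = bracket (modY \<gamma> z) powr (-7/8)"
  by (simp_all add: decayX_def decayY_def power2_eq_square powr_add[symmetric])

definition inv_sqrt_sum :: "int \<times> real \<Rightarrow> int \<times> real \<Rightarrow> real" where
  "inv_sqrt_sum y p = bracket_freq p powr (-1/2) + bracket_freq (y + p) powr (-1/2)"

lemma borel_measurable_inv_sqrt_sum [measurable]:
  "case_prod inv_sqrt_sum \<in> borel_measurable (freq \<Otimes>\<^sub>M freq)"
  unfolding inv_sqrt_sum_def[abs_def] by measurable

lemma inv_sqrt_sum_bounds [simp]: "0 \<le> inv_sqrt_sum y p" "inv_sqrt_sum y p \<le> 2"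
proof -
  have "bracket_freq z powr (-1/2) \<le> 1" for z
    by (intro powr_nonpos_le_1) auto
  from this[of p] this[of "y + p"] show "inv_sqrt_sum y p \<le> 2"
    unfolding inv_sqrt_sum_def by linarith
qed (simp add: inv_sqrt_sum_def)

text \<open>The two inputs give up part of their exponent 1/2, so that all three modulations carry
  7/16 and either an X or the Y frequency can be the output. The summand 1 is the part without loss
  of derivatives.\<close>

definition interaction :: "real \<Rightarrow> int \<times> real \<Rightarrow> int \<times> real \<Rightarrow> real" where
  "interaction \<gamma> y p = (1 + bracket_freq y powr (1/2) * inv_sqrt_sum y p) * decayY \<gamma> y * decayX p * decayX (y + p)"

lemma borel_measurable_interaction [measurable]:
  "case_prod (interaction \<gamma>) \<in> borel_measurable (freq \<Otimes>\<^sub>M freq)"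
  unfolding interaction_def[abs_def] by measurable

lemma interaction_nonneg [simp]: "0 \<le> interaction \<gamma> y p"
  by (simp add: interaction_def)

text \<open>What is left of \<open>interaction\<close> once the \<open>Y\<close> modulation has been spent against the resonance.\<close>

definition kernel_lowY :: "int \<times> real \<Rightarrow> int \<times> real \<Rightarrow> real" where
  "kernel_lowY y p = (if fst y = 0 then 0 else inv_sqrt_sum y p) * decayX p * decayX (y + p)"

lemma borel_measurable_kernel_lowY [measurable]:
  "case_prod kernel_lowY \<in> borel_measurable (freq \<Otimes>\<^sub>M freq)"
proof -
  have [measurable]: "Measurable.pred freq (\<lambda>z. fst z = 0)"
    unfolding freq_def by measurable
  show ?thesis
    unfolding kernel_lowY_def[abs_def] by measurable
qed

lemma kernel_lowY_nonneg [simp]: "0 \<le> kernel_lowY y p"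
  by (simp add: kernel_lowY_def)

text \<open>Here \<open>\<bar>k\<bar>\<close> is at most a multiple of both other frequencies, so
  each inverse square root absorbs the half derivative. No modulation has to pay, and the weight at
  \<open>y + p\<close> is bounded by 1.\<close>

lemma interaction_le_nonresonant:
  assumes "\<delta> > 0" and "\<delta> * \<bar>of_int (fst y)\<bar> \<le> 4 * bracket_freq p"
    "\<delta> * \<bar>of_int (fst y)\<bar> \<le> 4 * bracket_freq (y + p)"
  shows "interaction \<gamma> y p \<le> (1 + 2 * (1 + 4 / \<delta>)) * (decayY \<gamma> y * decayX p)"
proof -
  have *: "bracket_freq y powr (1/2) * b powr (-1/2) \<le> 1 + 4 / \<delta>"
    if "\<delta> * \<bar>of_int (fst y)\<bar> \<le> 4 * b" "b \<ge> 1" for b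
  proof -
    have "\<bar>real_of_int (fst y)\<bar> \<le> 4 / \<delta> * b"
      using that assms(1) by (simp add: field_simps)
    then have "bracket_freq y \<le> (1 + 4 / \<delta>) * b"
      using that by (simp add: bracket_freq_def bracket_def algebra_simps)
    then have "bracket_freq y powr (1/2) \<le> ((1 + 4 / \<delta>) * b) powr (1/2)"
      by (intro powr_mono2) auto
    also have "\<dots> = (1 + 4 / \<delta>) powr (1/2) * b powr (1/2)"
      using that assms by (simp add: powr_mult)
    also have "\<dots> \<le> (1 + 4 / \<delta>) * b powr (1/2)"
      using assms powr_mono[of "1/2" 1 "1 + 4 / \<delta>"] by (intro mult_right_mono) auto
    finally have "bracket_freq y powr (1/2) * b powr (-1/2) \<le> (1 + 4 / \<delta>) * b powr (1/2) * b powr (-1/2)"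
      by (rule mult_right_mono) simp
    also have "\<dots> = 1 + 4 / \<delta>"
      using that by (simp add: mult.assoc powr_add[symmetric])
    finally show ?thesis .
  qed
  have "bracket_freq y powr (1/2) * inv_sqrt_sum y p \<le> 2 * (1 + 4 / \<delta>)"
    using *[OF assms(2)] *[OF assms(3)] by (simp add: inv_sqrt_sum_def distrib_left)
  then have "interaction \<gamma> y p \<le> (1 + 2 * (1 + 4 / \<delta>)) * (decayY \<gamma> y * decayX p * decayX (y + p))"
    unfolding interaction_def mult.assoc by (intro mult_right_mono) auto
  also have "\<dots> \<le> (1 + 2 * (1 + 4 / \<delta>)) * (decayY \<gamma> y * decayX p * 1)"
    using assms(1) by (intro mult_left_mono) auto
  finally show ?thesis by simp
qed

text \<open>The largest modulation is at least a multiple of the square of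
  \<open>bracket_freq y\<close>, and its power 7/16 gains a power 7/8 against the 1/2 lost. That
  weight is thereby spent, which leaves one of three kernels with two modulation weights
  each.\<close>

lemma interaction_le_resonant:
  assumes "\<delta> > 0" "\<delta> \<le> \<bar>1 - \<gamma>\<bar>" "\<delta> \<le> \<bar>1 + \<gamma>\<bar>"
    and far: "4 * bracket_freq p < \<delta> * \<bar>of_int (fst y)\<bar> \<or> 4 * bracket_freq (y + p) < \<delta> * \<bar>of_int (fst y)\<bar>"
  shows "interaction \<gamma> y p \<le> (1 + 2 * (\<delta> / 24) powr (-7/16)) *
    (kernel_lowY y p + decayY \<gamma> y * decayX (y + p) + decayY \<gamma> y * decayX p)"
proof -
  define k where "k = real_of_int (fst y)"
  define E where "E = (\<delta> / 24) powr (-7/16)"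
  define B where "B = bracket_freq y powr (1/2)"
  \<comment> \<open>The hypothesis \<open>far\<close> excludes \<open>k = 0\<close>, the only place
    where \<open>kernel_lowY\<close> is cut to 0.\<close>
  have "0 < \<delta> * \<bar>k\<bar>"
    using far bracket_freq_pos(1)[of p] bracket_freq_pos(1)[of "y + p"] unfolding k_def by linarith
  then have "k \<noteq> 0" by auto
  then have k1: "fst y \<noteq> 0" "\<bar>k\<bar> \<ge> 1" by (auto simp: k_def)
  have "\<delta> / 2 * k\<^sup>2 \<le> \<bar>modX (y + p) - modY \<gamma> y - modX p\<bar>"
    unfolding resonance_identity k_def
    using far by (intro resonance_lower_bound assms) (simp add: bracket_freq_def)
  also have "\<dots> \<le> bracket (modX (y + p)) + bracket (modY \<gamma> y) + bracket (modX p)"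
    by (simp add: bracket_def)
  finally have sum: "\<delta> / 2 * k\<^sup>2 \<le> bracket (modX (y + p)) + bracket (modY \<gamma> y) + bracket (modX p)" .
  have "bracket_freq y \<le> 2 * \<bar>k\<bar>"
    using k1 by (simp add: bracket_freq_def bracket_def k_def)
  then have "(bracket_freq y)\<^sup>2 \<le> (2 * \<bar>k\<bar>)\<^sup>2"
    by (intro power_mono) auto
  then have "(bracket_freq y)\<^sup>2 \<le> 4 * k\<^sup>2"
    by (simp add: power_mult_distrib)
  then have "\<delta> / 8 * (bracket_freq y)\<^sup>2 \<le> \<delta> / 8 * (4 * k\<^sup>2)"
    using assms(1) by (intro mult_left_mono) auto
  \<comment> \<open>As \<open>(bracket_freq y)\<^sup>2 \<le> 4 * k\<^sup>2\<close>, the three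
    brackets add up to at least \<open>\<delta> / 8\<close> times that square, and one of them has a
    third of it: hence 24.\<close>
  with sum have alt: "\<delta> / 24 * (bracket_freq y)\<^sup>2 \<le> bracket (modX (y + p)) \<or>
      \<delta> / 24 * (bracket_freq y)\<^sup>2 \<le> bracket (modY \<gamma> y) \<or> \<delta> / 24 * (bracket_freq y)\<^sup>2 \<le> bracket (modX p)"
    by linarith
  have gain: "B * bracket x powr (-7/16) \<le> E" if "\<delta> / 24 * (bracket_freq y)\<^sup>2 \<le> bracket x" for x
  proof -
    have "bracket x powr (-7/16) \<le> (\<delta> / 24 * (bracket_freq y)\<^sup>2) powr (-7/16)"
      using assms(1) that by (intro powr_mono2') (auto intro!: mult_pos_pos zero_less_power)
    also have "\<dots> = E * bracket_freq y powr (-7/8)"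
    proof -
      have "(bracket_freq y)\<^sup>2 = bracket_freq y powr 2" by simp
      then show ?thesis
        using assms(1) unfolding E_def by (simp only: powr_mult powr_powr) simp
    qed
    finally have "B * bracket x powr (-7/16) \<le> B * (E * bracket_freq y powr (-7/8))"
      by (intro mult_left_mono) (auto simp: B_def)
    also have "\<dots> = E * bracket_freq y powr (-3/8)"
      by (simp add: B_def powr_add[symmetric])
    also have "\<dots> \<le> E * 1"
      by (intro mult_left_mono powr_nonpos_le_1) (auto simp: E_def)
    finally show ?thesis by simp
  qed
  define m a b c where "m = inv_sqrt_sum y p" and "a = decayY \<gamma> y" and "b = decayX p" and "c = decayX (y + p)"
  have nn: "0 \<le> m" "m \<le> 2" "0 \<le> a" "a \<le> 1" "0 \<le> b" "b \<le> 1" "0 \<le> c" "c \<le> 1" "0 \<le> B" "0 \<le> E"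
    by (auto simp: m_def a_def b_def c_def B_def E_def)
  have abc: "a * b * c \<le> a * b"
    using nn by (simp add: mult_left_le)
  \<comment> \<open>If the Y modulation pays, \<open>m\<close> must survive, because the phase left
    for that kernel is only linear. If an X modulation pays, the crude bound
    \<open>m \<le> 2\<close> is enough.\<close>
  have "B * m * a * b * c \<le> 2 * E * (m * b * c + a * c + a * b)"
  proof -
    have "B * m * a * b * c \<le> 2 * E * (m * b * c)" if "B * a \<le> E"
    proof -
      have "(B * a) * (m * b * c) \<le> E * (m * b * c)"
        using that nn by (intro mult_right_mono) auto
      also have "\<dots> \<le> 2 * E * (m * b * c)"
        using nn by (intro mult_right_mono) auto
      finally show ?thesis by (simp add: ac_simps)
    qed
    moreover have "B * m * a * b * c \<le> 2 * E * (a * c)" if "B * b \<le> E"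
    proof -
      have "(B * b) * (m * (a * c)) \<le> E * (2 * (a * c))"
        using that nn by (intro mult_mono) auto
      then show ?thesis by (simp add: ac_simps)
    qed
    moreover have "B * m * a * b * c \<le> 2 * E * (a * b)" if "B * c \<le> E"
    proof -
      have "(B * c) * (m * (a * b)) \<le> E * (2 * (a * b))"
        using that nn by (intro mult_mono) auto
      then show ?thesis by (simp add: ac_simps)
    qed
    moreover have "0 \<le> 2 * E * (m * b * c)" "0 \<le> 2 * E * (a * c)" "0 \<le> 2 * E * (a * b)"
      using nn by auto
    moreover have "B * a \<le> E \<or> B * b \<le> E \<or> B * c \<le> E"
      using alt gain[of "modX (y + p)"] gain[of "modY \<gamma> y"] gain[of "modX p"]
      unfolding a_def b_def c_def decayX_def decayY_def by blast
    ultimately show ?thesis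
      unfolding distrib_left by linarith
  qed
  moreover have "a * b \<le> m * b * c + a * c + a * b"
    using nn by simp
  ultimately have "a * b * c + B * m * a * b * c \<le> (1 + 2 * E) * (m * b * c + a * c + a * b)"
    using abc by (simp only: distrib_right) simp
  moreover have "interaction \<gamma> y p = a * b * c + B * m * a * b * c"
    by (simp add: interaction_def a_def b_def c_def B_def m_def algebra_simps)
  moreover have "kernel_lowY y p = m * b * c"
    using k1 by (simp add: kernel_lowY_def m_def b_def c_def)
  ultimately show ?thesis
    by (simp add: a_def b_def c_def E_def)
qed

lemma interaction_le:
  assumes "\<bar>\<gamma>\<bar> \<noteq> 1"
  obtains C where "C \<ge> 0"
    "\<And>y p. interaction \<gamma> y p \<le> C * (kernel_lowY y p + decayY \<gamma> y * decayX (y + p) + decayY \<gamma> y * decayX p)"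
proof -
  \<comment> \<open>Positive precisely because
    \<open>\<bar>\<gamma>\<bar> \<noteq> 1\<close>.\<close>
  define \<delta> where "\<delta> = min \<bar>1 - \<gamma>\<bar> \<bar>1 + \<gamma>\<bar>"
  have \<delta>: "\<delta> > 0" "\<delta> \<le> \<bar>1 - \<gamma>\<bar>" "\<delta> \<le> \<bar>1 + \<gamma>\<bar>"
    using assms by (auto simp: \<delta>_def)
  define C1 where "C1 = 1 + 2 * (1 + 4 / \<delta>)"
  define C2 where "C2 = 1 + 2 * (\<delta> / 24) powr (-7/16)"
  have C: "C1 \<ge> 0" "C2 \<ge> 0" using \<delta> by (auto simp: C1_def C2_def)
  have "interaction \<gamma> y p \<le> (C1 + C2) * (kernel_lowY y p + decayY \<gamma> y * decayX (y + p) + decayY \<gamma> y * decayX p)"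
    (is "_ \<le> _ * ?s") for y p
  proof -
    have s: "0 \<le> ?s" "decayY \<gamma> y * decayX p \<le> ?s" by simp_all
    have "interaction \<gamma> y p \<le> C1 * ?s \<or> interaction \<gamma> y p \<le> C2 * ?s"
    proof (cases "4 * bracket_freq p < \<delta> * \<bar>of_int (fst y)\<bar> \<or> 4 * bracket_freq (y + p) < \<delta> * \<bar>of_int (fst y)\<bar>")
      case True
      then show ?thesis
        using interaction_le_resonant[OF \<delta> True] by (simp add: C2_def)
    next
      case False
      then have "interaction \<gamma> y p \<le> C1 * (decayY \<gamma> y * decayX p)"
        unfolding C1_def using \<delta> by (intro interaction_le_nonresonant) auto
      also have "\<dots> \<le> C1 * ?s"
        using C s by (intro mult_left_mono)
      finally show ?thesis by simp
    qed
    moreover have "C1 * ?s \<ge> 0" "C2 * ?s \<ge> 0"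
      using C s(1) by (auto intro: mult_nonneg_nonneg)
    ultimately show ?thesis
      by (auto simp: distrib_right[of C1 C2])
  qed
  then show ?thesis
    using C by (intro that[of "C1 + C2"]) auto
qed

section \<open>The trilinear estimate\<close>

text \<open>On each half-line the term with \<gamma> is a pure square, so the sum is dominated by
  two sums over all integers along quadratic polynomials with leading coefficients
  \<open>c + \<gamma>\<close> and \<open>c - \<gamma>\<close>.\<close>

lemma bracket_dispersion_sum:
  fixes c \<gamma> :: real
  assumes "c \<noteq> \<gamma>" "c \<noteq> - \<gamma>"
  obtains S where "S \<ge> 0"
    "\<And>P Q. (\<integral>\<^sup>+k. ennreal (bracket (P + Q * of_int k + c * (of_int k)\<^sup>2 + \<gamma> * \<bar>of_int k\<bar> * of_int k) powr (-5/8))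
        \<partial>count_space UNIV) \<le> ennreal S"
proof -
  obtain S1 where S1: "S1 \<ge> 0" "\<And>A B. (\<integral>\<^sup>+n. ennreal (bracket (A + B * of_int n + (c + \<gamma>) * (of_int n)\<^sup>2) powr (- (5/8))) \<partial>count_space UNIV) \<le> ennreal S1"
    using bracket_quadratic_sum[of "c + \<gamma>" "5/8"] assms by (auto simp: add_eq_0_iff)
  obtain S2 where S2: "S2 \<ge> 0" "\<And>A B. (\<integral>\<^sup>+n. ennreal (bracket (A + B * of_int n + (c - \<gamma>) * (of_int n)\<^sup>2) powr (- (5/8))) \<partial>count_space UNIV) \<le> ennreal S2"
    using bracket_quadratic_sum[of "c - \<gamma>" "5/8"] assms by auto
  have "(\<integral>\<^sup>+k. ennreal (bracket (P + Q * of_int k + c * (of_int k)\<^sup>2 + \<gamma> * \<bar>of_int k\<bar> * of_int k) powr (-5/8)) \<partial>count_space UNIV)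
      \<le> ennreal (S1 + S2)" for P Q
  proof -
    let ?q = "\<lambda>d k. ennreal (bracket (P + Q * of_int k + d * (of_int k)\<^sup>2) powr (- (5/8)))"
    have "(\<integral>\<^sup>+k. ennreal (bracket (P + Q * of_int k + c * (of_int k)\<^sup>2 + \<gamma> * \<bar>of_int k\<bar> * of_int k) powr (-5/8)) \<partial>count_space UNIV)
        \<le> (\<integral>\<^sup>+k. ?q (c + \<gamma>) k + ?q (c - \<gamma>) k \<partial>count_space UNIV)"
    proof (rule nn_integral_mono)
      fix k :: int
      have eq: "P + Q * of_int k + c * (of_int k)\<^sup>2 + \<gamma> * \<bar>of_int k\<bar> * of_int k
          = P + Q * of_int k + (if k \<ge> 0 then c + \<gamma> else c - \<gamma>) * (of_int k)\<^sup>2"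
        by (simp add: power2_eq_square algebra_simps)
      show "ennreal (bracket (P + Q * of_int k + c * (of_int k)\<^sup>2 + \<gamma> * \<bar>of_int k\<bar> * of_int k) powr (-5/8))
          \<le> ?q (c + \<gamma>) k + ?q (c - \<gamma>) k"
        unfolding eq by (cases "k \<ge> 0") simp_all
    qed
    also have "\<dots> = (\<integral>\<^sup>+k. ?q (c + \<gamma>) k \<partial>count_space UNIV) + (\<integral>\<^sup>+k. ?q (c - \<gamma>) k \<partial>count_space UNIV)"
      by (rule nn_integral_add) auto
    also have "\<dots> \<le> ennreal S1 + ennreal S2"
      by (intro add_mono S1 S2)
    finally show ?thesis
      using S1(1) S2(1) by simp
  qed
  then show ?thesis
    using S1(1) S2(1) by (intro that[of "S1 + S2"]) auto
qed

definition conv_const :: real where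
  "conv_const = 8 * bracket_integral (9/8)"

lemma conv_const_nonneg [simp]: "0 \<le> conv_const"
  by (simp add: conv_const_def)

text \<open>The convolution bound removes the time frequency and leaves a bracket in which the two
  dispersions are combined. At fixed \<open>p\<close> the X dispersion enters as
  \<open>- k\<^sup>2\<close>; at fixed \<open>q\<close> the X modulation is taken at
  \<open>q - y\<close>, its time frequency has the opposite sign, and \<open>+ k\<^sup>2\<close>
  appears. In neither case can the term with \<gamma> cancel the square.\<close>

lemma test_decayY_decayX:
  assumes "\<bar>\<gamma>\<bar> \<noteq> 1"
  obtains S where "S \<ge> 0" "\<And>p. (\<integral>\<^sup>+y. (ennreal (decayY \<gamma> y * decayX (y + p)))\<^sup>2 \<partial>freq) \<le> ennreal S"
    "\<And>q. (\<integral>\<^sup>+y. (ennreal (decayY \<gamma> y * decayX (q - y)))\<^sup>2 \<partial>freq) \<le> ennreal S"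
proof -
  have "-1 \<noteq> \<gamma>" "-1 \<noteq> -\<gamma>" "1 \<noteq> \<gamma>" "1 \<noteq> -\<gamma>"
    using assms by auto
  obtain S1 where S1: "S1 \<ge> 0"
    "\<And>P Q. (\<integral>\<^sup>+k. ennreal (bracket (P + Q * of_int k + (-1) * (of_int k)\<^sup>2 + \<gamma> * \<bar>of_int k\<bar> * of_int k) powr (-5/8))
        \<partial>count_space UNIV) \<le> ennreal S1"
    by (rule bracket_dispersion_sum[OF \<open>-1 \<noteq> \<gamma>\<close> \<open>-1 \<noteq> -\<gamma>\<close>]) (rule that)
  obtain S2 where S2: "S2 \<ge> 0"
    "\<And>P Q. (\<integral>\<^sup>+k. ennreal (bracket (P + Q * of_int k + 1 * (of_int k)\<^sup>2 + \<gamma> * \<bar>of_int k\<bar> * of_int k) powr (-5/8))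
        \<partial>count_space UNIV) \<le> ennreal S2"
    by (rule bracket_dispersion_sum[OF \<open>1 \<noteq> \<gamma>\<close> \<open>1 \<noteq> -\<gamma>\<close>]) (rule that)
  have t1: "(\<integral>\<^sup>+y. (ennreal (decayY \<gamma> y * decayX (y + p)))\<^sup>2 \<partial>freq) \<le> ennreal (conv_const * S1)" for p
  proof -
    obtain m \<tau> where p: "p = (m, \<tau>)" by force
    have "(\<integral>\<^sup>+y. (ennreal (decayY \<gamma> y * decayX (y + p)))\<^sup>2 \<partial>freq)
      = (\<integral>\<^sup>+k. (\<integral>\<^sup>+x. ennreal (bracket (x + \<gamma> * \<bar>of_int k\<bar> * of_int k) powr (-7/8)
          * bracket (x + (\<tau> + (of_int (k + m))\<^sup>2)) powr (-7/8)) \<partial>lborel) \<partial>count_space UNIV)"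
      by (subst nn_integral_freq)
         (measurable, simp add: ennreal_power power_mult_distrib decay_squared p modX_def modY_def add.assoc)
    also have "\<dots> \<le> (\<integral>\<^sup>+k. ennreal conv_const * ennreal (bracket ((- \<tau> - (of_int m)\<^sup>2) + (- 2 * of_int m) * of_int k
          + (-1) * (of_int k)\<^sup>2 + \<gamma> * \<bar>of_int k\<bar> * of_int k) powr (-5/8)) \<partial>count_space UNIV)"
    proof (rule nn_integral_mono)
      fix k :: int
      have "\<gamma> * \<bar>of_int k\<bar> * of_int k - (\<tau> + (of_int (k + m))\<^sup>2) = (- \<tau> - (of_int m)\<^sup>2) + (- 2 * of_int m) * of_int k
          + (-1) * (of_int k)\<^sup>2 + \<gamma> * \<bar>of_int k\<bar> * of_int k"
        by (simp add: power2_eq_square algebra_simps)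
      then show "(\<integral>\<^sup>+x. ennreal (bracket (x + \<gamma> * \<bar>of_int k\<bar> * of_int k) powr (-7/8)
          * bracket (x + (\<tau> + (of_int (k + m))\<^sup>2)) powr (-7/8)) \<partial>lborel) \<le> ennreal conv_const *
          ennreal (bracket ((- \<tau> - (of_int m)\<^sup>2) + (- 2 * of_int m) * of_int k
          + (-1) * (of_int k)\<^sup>2 + \<gamma> * \<bar>of_int k\<bar> * of_int k) powr (-5/8))"
        using bracket_convolution_le[of "\<gamma> * \<bar>of_int k\<bar> * of_int k" "\<tau> + (of_int (k + m))\<^sup>2"]
        unfolding conv_const_def by (simp only:)
    qed
    also have "\<dots> \<le> ennreal conv_const * ennreal S1"
      unfolding nn_integral_cmult[OF borel_measurable_count_space] by (intro mult_left_mono S1) simp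
    finally show ?thesis
      using S1 by (simp add: ennreal_mult)
  qed
  have t2: "(\<integral>\<^sup>+y. (ennreal (decayY \<gamma> y * decayX (q - y)))\<^sup>2 \<partial>freq) \<le> ennreal (conv_const * S2)" for q
  proof -
    obtain m \<tau> where q: "q = (m, \<tau>)" by force
    \<comment> \<open>The bracket is even, and the convolution bound wants the integration variable
      with a plus sign.\<close>
    have br: "bracket (\<tau> - x + z) = bracket (x + (- \<tau> - z))" for x z
      using bracket_minus[of "x + (- \<tau> - z)"] by (simp add: algebra_simps)
    have "(\<integral>\<^sup>+y. (ennreal (decayY \<gamma> y * decayX (q - y)))\<^sup>2 \<partial>freq)
      = (\<integral>\<^sup>+k. (\<integral>\<^sup>+x. ennreal (bracket (x + \<gamma> * \<bar>of_int k\<bar> * of_int k) powr (-7/8)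
          * bracket (x + (- \<tau> - (of_int (m - k))\<^sup>2)) powr (-7/8)) \<partial>lborel) \<partial>count_space UNIV)"
      by (subst nn_integral_freq)
         (measurable, simp add: ennreal_power power_mult_distrib decay_squared q modX_def modY_def br)
    also have "\<dots> \<le> (\<integral>\<^sup>+k. ennreal conv_const * ennreal (bracket ((\<tau> + (of_int m)\<^sup>2) + (- 2 * of_int m) * of_int k
          + 1 * (of_int k)\<^sup>2 + \<gamma> * \<bar>of_int k\<bar> * of_int k) powr (-5/8)) \<partial>count_space UNIV)"
    proof (rule nn_integral_mono)
      fix k :: int
      have "\<gamma> * \<bar>of_int k\<bar> * of_int k - (- \<tau> - (of_int (m - k))\<^sup>2) = (\<tau> + (of_int m)\<^sup>2) + (- 2 * of_int m) * of_int k
          + 1 * (of_int k)\<^sup>2 + \<gamma> * \<bar>of_int k\<bar> * of_int k"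
        by (simp add: power2_eq_square algebra_simps)
      then show "(\<integral>\<^sup>+x. ennreal (bracket (x + \<gamma> * \<bar>of_int k\<bar> * of_int k) powr (-7/8)
          * bracket (x + (- \<tau> - (of_int (m - k))\<^sup>2)) powr (-7/8)) \<partial>lborel) \<le> ennreal conv_const *
          ennreal (bracket ((\<tau> + (of_int m)\<^sup>2) + (- 2 * of_int m) * of_int k
          + 1 * (of_int k)\<^sup>2 + \<gamma> * \<bar>of_int k\<bar> * of_int k) powr (-5/8))"
        using bracket_convolution_le[of "\<gamma> * \<bar>of_int k\<bar> * of_int k" "- \<tau> - (of_int (m - k))\<^sup>2"]
        unfolding conv_const_def by (simp only:)
    qed
    also have "\<dots> \<le> ennreal conv_const * ennreal S2"
      unfolding nn_integral_cmult[OF borel_measurable_count_space] by (intro mult_left_mono S2) simp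
    finally show ?thesis
      using S2 by (simp add: ennreal_mult)
  qed
  have le: "0 \<le> conv_const * S1 + conv_const * S2" "ennreal (conv_const * S1) \<le> ennreal (conv_const * S1 + conv_const * S2)"
    "ennreal (conv_const * S2) \<le> ennreal (conv_const * S1 + conv_const * S2)"
    using S1(1) S2(1) by (auto intro!: ennreal_leI simp del: ennreal_plus)
  show ?thesis
    by (rule that[OF le(1) order_trans[OF t1 le(2)] order_trans[OF t2 le(3)]])
qed

text \<open>Between the two X dispersions the squares of \<open>n\<close> cancel and the phase is
  linear in \<open>n\<close>. Decay 5/8 along it is not summable; the square of
  \<open>inv_sqrt_sum\<close> supplies another 5/8, and 5/4 sums uniformly in \<open>y\<close>. At
  \<open>k = 0\<close> the phase would not depend on \<open>n\<close> at all, but there the kernel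
  is 0.\<close>

lemma test_kernel_lowY:
  "(\<integral>\<^sup>+p. (ennreal (kernel_lowY y p))\<^sup>2 \<partial>freq)
    \<le> ennreal (2 * conv_const * (4 * (2 powr (5/4) * bracket_integral (5/4))))"
proof -
  obtain k \<tau> where y: "y = (k, \<tau>)" by force
  let ?k = "real_of_int k"
  have meas: "(\<lambda>p. (ennreal (kernel_lowY y p))\<^sup>2) \<in> borel_measurable freq"
    by measurable
  show ?thesis
  proof (cases "k = 0")
    case True
    then show ?thesis by (simp add: kernel_lowY_def y)
  next
    case False
    then have k: "\<bar>?k\<bar> \<ge> 1" by simp
    \<comment> \<open>The zero of the linear phase as a function of \<open>n\<close>.\<close>
    define r where "r = - (\<tau> + ?k\<^sup>2) / (2 * ?k)"
    let ?b = "\<lambda>n z. ennreal (bracket (of_int n - z) powr (- (5/4)))"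
    let ?T = "2 powr (5/4) * bracket_integral (5/4)"
    have T: "(\<integral>\<^sup>+n. ?b n z \<partial>count_space UNIV) \<le> ennreal ?T" for z
      by (rule bracket_sum_le) simp
    have m2: "(inv_sqrt_sum y (n, x))\<^sup>2 \<le> 2 * (bracket (of_int n) powr (-5/8) + bracket (of_int n - (- ?k)) powr (-5/8))"
      for n x
    proof -
      \<comment> \<open>Of the available exponent -1 only -5/8 is kept, to match the decay of the
        phase.\<close>
      have sq: "(bracket z powr (-1/2))\<^sup>2 \<le> bracket z powr (-5/8)" for z
      proof -
        have "(bracket z powr (-1/2))\<^sup>2 = bracket z powr (-1)"
          by (simp add: power2_eq_square powr_add[symmetric])
        then show ?thesis
          using powr_mono[of "-1" "-5/8" "bracket z"] by simp
      qed
      have "(a + b)\<^sup>2 \<le> 2 * (a\<^sup>2 + b\<^sup>2)" for a b :: real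
        using zero_le_power2[of "a - b"] by (simp add: power2_sum power2_diff)
      from this[of "bracket (of_int n) powr (-1/2)" "bracket (?k + of_int n) powr (-1/2)"]
      show ?thesis
        using sq[of "of_int n"] sq[of "?k + of_int n"]
        by (simp add: inv_sqrt_sum_def bracket_freq_def y add.commute)
    qed
    have "(\<integral>\<^sup>+p. (ennreal (kernel_lowY y p))\<^sup>2 \<partial>freq)
      \<le> (\<integral>\<^sup>+n. (\<integral>\<^sup>+x. ennreal (2 * (bracket (of_int n) powr (-5/8) + bracket (of_int n - (- ?k)) powr (-5/8)))
          * ennreal (bracket (x + (of_int n)\<^sup>2) powr (-7/8) * bracket (x + (\<tau> + (of_int (k + n))\<^sup>2)) powr (-7/8)) \<partial>lborel) \<partial>count_space UNIV)"
      unfolding nn_integral_freq[OF meas]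
    proof (intro nn_integral_mono)
      fix n :: int and x :: real
      have "(kernel_lowY y (n, x))\<^sup>2 = (inv_sqrt_sum y (n, x))\<^sup>2 *
          (bracket (x + (of_int n)\<^sup>2) powr (-7/8) * bracket (x + (\<tau> + (of_int (k + n))\<^sup>2)) powr (-7/8))"
        using False by (simp add: kernel_lowY_def power_mult_distrib decay_squared modX_def y add_ac)
      also have "\<dots> \<le> 2 * (bracket (of_int n) powr (-5/8) + bracket (of_int n - (- ?k)) powr (-5/8)) *
          (bracket (x + (of_int n)\<^sup>2) powr (-7/8) * bracket (x + (\<tau> + (of_int (k + n))\<^sup>2)) powr (-7/8))"
        by (intro mult_right_mono m2) simp
      finally show "(ennreal (kernel_lowY y (n, x)))\<^sup>2 \<le> ennreal (2 * (bracket (of_int n) powr (-5/8) + bracket (of_int n - (- ?k)) powr (-5/8)))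
          * ennreal (bracket (x + (of_int n)\<^sup>2) powr (-7/8) * bracket (x + (\<tau> + (of_int (k + n))\<^sup>2)) powr (-7/8))"
        by (subst ennreal_power, simp, subst ennreal_mult[symmetric], simp, simp) (rule ennreal_leI)
    qed
    also have "\<dots> \<le> (\<integral>\<^sup>+n. ennreal (2 * conv_const) * (?b n 0 + (?b n r + (?b n (- ?k) + ?b n r))) \<partial>count_space UNIV)"
    proof (rule nn_integral_mono)
      fix n :: int
      let ?w = "2 * (bracket (of_int n) powr (-5/8) + bracket (of_int n - (- ?k)) powr (-5/8))"
      \<comment> \<open>The slope has modulus \<open>2 * \<bar>k\<bar> \<ge> 1\<close>, so the phase
        dominates the distance to its zero, uniformly in \<open>k\<close>.\<close>
      have "\<bar>of_int n - r\<bar> \<le> \<bar>(of_int n)\<^sup>2 - (\<tau> + (of_int (k + n))\<^sup>2)\<bar>"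
      proof -
        have eq: "(of_int n)\<^sup>2 - (\<tau> + (of_int (k + n))\<^sup>2) = - (2 * ?k * (of_int n - r))"
          using False unfolding r_def by (simp add: field_simps power2_eq_square)
        have "1 * \<bar>of_int n - r\<bar> \<le> \<bar>2 * ?k\<bar> * \<bar>of_int n - r\<bar>"
          using k by (intro mult_right_mono) auto
        then show ?thesis
          unfolding eq abs_minus_cancel abs_mult by simp
      qed
      then have res: "bracket ((of_int n)\<^sup>2 - (\<tau> + (of_int (k + n))\<^sup>2)) powr (-5/8) \<le> bracket (of_int n - r) powr (-5/8)"
        by (intro powr_mono2') (auto simp: bracket_def)
      have young: "bracket z powr (-5/8) * bracket z' powr (-5/8) \<le> bracket z powr (- (5/4)) + bracket z' powr (- (5/4))" for z z'
        using powr_mult_le_sum_powr[of "bracket z" "bracket z'" "5/8" "5/8"] by simp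
      have "?w * (conv_const * bracket ((of_int n)\<^sup>2 - (\<tau> + (of_int (k + n))\<^sup>2)) powr (-5/8))
          \<le> ?w * (conv_const * bracket (of_int n - r) powr (-5/8))"
        using res by (intro mult_left_mono) auto
      also have "\<dots> = 2 * conv_const * (bracket (of_int n) powr (-5/8) * bracket (of_int n - r) powr (-5/8)
          + bracket (of_int n - (- ?k)) powr (-5/8) * bracket (of_int n - r) powr (-5/8))"
        by (simp add: algebra_simps)
      also have "\<dots> \<le> 2 * conv_const * ((bracket (of_int n) powr (- (5/4)) + bracket (of_int n - r) powr (- (5/4)))
          + (bracket (of_int n - (- ?k)) powr (- (5/4)) + bracket (of_int n - r) powr (- (5/4))))"
        by (intro mult_left_mono add_mono young) auto
      finally have main: "?w * (conv_const * bracket ((of_int n)\<^sup>2 - (\<tau> + (of_int (k + n))\<^sup>2)) powr (-5/8)) \<le>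
          2 * conv_const * ((bracket (of_int n) powr (- (5/4)) + bracket (of_int n - r) powr (- (5/4)))
          + (bracket (of_int n - (- ?k)) powr (- (5/4)) + bracket (of_int n - r) powr (- (5/4))))" .
      have "(\<integral>\<^sup>+x. ennreal ?w * ennreal (bracket (x + (of_int n)\<^sup>2) powr (-7/8) * bracket (x + (\<tau> + (of_int (k + n))\<^sup>2)) powr (-7/8)) \<partial>lborel)
        = ennreal ?w * (\<integral>\<^sup>+x. ennreal (bracket (x + (of_int n)\<^sup>2) powr (-7/8) * bracket (x + (\<tau> + (of_int (k + n))\<^sup>2)) powr (-7/8)) \<partial>lborel)"
        by (rule nn_integral_cmult) measurable
      also have "\<dots> \<le> ennreal ?w * (ennreal conv_const * ennreal (bracket ((of_int n)\<^sup>2 - (\<tau> + (of_int (k + n))\<^sup>2)) powr (-5/8)))"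
        unfolding conv_const_def by (intro mult_left_mono bracket_convolution_le) auto
      also have "\<dots> = ennreal (?w * (conv_const * bracket ((of_int n)\<^sup>2 - (\<tau> + (of_int (k + n))\<^sup>2)) powr (-5/8)))"
        by (simp add: ennreal_mult)
      also have "\<dots> \<le> ennreal (2 * conv_const * ((bracket (of_int n) powr (- (5/4)) + bracket (of_int n - r) powr (- (5/4)))
          + (bracket (of_int n - (- ?k)) powr (- (5/4)) + bracket (of_int n - r) powr (- (5/4)))))"
        by (rule ennreal_leI[OF main])
      also have "\<dots> = ennreal (2 * conv_const) * (?b n 0 + (?b n r + (?b n (- ?k) + ?b n r)))"
        by (simp add: ennreal_mult ennreal_plus[symmetric] add.assoc del: ennreal_plus)
      finally show "(\<integral>\<^sup>+x. ennreal ?w * ennreal (bracket (x + (of_int n)\<^sup>2) powr (-7/8) * bracket (x + (\<tau> + (of_int (k + n))\<^sup>2)) powr (-7/8)) \<partial>lborel)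
        \<le> ennreal (2 * conv_const) * (?b n 0 + (?b n r + (?b n (- ?k) + ?b n r)))" .
    qed
    also have "\<dots> = ennreal (2 * conv_const) * ((\<integral>\<^sup>+n. ?b n 0 \<partial>count_space UNIV) + ((\<integral>\<^sup>+n. ?b n r \<partial>count_space UNIV)
        + ((\<integral>\<^sup>+n. ?b n (- ?k) \<partial>count_space UNIV) + (\<integral>\<^sup>+n. ?b n r \<partial>count_space UNIV))))"
      by (simp only: nn_integral_cmult nn_integral_add borel_measurable_count_space)
    also have "\<dots> \<le> ennreal (2 * conv_const) * (ennreal ?T + (ennreal ?T + (ennreal ?T + ennreal ?T)))"
      by (intro mult_left_mono add_mono T) simp
    also have "\<dots> = ennreal (2 * conv_const * (4 * ?T))"
      by (simp add: ennreal_mult[symmetric] ennreal_plus[symmetric] del: ennreal_plus)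
    finally show ?thesis .
  qed
qed

text \<open>Each kernel is tested at the frequency whose modulation it no longer contains:
  \<open>kernel_lowY\<close> at \<open>y\<close>, the second at \<open>p\<close>, the third at
  \<open>y + p\<close>.\<close>

lemma trilinear_interaction_bound:
  assumes "\<bar>\<gamma>\<bar> \<noteq> 1"
  obtains A where "A \<ge> 0" "\<And>f g h. \<lbrakk>f \<in> borel_measurable freq; g \<in> borel_measurable freq; h \<in> borel_measurable freq\<rbrakk>
    \<Longrightarrow> (trilinear (\<lambda>y p. ennreal (interaction \<gamma> y p)) f g h)\<^sup>2 \<le> ennreal A * l2sq f * l2sq g * l2sq h"
proof -
  obtain C where C: "C \<ge> 0" "\<And>y p. interaction \<gamma> y p
      \<le> C * (kernel_lowY y p + decayY \<gamma> y * decayX (y + p) + decayY \<gamma> y * decayX p)"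
    using interaction_le[OF assms] by blast
  obtain S where S: "S \<ge> 0" "\<And>p. (\<integral>\<^sup>+y. (ennreal (decayY \<gamma> y * decayX (y + p)))\<^sup>2 \<partial>freq) \<le> ennreal S"
    "\<And>q. (\<integral>\<^sup>+y. (ennreal (decayY \<gamma> y * decayX (q - y)))\<^sup>2 \<partial>freq) \<le> ennreal S"
    using test_decayY_decayX[OF assms] by blast
  define S1 where "S1 = 2 * conv_const * (4 * (2 powr (5/4) * bracket_integral (5/4)))"
  have S1: "S1 \<ge> 0" by (simp add: S1_def)
  define D where "D = S1 + S"
  have D: "D \<ge> 0" "ennreal S \<le> ennreal D" "ennreal S1 \<le> ennreal D"
    using S1 S(1) by (auto simp: D_def intro!: ennreal_leI)
  have "(trilinear (\<lambda>y p. ennreal (interaction \<gamma> y p)) f g h)\<^sup>2 \<le> ennreal (9 * C\<^sup>2 * D) * l2sq f * l2sq g * l2sq h"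
    if [measurable]: "f \<in> borel_measurable freq" "g \<in> borel_measurable freq" "h \<in> borel_measurable freq" for f g h
  proof -
    let ?K1 = "\<lambda>y p. ennreal (kernel_lowY y p)"
    let ?K2 = "\<lambda>y p. ennreal (decayY \<gamma> y * decayX (y + p))"
    let ?K3 = "\<lambda>y p. ennreal (decayY \<gamma> y * decayX p)"
    let ?N = "ennreal D * l2sq f * l2sq g * l2sq h"
    have meas: "case_prod ?K1 \<in> borel_measurable (freq \<Otimes>\<^sub>M freq)" "case_prod ?K2 \<in> borel_measurable (freq \<Otimes>\<^sub>M freq)"
      "case_prod ?K3 \<in> borel_measurable (freq \<Otimes>\<^sub>M freq)" "case_prod (\<lambda>y p. ?K1 y p + ?K2 y p) \<in> borel_measurable (freq \<Otimes>\<^sub>M freq)"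
      "case_prod (\<lambda>y p. ?K1 y p + ?K2 y p + ?K3 y p) \<in> borel_measurable (freq \<Otimes>\<^sub>M freq)"
      by measurable
    have t1: "(trilinear ?K1 f g h)\<^sup>2 \<le> ?N"
      using test_kernel_lowY D(3) unfolding S1_def
      by (intro trilinear_bound_fst meas that) (rule order_trans)
    have t2: "(trilinear ?K2 f g h)\<^sup>2 \<le> ?N"
      using S(2) D(2) by (intro trilinear_bound_snd meas that) (rule order_trans)
    have t3: "(trilinear ?K3 f g h)\<^sup>2 \<le> ?N"
      using S(3) D(2) by (intro trilinear_bound_output meas that) (rule order_trans)
    \<comment> \<open>The sum of the three forms is at most \<open>3 * M\<close>, whose square is
      the origin of the factor 9.\<close>
    define M where "M = max (trilinear ?K1 f g h) (max (trilinear ?K2 f g h) (trilinear ?K3 f g h))"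
    have M: "M\<^sup>2 \<le> ?N"
      using t1 t2 t3 unfolding M_def by (auto simp: max_def)
    have "trilinear (\<lambda>y p. ennreal (interaction \<gamma> y p)) f g h
        \<le> trilinear (\<lambda>y p. ennreal C * (?K1 y p + ?K2 y p + ?K3 y p)) f g h"
    proof (rule trilinear_mono)
      fix y p
      show "ennreal (interaction \<gamma> y p) \<le> ennreal C * (?K1 y p + ?K2 y p + ?K3 y p)"
        using ennreal_leI[OF C(2)[of y p]] C(1)
        by (simp add: ennreal_mult[symmetric] ennreal_plus[symmetric] del: ennreal_plus)
    qed
    also have "\<dots> = ennreal C * (trilinear ?K1 f g h + trilinear ?K2 f g h + trilinear ?K3 f g h)"
      using meas that by (simp only: trilinear_cmult trilinear_add)
    also have "\<dots> \<le> ennreal C * (M + M + M)"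
      by (intro mult_left_mono add_mono) (auto simp: M_def le_max_iff_disj)
    also have "\<dots> = ennreal (3 * C) * M"
    proof -
      have three: "(3::ennreal) = 1 + 1 + 1" by simp
      have "M + M + M = 3 * M" unfolding three distrib_right by simp
      then show ?thesis
        using C(1) by (simp add: ennreal_mult ac_simps)
    qed
    finally have "(trilinear (\<lambda>y p. ennreal (interaction \<gamma> y p)) f g h)\<^sup>2 \<le> (ennreal (3 * C) * M)\<^sup>2"
      by (rule power_mono_ennreal)
    also have "\<dots> = ennreal (9 * C\<^sup>2) * M\<^sup>2"
      using C(1) by (simp add: power_mult_distrib ennreal_power)
    also have "\<dots> \<le> ennreal (9 * C\<^sup>2) * ?N"
      by (intro mult_left_mono M) simp
    also have "\<dots> = ennreal (9 * C\<^sup>2 * D) * l2sq f * l2sq g * l2sq h"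
      using C(1) D(1) by (simp add: ennreal_mult mult.assoc)
    finally show ?thesis .
  qed
  then show ?thesis
    using D(1) by (intro that[of "9 * C\<^sup>2 * D"]) auto
qed

section \<open>Fourier series\<close>

text \<open>The circle is represented by a closed period interval, as in
  \<open>fourier_coeff\<close>. Its two ends are a null set, and finiteness of the measure makes
  bounded measurable functions integrable.\<close>

definition circ :: "real \<Rightarrow> real measure" where
  "circ L = restrict_space lborel {0..L}"

definition character :: "real \<Rightarrow> int \<Rightarrow> real \<Rightarrow> complex" where
  "character L n x = cis (2 * pi * of_int n * x / L)"

lemma space_circ [simp]: "space (circ L) = {0..L}"
  by (simp add: circ_def space_restrict_space)

lemma finite_measure_circ: "finite_measure (circ L)"
  by (rule finite_measureI) (simp add: circ_def emeasure_restrict_space emeasure_lborel_Icc_eq space_restrict_space)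

interpretation circ: finite_measure "circ L" for L
  by (rule finite_measure_circ)

lemma norm_character [simp]: "norm (character L n x) = 1"
  by (simp add: character_def)

lemma cnj_character: "cnj (character L n x) = cis (- (2 * pi * of_int n * x / L))"
  by (simp add: character_def cis_cnj)

lemma character_add: "character L (m + n) x = character L m x * character L n x"
  by (simp add: character_def cis_mult ring_distribs add_divide_distrib)

lemma cnj_character_minus: "cnj (character L n x) = character L (- n) x"
  by (simp add: character_def cis_cnj)

lemma borel_measurable_character [measurable]: "character L n \<in> borel_measurable borel"
  unfolding character_def[abs_def]
  by (intro borel_measurable_continuous_onI) (auto intro!: continuous_intros simp: divide_inverse)

lemma measurable_circI:
  assumes "continuous_on {0..L} f"
  shows "f \<in> borel_measurable (circ L)"
proof -
  have "f \<in> borel_measurable (restrict_space borel {0..L})"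
    by (rule borel_measurable_continuous_on_restrict[OF assms])
  then show ?thesis
    unfolding circ_def by (subst measurable_cong_sets[of _ "restrict_space borel {0..L}" _ borel])
      (auto simp: sets_restrict_space)
qed

lemma measurable_circ_borel:
  "f \<in> borel_measurable borel \<Longrightarrow> f \<in> borel_measurable (circ L)"
  unfolding circ_def by (rule measurable_restrict_space1) simp

lemma borel_measurable_cnj [measurable]: "cnj \<in> borel_measurable borel"
  by (intro borel_measurable_continuous_onI continuous_intros)

lemma borel_measurable_circ_character [measurable]: "character L n \<in> borel_measurable (circ L)"
  by (intro measurable_circ_borel borel_measurable_character)

lemma integrable_circ_bounded:
  fixes f :: "real \<Rightarrow> complex"
  assumes "f \<in> borel_measurable (circ L)" "\<And>x. x \<in> {0..L} \<Longrightarrow> norm (f x) \<le> B"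
  shows "integrable (circ L) f"
  by (rule circ.integrable_const_bound[where B = B]) (use assms in auto)

lemma integrable_circ_character [simp]: "integrable (circ L) (character L n)"
  by (rule integrable_circ_bounded[where B = 1]) (simp_all add: measurable_circ_borel)

lemma fourier_coeff_circ:
  "fourier_coeff L w n = (\<integral>x. cnj (character L n x) * w x \<partial>circ L) / of_real L"
  unfolding fourier_coeff_def circ_def
  by (subst integral_restrict_space) (auto simp: cnj_character set_lebesgue_integral_def)

lemma has_vector_derivative_character [derivative_intros]:
  "(character L n has_vector_derivative (2 * pi * \<i> * of_int n / of_real L) * character L n x) (at x within A)"
  unfolding has_vector_derivative_def character_def[abs_def]
  by (auto intro!: derivative_eq_intros simp: scaleR_conv_of_real divide_inverse fun_eq_iff algebra_simps)

lemma integral_circ_FTC: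
  fixes F f :: "real \<Rightarrow> complex"
  assumes "L > 0" "\<And>x. x \<in> {0..L} \<Longrightarrow> (F has_vector_derivative f x) (at x within {0..L})"
    and "continuous_on {0..L} f"
  shows "(\<integral>x. f x \<partial>circ L) = F L - F 0"
proof -
  have "(\<integral>x. indicator {0..L} x *\<^sub>R f x \<partial>lborel) = F L - F 0"
    using assms by (intro integral_FTC_Icc) auto
  then show ?thesis
    unfolding circ_def by (subst integral_restrict_space) auto
qed

lemma character_period: "L > 0 \<Longrightarrow> character L n L = character L n 0"
  using cis_multiple_2pi[of "of_int n"] by (simp add: character_def mult.assoc)

lemma integral_character:
  assumes "L > 0"
  shows "(\<integral>x. character L n x \<partial>circ L) = (if n = 0 then of_real L else 0)"
proof (cases "n = 0")
  case True
  have "measure (circ L) {0..L} = L"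
    using assms unfolding circ_def by (simp add: measure_restrict_space)
  then show ?thesis
    using True by (simp add: character_def scaleR_conv_of_real)
next
  case False
  define c where "c = 2 * pi * \<i> * of_int n / of_real L"
  have c: "c \<noteq> 0" using False assms by (simp add: c_def)
  have "(\<integral>x. character L n x \<partial>circ L) = character L n L / c - character L n 0 / c"
  proof (rule integral_circ_FTC[OF assms])
    fix x
    have "((\<lambda>x. character L n x / c) has_vector_derivative (c * character L n x) / c) (at x within {0..L})"
      unfolding c_def by (intro has_vector_derivative_divide has_vector_derivative_character)
    then show "((\<lambda>x. character L n x / c) has_vector_derivative character L n x) (at x within {0..L})"
      using c by simp
  next
    show "continuous_on {0..L} (character L n)"
      using has_vector_derivative_character has_vector_derivative_continuous
      by (blast intro: continuous_on_eq_continuous_within[THEN iffD2])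
  qed
  then show ?thesis
    using False character_period[OF assms] by simp
qed

text \<open>Integration by parts: the boundary terms cancel because the character and
  \<open>w\<close> take equal values at 0 and \<open>L\<close>.\<close>

lemma fourier_coeff_deriv:
  fixes w w' :: "real \<Rightarrow> complex"
  assumes L: "L > 0"
    and deriv: "\<And>x. x \<in> {0..L} \<Longrightarrow> (w has_vector_derivative w' x) (at x within {0..L})"
    and cont: "continuous_on {0..L} w'" and per: "w L = w 0"
  shows "fourier_coeff L w' n = (2 * pi * \<i> * of_int n / of_real L) * fourier_coeff L w n"
proof -
  define c where "c = 2 * pi * \<i> * of_int n / of_real L"
  have contw: "continuous_on {0..L} w"
    using deriv has_vector_derivative_continuous continuous_on_eq_continuous_within by blast
  have conte: "continuous_on {0..L} (\<lambda>x. cnj (character L n x))"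
    unfolding cnj_character by (auto intro!: continuous_intros simp: divide_inverse)
  have int: "integrable (circ L) (\<lambda>x. cnj (character L n x) * v x)" if cv: "continuous_on {0..L} v" for v
  proof -
    obtain B where "\<And>x. x \<in> {0..L} \<Longrightarrow> norm (v x) \<le> B"
      using compact_continuous_image[OF cv] compact_imp_bounded by (force simp: bounded_iff)
    then show ?thesis
      by (intro integrable_circ_bounded[where B = B] measurable_circI continuous_intros cv conte)
         (auto simp: norm_mult)
  qed
  have "(\<integral>x. cnj (character L n x) * w' x - c * (cnj (character L n x) * w x) \<partial>circ L)
      = cnj (character L n L) * w L - cnj (character L n 0) * w 0"
  proof (rule integral_circ_FTC[OF L])
    fix x assume "x \<in> {0..L}"
    have "((\<lambda>x. cnj (character L n x)) has_vector_derivative (- c * cnj (character L n x))) (at x within {0..L})"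
      using has_vector_derivative_character[of L "- n" x "{0..L}"]
      by (simp add: cnj_character_minus[abs_def] c_def)
    from has_vector_derivative_mult[OF this deriv[OF \<open>x \<in> {0..L}\<close>]]
    show "((\<lambda>x. cnj (character L n x) * w x) has_vector_derivative
        cnj (character L n x) * w' x - c * (cnj (character L n x) * w x)) (at x within {0..L})"
      by (simp add: algebra_simps)
  qed (intro continuous_intros cont contw conte)
  also have "\<dots> = 0"
    using per character_period[OF L] by simp
  finally have "(\<integral>x. cnj (character L n x) * w' x \<partial>circ L) = c * (\<integral>x. cnj (character L n x) * w x \<partial>circ L)"
    using int[OF cont] int[OF contw] by simp
  then show ?thesis
    by (simp add: fourier_coeff_circ c_def)
qed

lemma norm_fourier_coeff_le:
  assumes L: "L > 0" and B: "\<And>x. x \<in> {0..L} \<Longrightarrow> norm (w x) \<le> B"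
  shows "norm (fourier_coeff L w n) \<le> B"
proof -
  have B0: "B \<ge> 0" using order_trans[OF norm_ge_zero B[of 0]] L by simp
  have "norm (\<integral>x. cnj (character L n x) * w x \<partial>circ L) \<le> (\<integral>x. B \<partial>circ L)"
  proof (cases "integrable (circ L) (\<lambda>x. cnj (character L n x) * w x)")
    case True
    then show ?thesis
      by (intro order_trans[OF integral_norm_bound] integral_mono integrable_norm)
         (auto simp: norm_mult B)
  next
    \<comment> \<open>A non-integrable function has integral 0 by convention.\<close>
    case False
    then show ?thesis
      using B0 by (simp add: not_integrable_integral_eq)
  qed
  also have "(\<integral>x. B \<partial>circ L) = L * B"
    using L unfolding circ_def by (simp add: measure_restrict_space)
  finally show ?thesis
    using L by (simp add: fourier_coeff_circ norm_divide field_simps)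
qed

text \<open>The integral of the squared modulus of \<open>g - s\<close> is nonnegative, where
  \<open>s\<close> is the Fourier sum over \<open>F\<close>. Both mixed terms and the term with
  \<open>s\<close> alone equal \<open>L * S\<close>, so its expansion leaves the integral for
  \<open>g\<close> minus \<open>L * S\<close>.\<close>

lemma bessel_inequality:
  fixes g :: "real \<Rightarrow> complex"
  assumes L: "L > 0" and [measurable]: "g \<in> borel_measurable (circ L)"
    and B: "\<And>x. x \<in> {0..L} \<Longrightarrow> norm (g x) \<le> B" and F: "finite F"
  shows "(\<Sum>n\<in>F. (cmod (fourier_coeff L g n))\<^sup>2) \<le> B\<^sup>2"
proof -
  define c where "c = fourier_coeff L g"
  define s where "s x = (\<Sum>n\<in>F. c n * character L n x)" for x
  have [measurable]: "s \<in> borel_measurable (circ L)"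
    unfolding s_def[abs_def] by measurable
  have s_bound: "norm (s x) \<le> (\<Sum>n\<in>F. norm (c n))" for x
    unfolding s_def by (rule order_trans[OF norm_sum]) (simp add: norm_mult)
  have int_prod: "integrable (circ L) (\<lambda>x. p x * cnj (q x))"
    if "p \<in> borel_measurable (circ L)" "q \<in> borel_measurable (circ L)"
      "\<And>x. x \<in> {0..L} \<Longrightarrow> norm (p x) \<le> P" "\<And>x. x \<in> {0..L} \<Longrightarrow> norm (q x) \<le> Q" for p q P Q
  proof (rule integrable_circ_bounded[where B = "P * Q"])
    show "norm (p x * cnj (q x)) \<le> P * Q" if "x \<in> {0..L}" for x
      using that by (auto simp: norm_mult intro!: mult_mono order_trans[OF norm_ge_zero] \<open>\<And>x. x \<in> {0..L} \<Longrightarrow> norm (p x) \<le> P\<close> \<open>\<And>x. x \<in> {0..L} \<Longrightarrow> norm (q x) \<le> Q\<close>)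
  qed (use that in simp)
  have igg: "integrable (circ L) (\<lambda>x. g x * cnj (g x))" by (rule int_prod[OF _ _ B B]) measurable
  have igs: "integrable (circ L) (\<lambda>x. g x * cnj (s x))" by (rule int_prod[OF _ _ B s_bound]) measurable
  have isg: "integrable (circ L) (\<lambda>x. s x * cnj (g x))" by (rule int_prod[OF _ _ s_bound B]) measurable
  have iss: "integrable (circ L) (\<lambda>x. s x * cnj (s x))" by (rule int_prod[OF _ _ s_bound s_bound]) measurable
  have ige: "integrable (circ L) (\<lambda>x. cnj (character L n x) * g x)" for n
    using int_prod[of g "character L n" B 1] B by (simp add: mult.commute)
  define S where "S = (\<Sum>n\<in>F. (cmod (c n))\<^sup>2)"
  have coeff: "(\<integral>x. cnj (character L n x) * g x \<partial>circ L) = of_real L * c n" for n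
    using L by (simp add: c_def fourier_coeff_circ)
  have gs: "(\<integral>x. g x * cnj (s x) \<partial>circ L) = of_real (L * S)"
  proof -
    have "(\<integral>x. g x * cnj (s x) \<partial>circ L) = (\<integral>x. (\<Sum>n\<in>F. cnj (c n) * (cnj (character L n x) * g x)) \<partial>circ L)"
      by (simp add: s_def sum_distrib_left ac_simps)
    also have "\<dots> = (\<Sum>n\<in>F. cnj (c n) * (of_real L * c n))"
      by (subst Bochner_Integration.integral_sum) (use ige coeff in auto)
    also have "\<dots> = of_real (L * S)"
      by (simp add: S_def sum_distrib_left complex_norm_square ac_simps del: of_real_power)
    finally show ?thesis .
  qed
  have sg: "(\<integral>x. s x * cnj (g x) \<partial>circ L) = of_real (L * S)"
  proof -
    have "(\<integral>x. s x * cnj (g x) \<partial>circ L) = (\<integral>x. cnj (g x * cnj (s x)) \<partial>circ L)"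
      by (simp add: mult.commute)
    also have "\<dots> = cnj (of_real (L * S))"
      using integral_bounded_linear[OF bounded_linear_cnj igs] by (simp only: gs)
    finally show ?thesis by simp
  qed
  have ss: "(\<integral>x. s x * cnj (s x) \<partial>circ L) = of_real (L * S)"
  proof -
    have "(\<integral>x. s x * cnj (s x) \<partial>circ L) = (\<integral>x. (\<Sum>n\<in>F. \<Sum>m\<in>F. c n * cnj (c m) * character L (n - m) x) \<partial>circ L)"
    proof (rule Bochner_Integration.integral_cong[OF refl])
      fix x
      have "c n * character L n x * (cnj (c m) * character L (- m) x) = c n * cnj (c m) * character L (n - m) x" for n m
        using character_add[of L n "- m" x] by (simp add: mult_ac)
      then show "s x * cnj (s x) = (\<Sum>n\<in>F. \<Sum>m\<in>F. c n * cnj (c m) * character L (n - m) x)"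
        unfolding s_def by (simp only: cnj_sum complex_cnj_mult cnj_character_minus sum_product)
    qed
    also have "\<dots> = (\<Sum>n\<in>F. \<Sum>m\<in>F. c n * cnj (c m) * (if n - m = 0 then of_real L else 0))"
      by (subst Bochner_Integration.integral_sum, simp, simp add: Bochner_Integration.integral_sum integral_character[OF L])
    also have "\<dots> = (\<Sum>n\<in>F. c n * cnj (c n) * of_real L)"
      using F by (intro sum.cong refl) (simp add: if_distrib[of "\<lambda>x. _ * x"] cong: if_cong)
    also have "\<dots> = of_real (L * S)"
      by (simp add: S_def sum_distrib_left complex_norm_square ac_simps del: of_real_power)
    finally show ?thesis .
  qed
  have "(\<integral>x. (g x - s x) * cnj (g x - s x) \<partial>circ L)
      = (\<integral>x. g x * cnj (g x) - g x * cnj (s x) - s x * cnj (g x) + s x * cnj (s x) \<partial>circ L)"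
    by (simp add: algebra_simps)
  also have "\<dots> = (\<integral>x. g x * cnj (g x) \<partial>circ L) - of_real (L * S)"
    using igg igs isg iss by (simp add: gs sg ss)
  finally have eq: "(\<integral>x. (g x - s x) * cnj (g x - s x) \<partial>circ L) = (\<integral>x. g x * cnj (g x) \<partial>circ L) - of_real (L * S)" .
  have re: "z * cnj z = of_real ((cmod z)\<^sup>2)" for z
    by (simp add: complex_norm_square del: of_real_power)
  have "complex_of_real (\<integral>x. (cmod (g x - s x))\<^sup>2 \<partial>circ L) = of_real ((\<integral>x. (cmod (g x))\<^sup>2 \<partial>circ L) - L * S)"
    using eq unfolding re by (simp only: integral_complex_of_real of_real_diff)
  then have "(\<integral>x. (cmod (g x - s x))\<^sup>2 \<partial>circ L) = (\<integral>x. (cmod (g x))\<^sup>2 \<partial>circ L) - L * S"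
    by (simp only: of_real_eq_iff)
  moreover have "0 \<le> (\<integral>x. (cmod (g x - s x))\<^sup>2 \<partial>circ L)"
    by (rule Bochner_Integration.integral_nonneg) simp
  ultimately have "L * S \<le> (\<integral>x. (cmod (g x))\<^sup>2 \<partial>circ L)"
    by simp
  also have "\<dots> \<le> (\<integral>x. B\<^sup>2 \<partial>circ L)"
  proof (rule integral_mono)
    have "integrable (circ L) (\<lambda>x. complex_of_real ((cmod (g x))\<^sup>2))"
      using igg unfolding re .
    then show "integrable (circ L) (\<lambda>x. (cmod (g x))\<^sup>2)"
      by (simp only: complex_of_real_integrable_eq)
    show "(cmod (g x))\<^sup>2 \<le> B\<^sup>2" if "x \<in> space (circ L)" for x
      using B that by (intro power_mono) auto
  qed simp
  also have "\<dots> = L * B\<^sup>2"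
    using L unfolding circ_def by (simp add: measure_restrict_space)
  finally show ?thesis
    using L by (simp add: S_def c_def)
qed

text \<open>The Riemann-Lebesgue lemma: by Bessel the squares along an injective sequence are
  summable. Sequences to both infinities are needed, for the two ends of a symmetric partial
  sum.\<close>

lemma fourier_coeff_tendsto_0:
  fixes g :: "real \<Rightarrow> complex" and \<phi> :: "nat \<Rightarrow> int"
  assumes "L > 0" "g \<in> borel_measurable (circ L)" "\<And>x. x \<in> {0..L} \<Longrightarrow> norm (g x) \<le> B" "inj \<phi>"
  shows "(\<lambda>N. fourier_coeff L g (\<phi> N)) \<longlonglongrightarrow> 0"
proof -
  have "summable (\<lambda>N. (cmod (fourier_coeff L g (\<phi> N)))\<^sup>2)"
  proof (rule summableI_nonneg_bounded)
    fix n
    have "(\<Sum>i<n. (cmod (fourier_coeff L g (\<phi> i)))\<^sup>2) = (\<Sum>m\<in>\<phi> ` {..<n}. (cmod (fourier_coeff L g m))\<^sup>2)"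
      using assms(4) by (subst sum.reindex) (auto intro: inj_on_subset)
    also have "\<dots> \<le> B\<^sup>2"
      by (rule bessel_inequality) (use assms in auto)
    finally show "(\<Sum>i<n. (cmod (fourier_coeff L g (\<phi> i)))\<^sup>2) \<le> B\<^sup>2" .
  qed simp
  then have "(\<lambda>N. sqrt ((cmod (fourier_coeff L g (\<phi> N)))\<^sup>2)) \<longlonglongrightarrow> sqrt 0"
    by (intro tendsto_real_sqrt summable_LIMSEQ_zero)
  then show ?thesis
    by - (rule tendsto_norm_zero_cancel, simp)
qed

text \<open>The constant is the minimum of \<open>\<bar>sinc x\<bar>\<close> on
  \<open>{-a..a}\<close>, which is positive because \<open>sin\<close> has no zero there except
  0.\<close>

lemma abs_sin_ge_linear:
  fixes a :: real
  assumes "0 \<le> a" "a < pi"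
  obtains c where "c > 0" "\<And>\<theta>. \<bar>\<theta>\<bar> \<le> a \<Longrightarrow> c * \<bar>\<theta>\<bar> \<le> \<bar>sin \<theta>\<bar>"
proof -
  have "continuous_on {-a..a} (\<lambda>x. \<bar>sinc x\<bar>)"
    by (intro continuous_intros continuous_at_imp_continuous_on ballI isCont_sinc)
  then obtain x0 where x0: "x0 \<in> {-a..a}" "\<And>x. x \<in> {-a..a} \<Longrightarrow> \<bar>sinc x0\<bar> \<le> \<bar>sinc x\<bar>"
    using continuous_attains_inf[of "{-a..a}" "\<lambda>x. \<bar>sinc x\<bar>"] assms by auto
  have "sin x0 \<noteq> 0" if "x0 \<noteq> 0"
  proof (cases "x0 > 0")
    case True
    then show ?thesis using sin_gt_zero[of x0] x0 assms by auto
  next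
    case False
    then show ?thesis using sin_gt_zero[of "- x0"] x0 assms that by auto
  qed
  then have "\<bar>sinc x0\<bar> > 0" by auto
  moreover have "\<bar>sinc x0\<bar> * \<bar>\<theta>\<bar> \<le> \<bar>sin \<theta>\<bar>" if "\<bar>\<theta>\<bar> \<le> a" for \<theta>
  proof (cases "\<theta> = 0")
    case False
    have "\<bar>sinc x0\<bar> * \<bar>\<theta>\<bar> \<le> \<bar>sinc \<theta>\<bar> * \<bar>\<theta>\<bar>"
      using that by (intro mult_right_mono x0(2)) auto
    also have "\<dots> = \<bar>sin \<theta>\<bar>"
      using False by (simp add: abs_divide)
    finally show ?thesis .
  qed simp
  ultimately show ?thesis by (rule that)
qed

lemma norm_cis_diff: "cmod (cis a - cis b) = 2 * \<bar>sin ((a - b) / 2)\<bar>"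
proof -
  have "sin ((b - a) / 2) = - sin ((a - b) / 2)"
    using sin_minus[of "(a - b) / 2"] by (simp add: minus_divide_left)
  then have "cis a - cis b = cis ((a + b) / 2) * (2 * \<i> * of_real (sin ((a - b) / 2)))"
    by (intro complex_eqI) (simp_all add: cos_diff_cos sin_diff_sin)
  then show ?thesis
    by (simp add: norm_mult)
qed

lemma sum_int_telescope:
  fixes d :: "int \<Rightarrow> 'a::ab_group_add"
  shows "(\<Sum>n\<in>{- int N..int N}. d (n - 1) - d n) = d (- int N - 1) - d (int N)"
proof (induction N)
  case (Suc N)
  have "{- int (Suc N)..int (Suc N)} = insert (- int (Suc N)) (insert (int (Suc N)) {- int N..int N})"
    by auto
  then show ?case
    using Suc by (simp add: algebra_simps) (rule arg_cong[where f = d], simp)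
qed simp

text \<open>Dominated convergence passes from the unordered sum to symmetric partial sums, the ones
  that telescope.\<close>

lemma integral_count_space_int_LIMSEQ:
  fixes a :: "int \<Rightarrow> complex"
  assumes "integrable (count_space UNIV) a"
  shows "(\<lambda>N. \<Sum>n\<in>{- int N..int N}. a n) \<longlonglongrightarrow> (\<integral>n. a n \<partial>count_space UNIV)"
proof -
  have "(\<lambda>N. \<integral>n. indicator {- int N..int N} n *\<^sub>R a n \<partial>count_space UNIV) \<longlonglongrightarrow> (\<integral>n. a n \<partial>count_space UNIV)"
  proof (rule integral_dominated_convergence)
    show "integrable (count_space UNIV) (\<lambda>n. norm (a n))"
      using assms by (rule integrable_norm)
    show "AE n in count_space UNIV. (\<lambda>N. indicator {- int N..int N} n *\<^sub>R a n) \<longlonglongrightarrow> a n"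
    proof (rule AE_I2)
      fix n :: int
      have "eventually (\<lambda>N. indicator {- int N..int N} n *\<^sub>R a n = a n) sequentially"
        by (rule eventually_sequentiallyI[of "nat \<bar>n\<bar>"]) (auto simp: indicator_def)
      then show "(\<lambda>N. indicator {- int N..int N} n *\<^sub>R a n) \<longlonglongrightarrow> a n"
        by (rule tendsto_eventually)
    qed
  qed (auto split: split_indicator)
  moreover have "(\<integral>n. indicator {- int N..int N} n *\<^sub>R a n \<partial>count_space UNIV) = (\<Sum>n\<in>{- int N..int N}. a n)" for N
  proof -
    have "(\<integral>n. indicator {- int N..int N} n *\<^sub>R a n \<partial>count_space UNIV)
        = (\<integral>n. a n \<partial>count_space {- int N..int N})"
      using integral_restrict_space[of "{- int N..int N}" "count_space UNIV" a] by (simp add: restrict_count_space)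
    then show ?thesis
      by (simp add: lebesgue_integral_count_space_finite)
  qed
  ultimately show ?thesis by simp
qed

text \<open>Chernoff's argument: dividing \<open>f - f x0\<close> by \<open>character L 1 - character L 1 x0\<close> leaves a bounded
  function, and this turns the partial sums of the series at \<open>x0\<close> into telescoping sums.\<close>

lemma fourier_series_inversion:
  fixes f :: "real \<Rightarrow> complex"
  assumes L: "L > 0" and cont: "continuous_on {0..L} f" and x0: "0 < x0" "x0 < L"
    and lip: "\<And>x. x \<in> {0..L} \<Longrightarrow> norm (f x - f x0) \<le> K * \<bar>x - x0\<bar>"
    and int: "integrable (count_space UNIV) (fourier_coeff L f)"
  shows "(\<integral>n. fourier_coeff L f n * character L n x0 \<partial>count_space UNIV) = f x0"
proof -
  define E where "E = character L 1"
  \<comment> \<open>At \<open>x0\<close> the quotient is 0 by the convention for division by 0; the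
    identity \<open>gE\<close> still holds there, since both of its sides vanish.\<close>
  define g where "g x = (f x - f x0) / (E x - E x0)" for x
  have [measurable]: "f \<in> borel_measurable (circ L)" "E \<in> borel_measurable (circ L)"
    using measurable_circI[OF cont] by (auto simp: E_def)
  have [measurable]: "g \<in> borel_measurable (circ L)"
    unfolding g_def[abs_def] by measurable
  \<comment> \<open>Bounds the half angle \<open>pi * (x - x0) / L\<close>. Since \<open>x0\<close>
    is an interior point, \<open>a < pi\<close>; for \<open>x0\<close> at one end of the interval
    the character would return to its value at the other end, and \<open>g\<close> could be
    unbounded.\<close>
  define a where "a = pi * max x0 (L - x0) / L"
  have a: "0 \<le> a" "a < pi"
    using x0 L by (auto simp: a_def field_simps max_def)
  obtain c where c: "c > 0" "\<And>\<theta>. \<bar>\<theta>\<bar> \<le> a \<Longrightarrow> c * \<bar>\<theta>\<bar> \<le> \<bar>sin \<theta>\<bar>"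
    using abs_sin_ge_linear[OF a] by blast
  have lower: "2 * c * pi / L * \<bar>x - x0\<bar> \<le> cmod (E x - E x0)" if "x \<in> {0..L}" for x
  proof -
    have half: "(2 * pi * x / L - 2 * pi * x0 / L) / 2 = pi * (x - x0) / L"
      using L by (simp add: field_simps)
    have "\<bar>x - x0\<bar> \<le> max x0 (L - x0)"
      using that by auto
    then have "pi * \<bar>x - x0\<bar> / L \<le> a"
      using L unfolding a_def by (intro divide_right_mono mult_left_mono) auto
    then have "\<bar>pi * (x - x0) / L\<bar> \<le> a"
      using L by (simp add: abs_mult)
    from c(2)[OF this] have "c * (pi * \<bar>x - x0\<bar> / L) \<le> \<bar>sin (pi * (x - x0) / L)\<bar>"
      using L by (simp add: abs_mult)
    moreover have "cmod (E x - E x0) = 2 * \<bar>sin (pi * (x - x0) / L)\<bar>"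
      unfolding E_def character_def norm_cis_diff using half by simp
    ultimately show ?thesis
      by (simp add: mult.assoc)
  qed
  define k where "k = 2 * c * pi / L"
  have k: "k > 0" using c L by (simp add: k_def)
  have lower': "k * \<bar>x - x0\<bar> \<le> cmod (E x - E x0)" if "x \<in> {0..L}" for x
    using lower[OF that] by (simp add: k_def)
  have gE: "f x - f x0 = g x * (E x - E x0)" if "x \<in> {0..L}" for x
  proof (cases "x = x0")
    case False
    then have "0 < k * \<bar>x - x0\<bar>" using k by simp
    then have "E x - E x0 \<noteq> 0"
      using lower'[OF that] by (auto simp del: right_minus_eq)
    then show ?thesis by (simp add: g_def)
  qed simp
  have gB: "norm (g x) \<le> K / k" if "x \<in> {0..L}" for x
  proof (cases "x = x0")
    case True
    have "0 \<le> K * \<bar>0 - x0\<bar>"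
      using order_trans[OF norm_ge_zero lip[of 0]] L by simp
    then have "0 \<le> K" using x0 by (simp add: zero_le_mult_iff)
    then show ?thesis using True k by (simp add: g_def)
  next
    case False
    have pos: "0 < k * \<bar>x - x0\<bar>" using False k by simp
    have "norm (g x) = norm (f x - f x0) / norm (E x - E x0)"
      by (simp add: g_def norm_divide)
    also have "\<dots> \<le> (K * \<bar>x - x0\<bar>) / (k * \<bar>x - x0\<bar>)"
      using lip[OF that] lower'[OF that] pos by (intro frac_le) (auto intro: order_trans[OF norm_ge_zero])
    also have "\<dots> = K / k" using False by simp
    finally show ?thesis .
  qed
  \<comment> \<open>For \<open>f - f x0\<close> the coefficient is
    \<open>fourier_coeff L g (n - 1) - E x0 * fourier_coeff L g n\<close>. Multiplication by the
    character at \<open>x0\<close> turns this into a difference of consecutive values of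
    \<open>d\<close>.\<close>
  define d where "d n = character L (n + 1) x0 * fourier_coeff L g n" for n
  have tele: "fourier_coeff L f n * character L n x0 = (if n = 0 then f x0 else 0) + (d (n - 1) - d n)" for n
  proof -
    have ig: "integrable (circ L) (\<lambda>x. cnj (character L m x) * g x)" for m
      using gB by (intro integrable_circ_bounded[where B = "K / k"]) (auto simp: norm_mult)
    have "(\<integral>x. cnj (character L n x) * f x \<partial>circ L)
        = (\<integral>x. f x0 * character L (- n) x + (cnj (character L (n - 1) x) * g x - E x0 * (cnj (character L n x) * g x)) \<partial>circ L)"
    proof (rule Bochner_Integration.integral_cong[OF refl])
      fix x assume "x \<in> space (circ L)"
      then have eq1: "f x = f x0 + g x * (E x - E x0)"
        using gE[of x] by (simp add: algebra_simps)
      have eq2: "cnj (character L (n - 1) x) = cnj (character L n x) * E x"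
        using character_add[of L "- n" 1 x] by (simp add: cnj_character_minus E_def)
      show "cnj (character L n x) * f x = f x0 * character L (- n) x
          + (cnj (character L (n - 1) x) * g x - E x0 * (cnj (character L n x) * g x))"
        unfolding eq1 eq2 by (simp add: cnj_character_minus algebra_simps)
    qed
    also have "\<dots> = f x0 * (if - n = 0 then of_real L else 0)
        + ((\<integral>x. cnj (character L (n - 1) x) * g x \<partial>circ L) - E x0 * (\<integral>x. cnj (character L n x) * g x \<partial>circ L))"
      using ig by (simp only: Bochner_Integration.integral_add Bochner_Integration.integral_diff
          integrable_mult_right integrable_circ_character Bochner_Integration.integrable_diff
          integral_mult_right_zero integral_character[OF L])
    finally have cf: "fourier_coeff L f n = (if n = 0 then f x0 else 0) + (fourier_coeff L g (n - 1) - E x0 * fourier_coeff L g n)"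
      using L by (simp add: fourier_coeff_circ add_divide_distrib diff_divide_distrib)
    have "character L (n + 1) x0 = character L n x0 * E x0"
      by (simp add: character_add E_def)
    moreover have "character L 0 x0 = 1"
      by (simp add: character_def)
    ultimately show ?thesis
      unfolding cf by (simp add: d_def algebra_simps)
  qed
  have sums: "(\<Sum>n\<in>{- int N..int N}. fourier_coeff L f n * character L n x0) = f x0 + (d (- int N - 1) - d (int N))" for N
    unfolding tele sum.distrib sum_int_telescope by (simp add: sum.delta)
  have "inj (\<lambda>N. - int N - 1)" "inj int" by (auto simp: inj_def)
  have d0: "(\<lambda>N. d (\<phi> N)) \<longlonglongrightarrow> 0" if "inj \<phi>" for \<phi> :: "nat \<Rightarrow> int"
  proof -
    have "(\<lambda>N. fourier_coeff L g (\<phi> N)) \<longlonglongrightarrow> 0"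
      by (rule fourier_coeff_tendsto_0[OF L _ gB that]) measurable
    then show ?thesis
      by - (rule tendsto_norm_zero_cancel, simp add: d_def norm_mult tendsto_norm_zero)
  qed
  have "(\<lambda>N. f x0 + (d (- int N - 1) - d (int N))) \<longlonglongrightarrow> f x0 + (0 - 0)"
    by (intro tendsto_intros d0 \<open>inj int\<close> \<open>inj (\<lambda>N. - int N - 1)\<close>)
  then have lim1: "(\<lambda>N. \<Sum>n\<in>{- int N..int N}. fourier_coeff L f n * character L n x0) \<longlonglongrightarrow> f x0"
    unfolding sums by simp
  have "integrable (count_space UNIV) (\<lambda>n. fourier_coeff L f n * character L n x0)"
    by (rule Bochner_Integration.integrable_bound[OF int]) (auto simp: norm_mult)
  from integral_count_space_int_LIMSEQ[OF this] lim1 show ?thesis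
    by (rule LIMSEQ_unique)
qed

section \<open>The Fourier transform on the real line\<close>

text \<open>Decay in each variable separately yields a majorant in product form; it makes the kernel
  integrable on the product space.\<close>

lemma (in pair_sigma_finite) Fubini_dominated:
  fixes K :: "'a \<Rightarrow> 'b \<Rightarrow> complex" and p :: "'a \<Rightarrow> real" and q :: "'b \<Rightarrow> real"
  assumes K [measurable]: "case_prod K \<in> borel_measurable (M1 \<Otimes>\<^sub>M M2)"
    and p: "integrable M1 p" and q: "integrable M2 q"
    and le: "\<And>x y. x \<in> space M1 \<Longrightarrow> y \<in> space M2 \<Longrightarrow> norm (K x y) \<le> p x * q y"
  shows "(\<integral>x. (\<integral>y. K x y \<partial>M2) \<partial>M1) = (\<integral>y. (\<integral>x. K x y \<partial>M1) \<partial>M2)"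
proof -
  have [measurable]: "p \<in> borel_measurable M1" "q \<in> borel_measurable M2"
    using p q by auto
  have "integrable (M1 \<Otimes>\<^sub>M M2) (\<lambda>(x, y). p x * q y)"
  proof (rule Fubini_integrable)
    have "integrable M1 (\<lambda>x. norm (p x) * (\<integral>y. norm (q y) \<partial>M2))"
      using p by (intro integrable_mult_left integrable_norm)
    then show "integrable M1 (\<lambda>x. \<integral>y. norm (case (x, y) of (x, y) \<Rightarrow> p x * q y) \<partial>M2)"
      by (simp add: abs_mult)
    show "AE x in M1. integrable M2 (\<lambda>y. case (x, y) of (x, y) \<Rightarrow> p x * q y)"
      using q by auto
  qed measurable
  then have "integrable (M1 \<Otimes>\<^sub>M M2) (case_prod K)"
    by (rule Bochner_Integration.integrable_bound)
       (use le in \<open>auto simp: space_pair_measure intro!: order_trans[OF _ abs_ge_self]\<close>)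
  from Fubini_integral[OF this] show ?thesis by simp
qed

lemma bracket_neq_0 [simp]: "bracket x \<noteq> 0"
  by (rule less_imp_neq[OF bracket_pos, symmetric])

lemma integrable_bracket_powr: "a > 1 \<Longrightarrow> integrable lborel (\<lambda>t. c * bracket t powr (- a))"
  using bracket_integral_finite[of a]
  by (intro integrable_mult_right integrableI_nonneg) auto

lemma integrable_bracket_bound:
  fixes f :: "real \<Rightarrow> complex"
  assumes "f \<in> borel_measurable borel" "\<And>t. norm (f t) \<le> C * bracket t powr (- 2)"
  shows "integrable lborel f"
proof (rule Bochner_Integration.integrable_bound)
  show "integrable lborel (\<lambda>t. C * bracket t powr (- 2))"
    by (rule integrable_bracket_powr) simp
  show "AE t in lborel. norm (f t) \<le> norm (C * bracket t powr (- 2))"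
    by (intro AE_I2 order_trans[OF assms(2)]) simp
qed (use assms(1) in simp)

lemma borel_measurable_cis [measurable]: "cis \<in> borel_measurable borel"
  by (intro borel_measurable_continuous_onI continuous_intros)

definition ftrans :: "(real \<Rightarrow> complex) \<Rightarrow> real \<Rightarrow> complex" where
  "ftrans f \<tau> = (\<integral>t. cis (- (\<tau> * t)) * f t \<partial>lborel)"

lemma borel_measurable_ftrans [measurable]:
  assumes [measurable]: "f \<in> borel_measurable borel"
  shows "ftrans f \<in> borel_measurable borel"
  unfolding ftrans_def[abs_def] by measurable

lemma integrable_cis_mult:
  assumes "integrable lborel f"
  shows "integrable lborel (\<lambda>t. cis (a * t) * f t)"
proof (rule Bochner_Integration.integrable_bound[OF assms])
  have [measurable]: "f \<in> borel_measurable borel"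
    using assms by auto
  show "(\<lambda>t. cis (a * t) * f t) \<in> borel_measurable lborel"
    by measurable
qed (simp add: norm_mult)

text \<open>The characteristic function of the standard normal law, rescaled. As a function of
  \<open>a\<close> the right side is an approximate identity of mass \<open>2 * pi\<close> and width
  \<epsilon>.\<close>

lemma gaussian_ftrans:
  assumes "\<epsilon> > 0"
  shows "(\<integral>\<tau>. cis (\<tau> * a) * of_real (exp (- (\<epsilon> * \<tau>)\<^sup>2 / 2)) \<partial>lborel)
    = of_real (2 * pi / \<epsilon> * std_normal_density (a / \<epsilon>))"
proof -
  have "(\<integral>y. cis (y * (a / \<epsilon>)) * of_real (std_normal_density y) \<partial>lborel) = char std_normal_distribution (a / \<epsilon>)"
    unfolding char_def
    by (subst integral_density) (auto simp: cis_conv_exp scaleR_conv_of_real mult_ac)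
  also have "\<dots> = of_real (exp (- (a / \<epsilon>)\<^sup>2 / 2))"
    by (simp add: char_std_normal_distribution)
  finally have char: "(\<integral>y. cis (y * (a / \<epsilon>)) * of_real (std_normal_density y) \<partial>lborel) = of_real (exp (- (a / \<epsilon>)\<^sup>2 / 2))" .
  have "(\<integral>\<tau>. cis (\<tau> * a) * of_real (exp (- (\<epsilon> * \<tau>)\<^sup>2 / 2)) \<partial>lborel)
      = \<bar>1 / \<epsilon>\<bar> *\<^sub>R (\<integral>y. cis ((0 + 1 / \<epsilon> * y) * a) * of_real (exp (- (\<epsilon> * (0 + 1 / \<epsilon> * y))\<^sup>2 / 2)) \<partial>lborel)"
    using assms by (intro lborel_integral_real_affine) auto
  also have "\<dots> = (1 / \<epsilon>) *\<^sub>R (\<integral>y. of_real (sqrt (2 * pi)) * (cis (y * (a / \<epsilon>)) * of_real (std_normal_density y)) \<partial>lborel)"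
    using assms by (simp add: std_normal_density_def mult_ac)
  also have "\<dots> = of_real (1 / \<epsilon>) * (of_real (sqrt (2 * pi)) * of_real (exp (- (a / \<epsilon>)\<^sup>2 / 2)))"
    unfolding integral_mult_right_zero char by (simp only: scaleR_conv_of_real)
  also have "\<dots> = of_real (1 / \<epsilon> * (sqrt (2 * pi) * exp (- (a / \<epsilon>)\<^sup>2 / 2)))"
    by (simp only: of_real_mult)
  also have "1 / \<epsilon> * (sqrt (2 * pi) * exp (- (a / \<epsilon>)\<^sup>2 / 2)) = 2 * pi / \<epsilon> * std_normal_density (a / \<epsilon>)"
  proof -
    have "1 / \<epsilon> * (R * x) = c / \<epsilon> * (1 / R * x)" if "c = R * R" "R \<noteq> 0" for R c x :: real
      using that by simp
    from this[of "2 * pi" "sqrt (2 * pi)"] show ?thesis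
      unfolding std_normal_density_def by simp
  qed
  finally show ?thesis .
qed

text \<open>Gaussian damping makes the double integral absolutely convergent. After the exchange of
  integrals it is \<open>2 * pi\<close> times an average of \<open>f\<close> near \<open>t\<close>
  at scale \<epsilon>. As \<epsilon> tends to 0, the damping disappears on one side and continuity
  gives \<open>f t\<close> on the other.\<close>

lemma ftrans_inversion:
  fixes f :: "real \<Rightarrow> complex"
  assumes cont: "continuous_on UNIV f" and int: "integrable lborel f"
    and bd: "\<And>t. norm (f t) \<le> B" and inth: "integrable lborel (ftrans f)"
  shows "(\<integral>\<tau>. cis (\<tau> * t) * ftrans f \<tau> \<partial>lborel) = 2 * pi * f t"
proof -
  have [measurable]: "f \<in> borel_measurable borel"
    by (rule borel_measurable_continuous_onI[OF cont])
  define G where "G \<epsilon> \<tau> = exp (- (\<epsilon> * \<tau>)\<^sup>2 / 2)" for \<epsilon> \<tau> :: real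
  have [measurable]: "G \<epsilon> \<in> borel_measurable borel" for \<epsilon>
    unfolding G_def[abs_def] by measurable
  have smoothed: "(\<integral>\<tau>. of_real (G \<epsilon> \<tau>) * (cis (\<tau> * t) * ftrans f \<tau>) \<partial>lborel)
      = 2 * pi * (\<integral>y. of_real (std_normal_density y) * f (t - \<epsilon> * y) \<partial>lborel)" if "\<epsilon> > 0" for \<epsilon>
  proof -
    have intG: "integrable lborel (G \<epsilon>)"
    proof -
      have "integrable lborel (\<lambda>\<tau>. sqrt (2 * pi) * std_normal_density (0 + \<epsilon> * \<tau>))"
        using that by (intro integrable_mult_right lborel_integrable_real_affine integrable_normal_density) auto
      then show ?thesis
        by (simp add: std_normal_density_def G_def[abs_def])
    qed
    have "(\<integral>\<tau>. of_real (G \<epsilon> \<tau>) * (cis (\<tau> * t) * ftrans f \<tau>) \<partial>lborel)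
        = (\<integral>\<tau>. (\<integral>s. f s * (cis (\<tau> * (t - s)) * of_real (G \<epsilon> \<tau>)) \<partial>lborel) \<partial>lborel)"
      unfolding ftrans_def integral_mult_right_zero[symmetric]
      by (intro Bochner_Integration.integral_cong refl) (simp add: cis_mult[symmetric] right_diff_distrib cis_divide[symmetric] cis_inverse[symmetric] field_simps)
    also have "\<dots> = (\<integral>s. (\<integral>\<tau>. f s * (cis (\<tau> * (t - s)) * of_real (G \<epsilon> \<tau>)) \<partial>lborel) \<partial>lborel)"
      by (rule lborel_pair.Fubini_dominated[OF _ intG integrable_norm[OF int]])
         (measurable, simp add: norm_mult G_def)
    also have "\<dots> = (\<integral>s. f s * of_real (2 * pi / \<epsilon> * std_normal_density ((t - s) / \<epsilon>)) \<partial>lborel)"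
      unfolding integral_mult_right_zero G_def gaussian_ftrans[OF that] ..
    also have "\<dots> = \<bar>- \<epsilon>\<bar> *\<^sub>R (\<integral>y. f (t + - \<epsilon> * y) * of_real (2 * pi / \<epsilon> * std_normal_density ((t - (t + - \<epsilon> * y)) / \<epsilon>)) \<partial>lborel)"
      using that by (intro lborel_integral_real_affine) auto
    also have "\<dots> = (\<integral>y. 2 * pi * (of_real (std_normal_density y) * f (t - \<epsilon> * y)) \<partial>lborel)"
      unfolding integral_scaleR_right[symmetric]
      using that by (intro Bochner_Integration.integral_cong refl) (simp add: scaleR_conv_of_real field_simps)
    also have "\<dots> = 2 * pi * (\<integral>y. of_real (std_normal_density y) * f (t - \<epsilon> * y) \<partial>lborel)"
      by (rule integral_mult_right_zero)
    finally show ?thesis .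
  qed
  define e where "e n = 1 / real (Suc n)" for n
  have e: "e n > 0" "e \<longlonglongrightarrow> 0" for n
    unfolding e_def using LIMSEQ_Suc[OF lim_1_over_n] by (auto simp: e_def[abs_def])
  have lim1: "(\<lambda>n. \<integral>\<tau>. of_real (G (e n) \<tau>) * (cis (\<tau> * t) * ftrans f \<tau>) \<partial>lborel)
      \<longlonglongrightarrow> (\<integral>\<tau>. cis (\<tau> * t) * ftrans f \<tau> \<partial>lborel)"
  proof (rule integral_dominated_convergence)
    show "integrable lborel (\<lambda>\<tau>. norm (ftrans f \<tau>))"
      using inth by (rule integrable_norm)
    show "AE \<tau> in lborel. (\<lambda>n. of_real (G (e n) \<tau>) * (cis (\<tau> * t) * ftrans f \<tau>)) \<longlonglongrightarrow> cis (\<tau> * t) * ftrans f \<tau>"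
    proof (rule AE_I2)
      fix \<tau> :: real
      have "(\<lambda>n. of_real (G (e n) \<tau>) * (cis (\<tau> * t) * ftrans f \<tau>)) \<longlonglongrightarrow> of_real (exp (- (0 * \<tau>)\<^sup>2 / 2)) * (cis (\<tau> * t) * ftrans f \<tau>)"
        unfolding G_def by (intro tendsto_intros e) simp
      then show "(\<lambda>n. of_real (G (e n) \<tau>) * (cis (\<tau> * t) * ftrans f \<tau>)) \<longlonglongrightarrow> cis (\<tau> * t) * ftrans f \<tau>"
        by simp
    qed
    show "AE \<tau> in lborel. norm (of_real (G (e n) \<tau>) * (cis (\<tau> * t) * ftrans f \<tau>)) \<le> norm (ftrans f \<tau>)" for n
      by (rule AE_I2) (simp add: norm_mult G_def mult_left_le_one_le)
  qed measurable
  have int_normal: "integrable lborel (\<lambda>y. complex_of_real (std_normal_density y))"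
    by (simp add: integrable_normal_density)
  have lim2: "(\<lambda>n. \<integral>y. of_real (std_normal_density y) * f (t - e n * y) \<partial>lborel)
      \<longlonglongrightarrow> (\<integral>y. of_real (std_normal_density y) * f t \<partial>lborel)"
  proof (rule integral_dominated_convergence)
    show "integrable lborel (\<lambda>y. std_normal_density y * B)"
      by (intro integrable_mult_left integrable_normal_density) auto
    show "AE y in lborel. (\<lambda>n. of_real (std_normal_density y) * f (t - e n * y)) \<longlonglongrightarrow> of_real (std_normal_density y) * f t"
    proof (rule AE_I2)
      fix y :: real
      have "(\<lambda>n. t - e n * y) \<longlonglongrightarrow> t - 0 * y"
        by (intro tendsto_intros e)
      then have "(\<lambda>n. f (t - e n * y)) \<longlonglongrightarrow> f t"
        using cont by (intro isCont_tendsto_compose[of _ f]) (auto simp: continuous_on_eq_continuous_at)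
      then show "(\<lambda>n. of_real (std_normal_density y) * f (t - e n * y)) \<longlonglongrightarrow> of_real (std_normal_density y) * f t"
        by (intro tendsto_intros)
    qed
    show "AE y in lborel. norm (of_real (std_normal_density y) * f (t - e n * y)) \<le> std_normal_density y * B" for n
      by (rule AE_I2) (auto simp: norm_mult intro!: mult_left_mono bd)
  qed measurable
  have "(\<integral>y. of_real (std_normal_density y) * f t \<partial>lborel) = f t"
    using integral_normal_density[of 1 0] by (simp only: integral_mult_left_zero integral_complex_of_real) simp
  then have "(\<lambda>n. 2 * pi * (\<integral>y. of_real (std_normal_density y) * f (t - e n * y) \<partial>lborel)) \<longlonglongrightarrow> 2 * pi * f t"
    using lim2 by (intro tendsto_mult tendsto_const) simp
  then have "(\<lambda>n. \<integral>\<tau>. of_real (G (e n) \<tau>) * (cis (\<tau> * t) * ftrans f \<tau>) \<partial>lborel) \<longlonglongrightarrow> 2 * pi * f t"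
    unfolding smoothed[OF e(1)] .
  with lim1 show ?thesis
    by (rule LIMSEQ_unique)
qed

text \<open>Inversion is inserted for \<open>f\<close> only, so that \<open>w\<close> enters just
  through its integrability. The factor \<open>2 * pi\<close> reflects the transform without
  normalising constant.\<close>

lemma ftrans_mult:
  fixes f w :: "real \<Rightarrow> complex"
  assumes f: "continuous_on UNIV f" "integrable lborel f" "\<And>t. norm (f t) \<le> B" "integrable lborel (ftrans f)"
    and w: "integrable lborel w"
  shows "2 * pi * ftrans (\<lambda>t. f t * w t) \<tau> = (\<integral>\<sigma>. ftrans f \<sigma> * ftrans w (\<tau> - \<sigma>) \<partial>lborel)"
proof -
  have [measurable]: "f \<in> borel_measurable borel" "w \<in> borel_measurable borel"
    using borel_measurable_continuous_onI[OF f(1)] w by auto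
  have "2 * pi * ftrans (\<lambda>t. f t * w t) \<tau> = (\<integral>t. cis (- (\<tau> * t)) * w t * (2 * pi * f t) \<partial>lborel)"
    unfolding ftrans_def integral_mult_right_zero[symmetric] by (simp add: mult_ac)
  also have "\<dots> = (\<integral>t. (\<integral>\<sigma>. ftrans f \<sigma> * (cis (- ((\<tau> - \<sigma>) * t)) * w t) \<partial>lborel) \<partial>lborel)"
    unfolding ftrans_inversion[OF f, symmetric] integral_mult_right_zero[symmetric]
  proof (intro Bochner_Integration.integral_cong refl)
    fix t \<sigma>
    have "cis (- ((\<tau> - \<sigma>) * t)) = cis (- (\<tau> * t)) * cis (\<sigma> * t)"
      by (simp add: cis_mult algebra_simps)
    then show "cis (- (\<tau> * t)) * w t * (cis (\<sigma> * t) * ftrans f \<sigma>) = ftrans f \<sigma> * (cis (- ((\<tau> - \<sigma>) * t)) * w t)"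
      by (simp add: mult_ac)
  qed
  also have "\<dots> = (\<integral>\<sigma>. (\<integral>t. ftrans f \<sigma> * (cis (- ((\<tau> - \<sigma>) * t)) * w t) \<partial>lborel) \<partial>lborel)"
    by (rule lborel_pair.Fubini_dominated[OF _ integrable_norm[OF w] integrable_norm[OF f(4)]])
       (measurable, simp add: norm_mult mult_ac)
  also have "\<dots> = (\<integral>\<sigma>. ftrans f \<sigma> * ftrans w (\<tau> - \<sigma>) \<partial>lborel)"
    unfolding integral_mult_right_zero ftrans_def ..
  finally show ?thesis .
qed

text \<open>Integration by parts over the line, where the quadratic decay removes the boundary
  terms.\<close>

lemma ftrans_deriv:
  fixes f f' :: "real \<Rightarrow> complex"
  assumes deriv: "\<And>t. (f has_vector_derivative f' t) (at t)" and cont: "continuous_on UNIV f'"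
    and bd: "\<And>t. norm (f t) \<le> C * bracket t powr (- 2)" "\<And>t. norm (f' t) \<le> C' * bracket t powr (- 2)"
  shows "ftrans f' \<tau> = \<i> * \<tau> * ftrans f \<tau>"
proof -
  have contf: "continuous_on UNIV f"
    by (intro continuous_at_imp_continuous_on ballI has_vector_derivative_continuous[OF deriv])
  have int: "integrable lborel f" "integrable lborel f'"
    using borel_measurable_continuous_onI[OF contf] borel_measurable_continuous_onI[OF cont] bd
    by (auto intro: integrable_bracket_bound)
  have int': "integrable lborel (\<lambda>t. cis (- (\<tau> * t)) * f t)" "integrable lborel (\<lambda>t. cis (- (\<tau> * t)) * f' t)"
    using integrable_cis_mult[OF int(1), of "- \<tau>"] integrable_cis_mult[OF int(2), of "- \<tau>"] by simp_all
  define F where "F t = cis (- (\<tau> * t)) * f t" for t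
  define g where "g t = cis (- (\<tau> * t)) * f' t - \<i> * \<tau> * (cis (- (\<tau> * t)) * f t)" for t
  have F0: "(F \<longlongrightarrow> 0) at_top" "(F \<longlongrightarrow> 0) at_bot"
  proof -
    have lim: "((\<lambda>t::real. C * bracket t powr (- 2)) \<longlongrightarrow> 0) at_top" "((\<lambda>t::real. C * bracket t powr (- 2)) \<longlongrightarrow> 0) at_bot"
      unfolding bracket_def by real_asymp+
    have le: "norm (F t) \<le> C * bracket t powr (- 2)" for t
      using bd(1)[of t] by (simp add: F_def norm_mult)
    show "(F \<longlongrightarrow> 0) at_top" "(F \<longlongrightarrow> 0) at_bot"
      by (rule Lim_null_comparison[OF always_eventually[OF allI[OF le]] lim(1)])
         (rule Lim_null_comparison[OF always_eventually[OF allI[OF le]] lim(2)])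
  qed
  have "(LBINT t=-\<infinity>..\<infinity>. g t) = 0 - 0"
  proof (rule interval_integral_FTC_integrable)
    fix t
    show "(F has_vector_derivative g t) (at t)"
    proof -
      have "((\<lambda>t. cis (- (\<tau> * t))) has_vector_derivative (- \<i> * \<tau> * cis (- (\<tau> * t)))) (at t)"
        unfolding has_vector_derivative_def
        by (auto intro!: derivative_eq_intros simp: scaleR_conv_of_real algebra_simps)
      from has_vector_derivative_mult[OF this deriv]
      show ?thesis
        unfolding F_def g_def by (simp add: algebra_simps)
    qed
    show "isCont g t"
    proof -
      have "continuous_on UNIV g"
        unfolding g_def[abs_def] by (intro continuous_intros cont contf)
      then show ?thesis
        by (simp add: continuous_on_eq_continuous_at)
    qed
  next
    show "set_integrable lborel (einterval (-\<infinity>) \<infinity>) g"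
      using int' unfolding set_integrable_def g_def by simp
    show "((F \<circ> real_of_ereal) \<longlongrightarrow> 0) (at_right (-\<infinity>))" "((F \<circ> real_of_ereal) \<longlongrightarrow> 0) (at_left \<infinity>)"
      using F0 by (simp_all add: ereal_tendsto_simps)
  qed simp
  then have "(\<integral>t. g t \<partial>lborel) = 0"
    by (simp add: interval_lebesgue_integral_def set_lebesgue_integral_def)
  then show ?thesis
    using int' unfolding g_def ftrans_def by simp
qed

lemma norm_ftrans_le:
  assumes "f \<in> borel_measurable borel" "\<And>t. norm (f t) \<le> C * bracket t powr (- 2)"
  shows "norm (ftrans f \<tau>) \<le> C * bracket_integral 2"
proof -
  have int: "integrable lborel f"
    using assms by (rule integrable_bracket_bound)
  have "norm (ftrans f \<tau>) \<le> (\<integral>t. norm (cis (- (\<tau> * t)) * f t) \<partial>lborel)"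
    unfolding ftrans_def by (rule integral_norm_bound)
  also have "\<dots> \<le> (\<integral>t. C * bracket t powr (- 2) \<partial>lborel)"
    using int assms(2) by (intro integral_mono integrable_bracket_powr) (auto simp: norm_mult)
  also have "\<dots> = C * bracket_integral 2"
    using bracket_integral_finite[of 2]
    by (simp add: bracket_integral_def integral_eq_nn_integral)
  finally show ?thesis .
qed

text \<open>The reason is \<open>(1 + \<tau>\<^sup>2) ftrans f \<tau> = ftrans (f - f'') \<tau>\<close>.\<close>

lemma norm_ftrans_le_smooth:
  fixes f f' f'' :: "real \<Rightarrow> complex"
  assumes "\<And>t. (f has_vector_derivative f' t) (at t)" "\<And>t. (f' has_vector_derivative f'' t) (at t)"
    and "continuous_on UNIV f''"
    and bd: "\<And>t. norm (f t) \<le> C * bracket t powr (- 2)" "\<And>t. norm (f' t) \<le> C * bracket t powr (- 2)"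
      "\<And>t. norm (f'' t) \<le> C * bracket t powr (- 2)"
  shows "norm (ftrans f \<tau>) \<le> 4 * C * bracket_integral 2 * bracket \<tau> powr (- 2)"
proof -
  have cont: "continuous_on UNIV f" "continuous_on UNIV f'"
    by (intro continuous_at_imp_continuous_on ballI has_vector_derivative_continuous[OF assms(1)]
        has_vector_derivative_continuous[OF assms(2)])+
  have "ftrans f'' \<tau> = \<i> * \<tau> * (\<i> * \<tau> * ftrans f \<tau>)"
    using ftrans_deriv[OF assms(2,3) bd(2,3)] ftrans_deriv[OF assms(1) cont(2) bd(1,2)] by simp
  then have "norm (ftrans f'' \<tau>) = \<tau>\<^sup>2 * norm (ftrans f \<tau>)"
    by (simp add: norm_mult power2_eq_square)
  moreover have "norm (ftrans f'' \<tau>) \<le> C * bracket_integral 2" "norm (ftrans f \<tau>) \<le> C * bracket_integral 2"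
    using borel_measurable_continuous_onI[OF assms(3)] borel_measurable_continuous_onI[OF cont(1)] bd
    by (auto intro: norm_ftrans_le)
  ultimately have "(1 + \<tau>\<^sup>2) * norm (ftrans f \<tau>) \<le> 2 * (C * bracket_integral 2)"
    by (simp add: algebra_simps)
  moreover have "(bracket \<tau>)\<^sup>2 \<le> 2 * (1 + \<tau>\<^sup>2)"
    using zero_le_power2[of "1 - \<bar>\<tau>\<bar>"] by (simp add: bracket_def power2_eq_square algebra_simps)
  then have "(bracket \<tau>)\<^sup>2 * norm (ftrans f \<tau>) \<le> 2 * ((1 + \<tau>\<^sup>2) * norm (ftrans f \<tau>))"
    unfolding mult.assoc[symmetric] by (rule mult_right_mono) simp
  ultimately have "(bracket \<tau>)\<^sup>2 * norm (ftrans f \<tau>) \<le> 4 * C * bracket_integral 2"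
    by linarith
  then have "norm (ftrans f \<tau>) \<le> 4 * C * bracket_integral 2 / (bracket \<tau>)\<^sup>2"
    by (subst pos_le_divide_eq) (auto simp: mult.commute)
  then show ?thesis
    by (simp add: powr_minus divide_inverse)
qed

section \<open>The space-time Fourier transform of a product\<close>

text \<open>What is asked of the second factor of a product. It holds for Schwartz functions and
  their iterated derivatives, and it passes to conjugates without any derivative of the conjugate
  being examined.\<close>

definition decaying :: "(real \<Rightarrow> real \<Rightarrow> complex) \<Rightarrow> bool" where
  "decaying w \<longleftrightarrow> continuous_on UNIV (case_prod w) \<and> (\<exists>C. \<forall>t x. cmod (w t x) \<le> C * bracket t powr (- 2))"

lemma decayingE:
  assumes "decaying w"
  obtains C where "C \<ge> 0" "\<And>t x. cmod (w t x) \<le> C * bracket t powr (- 2)"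
proof -
  obtain C where C: "\<And>t x. cmod (w t x) \<le> C * bracket t powr (- 2)"
    using assms by (auto simp: decaying_def)
  have "0 \<le> C * bracket 0 powr (- 2)"
    by (rule order_trans[OF norm_ge_zero C])
  then have "C \<ge> 0" by (simp add: bracket_def)
  then show ?thesis using C by (rule that)
qed

lemma bracket_powr_m2_le_1: "bracket t powr (- 2) \<le> 1"
  by (intro powr_nonpos_le_1) auto

lemma decaying_continuous:
  assumes "decaying w"
  shows "continuous_on A (\<lambda>x. w t x)" "continuous_on A (\<lambda>t. w t x)"
proof -
  have w: "continuous_on UNIV (case_prod w)" using assms by (simp add: decaying_def)
  have "continuous_on A (\<lambda>x. case_prod w (t, x))"
    by (rule continuous_on_compose2[OF w]) (auto intro!: continuous_intros)
  moreover have "continuous_on A (\<lambda>t. case_prod w (t, x))"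
    by (rule continuous_on_compose2[OF w]) (auto intro!: continuous_intros)
  ultimately show "continuous_on A (\<lambda>x. w t x)" "continuous_on A (\<lambda>t. w t x)" by simp_all
qed

lemma decaying_measurable:
  assumes "decaying w"
  shows "case_prod w \<in> borel_measurable (borel \<Otimes>\<^sub>M borel)"
  using assms unfolding borel_prod decaying_def by (intro borel_measurable_continuous_onI) simp

lemma schwartz_decaying:
  assumes "u \<in> schwartz_per L"
  shows "decaying ((deriv_t ^^ j) ((deriv_x ^^ k) u))"
proof -
  let ?D = "(deriv_t ^^ j) ((deriv_x ^^ k) u)"
  have "(\<lambda>(t, x). ?D t x) differentiable_on UNIV"
    using assms by (simp add: schwartz_per_def smooth_def)
  then have "continuous_on UNIV (case_prod ?D)"
    using differentiable_imp_continuous_on by auto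
  moreover obtain C where C: "\<And>t x. (1 + \<bar>t\<bar>) ^ 2 * cmod (?D t x) \<le> C"
    using assms unfolding schwartz_per_def rapidly_decreasing_def by blast
  have "cmod (?D t x) \<le> C * bracket t powr (- 2)" for t x
  proof -
    have "cmod (?D t x) \<le> C / (bracket t)\<^sup>2"
      using C[of t x] by (subst pos_le_divide_eq) (auto simp: bracket_def mult.commute)
    then show ?thesis by (simp add: powr_minus divide_inverse)
  qed
  ultimately show ?thesis
    unfolding decaying_def by blast
qed

text \<open>Joint differentiability restricted to lines. The part about \<open>x\<close> is confined
  to \<open>j = 0\<close>, because the iterates take the \<open>x\<close> derivatives first: an
  outer \<open>deriv_x\<close> lengthens the list only while no \<open>deriv_t\<close> has been
  applied.\<close>

lemma schwartz_has_derivs: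
  assumes "u \<in> schwartz_per L"
  defines "D \<equiv> \<lambda>j k. (deriv_t ^^ j) ((deriv_x ^^ k) u)"
  shows "((\<lambda>r. D j k r x) has_vector_derivative D (Suc j) k t x) (at t)"
    and "((\<lambda>y. D 0 k t y) has_vector_derivative D 0 (Suc k) t x) (at x)"
proof -
  have diff: "(\<lambda>(t, x). D j k t x) differentiable (at z)" for j k z
    using assms(1) unfolding D_def schwartz_per_def smooth_def differentiable_on_def by blast
  have "(\<lambda>r. (r, x)) differentiable (at t)" "(\<lambda>y. (t, y)) differentiable (at x)"
    by (auto intro!: derivative_intros)
  then have "((\<lambda>(t, x). D j k t x) \<circ> (\<lambda>r. (r, x))) differentiable (at t)"
    "((\<lambda>(t, x). D 0 k t x) \<circ> (\<lambda>y. (t, y))) differentiable (at x)"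
    by (auto intro!: differentiable_chain_at diff)
  then have "(\<lambda>r. D j k r x) differentiable (at t)" "(\<lambda>y. D 0 k t y) differentiable (at x)"
    by (simp_all add: o_def)
  then show "((\<lambda>r. D j k r x) has_vector_derivative D (Suc j) k t x) (at t)"
    and "((\<lambda>y. D 0 k t y) has_vector_derivative D 0 (Suc k) t x) (at x)"
    unfolding vector_derivative_works by (simp_all add: D_def deriv_t_def deriv_x_def)
qed

lemma has_vector_derivative_deriv_x:
  assumes "u \<in> schwartz_per L"
  shows "((\<lambda>y. u t y) has_vector_derivative deriv_x u t x) (at x)"
    "((\<lambda>y. deriv_x u t y) has_vector_derivative deriv_x (deriv_x u) t x) (at x)"
  using schwartz_has_derivs(2)[OF assms, of 0] schwartz_has_derivs(2)[OF assms, of 1]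
  by simp_all

lemma has_vector_derivative_deriv_t:
  assumes "u \<in> schwartz_per L"
  shows "((\<lambda>r. u r x) has_vector_derivative deriv_t u t x) (at t)"
    "((\<lambda>r. deriv_t u r x) has_vector_derivative deriv_t (deriv_t u) t x) (at t)"
  using schwartz_has_derivs(1)[OF assms, of 0 0] schwartz_has_derivs(1)[OF assms, of 1 0]
  by simp_all

lemma schwartz_decaying_derivs:
  assumes "u \<in> schwartz_per L"
  shows "decaying u" "decaying (deriv_x u)" "decaying (deriv_x (deriv_x u))"
    "decaying (deriv_t u)" "decaying (deriv_t (deriv_t u))"
  using schwartz_decaying[OF assms, of 0 0] schwartz_decaying[OF assms, of 0 1] schwartz_decaying[OF assms, of 0 2]
    schwartz_decaying[OF assms, of 1 0] schwartz_decaying[OF assms, of 2 0]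
  by (simp_all add: numeral_2_eq_2)

lemma schwartz_periodic:
  assumes "u \<in> schwartz_per L"
  shows "u t (x + L) = u t x" "deriv_x u t (x + L) = deriv_x u t x"
proof -
  show per: "u t (x + L) = u t x" for x
    using assms by (simp add: schwartz_per_def)
  have "((\<lambda>y. u t (y + L)) has_vector_derivative deriv_x u t (x + L)) (at x)"
  proof -
    have "((\<lambda>y. y + L) has_vector_derivative 1) (at x)"
      unfolding has_real_derivative_iff_has_vector_derivative[symmetric]
      by (auto intro!: derivative_eq_intros)
    from vector_diff_chain_at[OF this has_vector_derivative_deriv_x(1)[OF assms]] show ?thesis
      by (simp add: o_def)
  qed
  then have "((\<lambda>y. u t y) has_vector_derivative deriv_x u t (x + L)) (at x)"
    by (simp add: per)
  from vector_derivative_at[OF this] show "deriv_x u t (x + L) = deriv_x u t x"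
    by (simp add: deriv_x_def)
qed

section \<open>Decay of the transforms of Schwartz functions\<close>

lemma spacetime_fourier_eq_ftrans:
  "spacetime_fourier L w \<tau> n = ftrans (\<lambda>t. fourier_coeff L (w t) n) \<tau>"
  by (simp add: spacetime_fourier_def ftrans_def)

lemma norm_fourier_coeff_decaying:
  assumes "L > 0" "\<And>t x. cmod (w t x) \<le> C * bracket t powr (- 2)"
  shows "cmod (fourier_coeff L (w t) n) \<le> C * bracket t powr (- 2)"
  using assms by (intro norm_fourier_coeff_le) auto

lemma continuous_fourier_coeff:
  assumes "L > 0" "decaying w"
  shows "continuous_on UNIV (\<lambda>t. fourier_coeff L (w t) n)"
proof -
  obtain C where C: "C \<ge> 0" "\<And>t x. cmod (w t x) \<le> C * bracket t powr (- 2)"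
    using decayingE[OF assms(2)] by blast
  have C1: "cmod (w t x) \<le> C" for t x
    using C(2)[of t x] mult_left_mono[OF bracket_powr_m2_le_1[of t] C(1)] by simp
  have meas: "(\<lambda>x. cnj (character L n x) * w t x) \<in> borel_measurable (circ L)" for t
    using measurable_circI[OF decaying_continuous(1)[OF assms(2)]] by measurable
  have "isCont (\<lambda>t. fourier_coeff L (w t) n) t" for t
    unfolding continuous_at_sequentially o_def fourier_coeff_circ
  proof (intro allI impI tendsto_divide tendsto_const)
    fix s :: "nat \<Rightarrow> real" assume s: "s \<longlonglongrightarrow> t"
    show "(\<lambda>k. \<integral>x. cnj (character L n x) * w (s k) x \<partial>circ L) \<longlonglongrightarrow> (\<integral>x. cnj (character L n x) * w t x \<partial>circ L)"
    proof (rule integral_dominated_convergence[where w = "\<lambda>_. C"])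
      show "AE x in circ L. (\<lambda>k. cnj (character L n x) * w (s k) x) \<longlonglongrightarrow> cnj (character L n x) * w t x"
      proof (rule AE_I2)
        fix x
        have "isCont (\<lambda>t. w t x) t"
          using decaying_continuous(2)[OF assms(2), of UNIV x] by (simp add: continuous_on_eq_continuous_at)
        then show "(\<lambda>k. cnj (character L n x) * w (s k) x) \<longlonglongrightarrow> cnj (character L n x) * w t x"
          using s by (intro tendsto_intros isCont_tendsto_compose[of t "\<lambda>t. w t x"])
      qed
    qed (use meas C1 in \<open>auto simp: norm_mult\<close>)
  qed (use assms in simp)
  then show ?thesis
    by (intro continuous_at_imp_continuous_on) auto
qed

lemma borel_measurable_spacetime_fourier:
  assumes "L > 0" "decaying w"
  shows "(\<lambda>\<tau>. spacetime_fourier L w \<tau> n) \<in> borel_measurable borel"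
  unfolding spacetime_fourier_eq_ftrans
  by (intro borel_measurable_ftrans borel_measurable_continuous_onI continuous_fourier_coeff assms)

lemma integrable_count_space_bracket: "integrable (count_space UNIV) (\<lambda>n::int. c * bracket (of_int n) powr (- 2))"
  using bracket_sum_le[of 2 0]
  by (intro integrable_mult_right integrableI_nonneg) (auto intro: order_le_less_trans)

text \<open>Two integrations by parts in \<open>x\<close> give quadratic decay in \<open>n\<close>,
  while the sup bound on \<open>deriv_x (deriv_x u)\<close> preserves the decay in \<open>t\<close>.
  The product is a majorant summable in \<open>n\<close> and integrable in \<open>t\<close>.\<close>

lemma schwartz_fourier_coeff_decay:
  assumes L: "L > 0" and u: "u \<in> schwartz_per L"
  obtains C where "C \<ge> 0"
    "\<And>t n. cmod (fourier_coeff L (u t) n) \<le> C * bracket (of_int n) powr (- 2) * bracket t powr (- 2)"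
proof -
  obtain C0 where C0: "C0 \<ge> 0" "\<And>t x. cmod (u t x) \<le> C0 * bracket t powr (- 2)"
    using decayingE[OF schwartz_decaying_derivs(1)[OF u]] by blast
  obtain C2 where C2: "C2 \<ge> 0" "\<And>t x. cmod (deriv_x (deriv_x u) t x) \<le> C2 * bracket t powr (- 2)"
    using decayingE[OF schwartz_decaying_derivs(3)[OF u]] by blast
  define C where "C = 2 * C0 + 2 * (L / (2 * pi))\<^sup>2 * C2"
  have "cmod (fourier_coeff L (u t) n) \<le> C * bracket (of_int n) powr (- 2) * bracket t powr (- 2)" for t n
  proof -
    let ?a = "cmod (fourier_coeff L (u t) n)" and ?b = "bracket t powr (- 2)" and ?n = "real_of_int n"
    have per: "u t L = u t 0" "deriv_x u t L = deriv_x u t 0"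
      using schwartz_periodic[OF u, of t 0] by simp_all
    have "fourier_coeff L (deriv_x u t) n = (2 * pi * \<i> * of_int n / of_real L) * fourier_coeff L (u t) n"
      by (intro fourier_coeff_deriv L per decaying_continuous schwartz_decaying_derivs[OF u]
          has_vector_derivative_at_within[OF has_vector_derivative_deriv_x(1)[OF u]])
    moreover have "fourier_coeff L (deriv_x (deriv_x u) t) n = (2 * pi * \<i> * of_int n / of_real L) * fourier_coeff L (deriv_x u t) n"
      by (intro fourier_coeff_deriv L per decaying_continuous schwartz_decaying_derivs[OF u]
          has_vector_derivative_at_within[OF has_vector_derivative_deriv_x(2)[OF u]])
    ultimately have "cmod (fourier_coeff L (deriv_x (deriv_x u) t) n) = (2 * pi * \<bar>?n\<bar> / L) * ((2 * pi * \<bar>?n\<bar> / L) * ?a)"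
      using L by (simp add: norm_mult norm_divide)
    also have "\<dots> = (2 * pi / L)\<^sup>2 * (?n\<^sup>2 * ?a)"
      by (simp add: power2_eq_square)
    finally have "(2 * pi / L)\<^sup>2 * (?n\<^sup>2 * ?a) \<le> C2 * ?b"
      using norm_fourier_coeff_decaying[of L "deriv_x (deriv_x u)" C2 t n, OF L C2(2)] by simp
    then have "(L / (2 * pi))\<^sup>2 * ((2 * pi / L)\<^sup>2 * (?n\<^sup>2 * ?a)) \<le> (L / (2 * pi))\<^sup>2 * (C2 * ?b)"
      by (intro mult_left_mono) auto
    moreover have "(L / (2 * pi))\<^sup>2 * (2 * pi / L)\<^sup>2 = 1"
      using L by (simp add: power_mult_distrib[symmetric])
    ultimately have n2: "?n\<^sup>2 * ?a \<le> (L / (2 * pi))\<^sup>2 * C2 * ?b"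
      by (simp only: mult.assoc[symmetric] mult_1)
    have "?a \<le> C0 * ?b"
      by (rule norm_fourier_coeff_decaying[OF L C0(2)])
    with n2 have "2 * ((1 + ?n\<^sup>2) * ?a) \<le> C * ?b"
      by (simp add: C_def distrib_right)
    moreover have "(bracket ?n)\<^sup>2 \<le> 2 * (1 + ?n\<^sup>2)"
      using zero_le_power2[of "1 - \<bar>?n\<bar>"] by (simp add: bracket_def power2_eq_square algebra_simps)
    then have "(bracket ?n)\<^sup>2 * ?a \<le> 2 * ((1 + ?n\<^sup>2) * ?a)"
      unfolding mult.assoc[symmetric] by (rule mult_right_mono) simp
    ultimately have "(bracket ?n)\<^sup>2 * ?a \<le> C * ?b"
      by linarith
    then have "?a \<le> C * ?b / (bracket ?n)\<^sup>2"
      by (subst pos_le_divide_eq) (auto simp: mult.commute)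
    then show ?thesis
      by (simp add: powr_minus divide_inverse mult_ac)
  qed
  moreover have "C \<ge> 0" using C0 C2 by (simp add: C_def)
  ultimately show ?thesis using that by blast
qed

interpretation circ_lborel: pair_sigma_finite "circ L" "lborel :: real measure" for L
  by (rule pair_sigma_finite.intro[OF circ.sigma_finite_measure_axioms lborel.sigma_finite_measure_axioms])

interpretation int_circ: pair_sigma_finite "count_space (UNIV :: int set)" "circ L" for L
  by (rule pair_sigma_finite.intro[OF sigma_finite_measure_count_space circ.sigma_finite_measure_axioms])

text \<open>With the time transform taken first, at fixed \<open>x\<close>, decay in \<tau> can be
  read off from the time derivatives of \<open>w\<close> itself, with no differentiation under the
  integral over \<open>x\<close>.\<close>

lemma spacetime_fourier_swap:
  assumes L: "L > 0" and w: "decaying w"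
  shows "spacetime_fourier L w \<tau> n = fourier_coeff L (\<lambda>x. ftrans (\<lambda>t. w t x) \<tau>) n"
proof -
  obtain C where C: "C \<ge> 0" "\<And>t x. cmod (w t x) \<le> C * bracket t powr (- 2)"
    using decayingE[OF w] by blast
  have id: "(\<lambda>x. x) \<in> borel_measurable (circ L)"
    by (rule measurable_circ_borel) simp
  have [measurable]: "(\<lambda>z. w (snd z) (fst z)) \<in> borel_measurable (circ L \<Otimes>\<^sub>M lborel)"
  proof -
    have "(\<lambda>z. (snd z, fst z)) \<in> measurable (circ L \<Otimes>\<^sub>M lborel) (borel \<Otimes>\<^sub>M borel)"
      using measurable_compose[OF measurable_fst id, of lborel] by (intro measurable_Pair) simp_all
    from measurable_compose[OF this decaying_measurable[OF w]] show ?thesis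
      by simp
  qed
  have "of_real L * spacetime_fourier L w \<tau> n
      = (\<integral>t. (\<integral>x. cis (- (\<tau> * t)) * (cnj (character L n x) * w t x) \<partial>circ L) \<partial>lborel)"
    using L unfolding spacetime_fourier_def fourier_coeff_circ integral_mult_right_zero
    by (subst integral_mult_right_zero[symmetric]) (simp add: mult_ac)
  also have "\<dots> = (\<integral>x. (\<integral>t. cis (- (\<tau> * t)) * (cnj (character L n x) * w t x) \<partial>lborel) \<partial>circ L)"
  proof (rule circ_lborel.Fubini_dominated[symmetric])
    have "(\<lambda>z. cis (- (\<tau> * snd z)) * (cnj (character L n (fst z)) * w (snd z) (fst z))) \<in> borel_measurable (circ L \<Otimes>\<^sub>M lborel)"
      by measurable
    then show "(\<lambda>(x, t). cis (- (\<tau> * t)) * (cnj (character L n x) * w t x)) \<in> borel_measurable (circ L \<Otimes>\<^sub>M lborel)"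
      by (simp add: case_prod_beta')
    show "integrable (circ L) (\<lambda>_. 1 :: real)"
      by simp
    show "integrable lborel (\<lambda>t. C * bracket t powr (- 2))"
      by (rule integrable_bracket_powr) simp
    show "norm (cis (- (\<tau> * t)) * (cnj (character L n x) * w t x)) \<le> 1 * (C * bracket t powr (- 2))" for x t
      using C(2)[of t x] by (simp add: norm_mult)
  qed
  also have "\<dots> = (\<integral>x. cnj (character L n x) * ftrans (\<lambda>t. w t x) \<tau> \<partial>circ L)"
    unfolding ftrans_def integral_mult_right_zero[symmetric] by (simp add: mult_ac)
  finally show ?thesis
    using L by (simp add: fourier_coeff_circ eq_divide_eq mult.commute)
qed

text \<open>Two time derivatives give the decay at fixed \<open>x\<close>, and a Fourier coefficient
  never exceeds the sup bound. This makes the time transform of each coefficient integrable, as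
  inversion requires.\<close>

lemma schwartz_spacetime_fourier_decay:
  assumes L: "L > 0" and u: "u \<in> schwartz_per L"
  obtains C where "\<And>\<tau> n. cmod (spacetime_fourier L u \<tau> n) \<le> C * bracket \<tau> powr (- 2)"
proof -
  obtain C0 where C0: "C0 \<ge> 0" "\<And>t x. cmod (u t x) \<le> C0 * bracket t powr (- 2)"
    using decayingE[OF schwartz_decaying_derivs(1)[OF u]] by blast
  obtain C1 where C1: "C1 \<ge> 0" "\<And>t x. cmod (deriv_t u t x) \<le> C1 * bracket t powr (- 2)"
    using decayingE[OF schwartz_decaying_derivs(4)[OF u]] by blast
  obtain C2 where C2: "C2 \<ge> 0" "\<And>t x. cmod (deriv_t (deriv_t u) t x) \<le> C2 * bracket t powr (- 2)"
    using decayingE[OF schwartz_decaying_derivs(5)[OF u]] by blast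
  define C where "C = C0 + C1 + C2"
  have C: "C0 * bracket t powr (- 2) \<le> C * bracket t powr (- 2)" "C1 * bracket t powr (- 2) \<le> C * bracket t powr (- 2)"
    "C2 * bracket t powr (- 2) \<le> C * bracket t powr (- 2)" for t
    unfolding C_def using C0 C1 C2 by (auto intro!: mult_right_mono)
  have "cmod (ftrans (\<lambda>t. u t x) \<tau>) \<le> 4 * C * bracket_integral 2 * bracket \<tau> powr (- 2)" for x \<tau>
    by (rule norm_ftrans_le_smooth[OF has_vector_derivative_deriv_t[OF u]
          decaying_continuous(2)[OF schwartz_decaying_derivs(5)[OF u]]])
       (rule order_trans[OF C0(2) C(1)] order_trans[OF C1(2) C(2)] order_trans[OF C2(2) C(3)])+
  then have "cmod (spacetime_fourier L u \<tau> n) \<le> 4 * C * bracket_integral 2 * bracket \<tau> powr (- 2)" for \<tau> n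
    unfolding spacetime_fourier_swap[OF L schwartz_decaying_derivs(1)[OF u]]
    by (intro norm_fourier_coeff_le L)
  then show ?thesis by (rule that)
qed

text \<open>Only \<open>u\<close> is expanded. Its series converges absolutely and uniformly, so it
  can be integrated term by term against the bounded function \<open>w\<close>.\<close>

lemma fourier_coeff_mult:
  assumes L: "L > 0" and u: "u \<in> schwartz_per L" and w: "continuous_on {0..L} w"
  shows "fourier_coeff L (\<lambda>x. u t x * w x) n
    = (\<integral>m. fourier_coeff L (u t) m * fourier_coeff L w (n - m) \<partial>count_space UNIV)"
proof -
  define a where "a = fourier_coeff L (u t)"
  obtain C where C: "C \<ge> 0"
    "\<And>t n. cmod (fourier_coeff L (u t) n) \<le> C * bracket (of_int n) powr (- 2) * bracket t powr (- 2)"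
    using schwartz_fourier_coeff_decay[OF L u] by blast
  have "integrable (count_space UNIV) (\<lambda>n::int. (C * bracket t powr (- 2)) * bracket (of_int n) powr (- 2))"
    by (rule integrable_count_space_bracket)
  then have inta: "integrable (count_space UNIV) a"
    by (rule Bochner_Integration.integrable_bound)
       (use C(2)[of t] C(1) in \<open>auto simp: a_def mult_ac abs_mult\<close>)
  obtain B where B: "\<And>x. x \<in> {0..L} \<Longrightarrow> norm (w x) \<le> B"
    using compact_continuous_image[OF w] compact_imp_bounded by (force simp: bounded_iff)
  obtain K where K: "K \<ge> 0" "\<And>t x. cmod (deriv_x u t x) \<le> K * bracket t powr (- 2)"
    using decayingE[OF schwartz_decaying_derivs(2)[OF u]] by blast
  have contu: "continuous_on {0..L} (u t)"
    by (rule decaying_continuous(1)[OF schwartz_decaying_derivs(1)[OF u]])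
  \<comment> \<open>The bound on \<open>deriv_x u\<close> supplies the Lipschitz condition of
    \<open>fourier_series_inversion\<close>.\<close>
  have lip: "norm (u t x - u t y) \<le> K * \<bar>x - y\<bar>" for x y
  proof -
    have "norm (u t x - u t y) \<le> K * norm (x - y)"
    proof (rule differentiable_bound[of UNIV "u t" "\<lambda>x h. h *\<^sub>R deriv_x u t x"])
      show "(u t has_derivative (\<lambda>h. h *\<^sub>R deriv_x u t x)) (at x within UNIV)" for x
        using has_vector_derivative_deriv_x(1)[OF u, of t x] by (simp add: has_vector_derivative_def)
      show "onorm (\<lambda>h. h *\<^sub>R deriv_x u t x) \<le> K" for x
      proof (rule onorm_bound[OF K(1)])
        have "cmod (deriv_x u t x) \<le> K"
          using K(2)[of t x] mult_left_mono[OF bracket_powr_m2_le_1[of t] K(1)] by simp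
        then show "norm (h *\<^sub>R deriv_x u t x) \<le> K * norm h" for h
          using mult_left_mono[of "cmod (deriv_x u t x)" K "\<bar>h\<bar>"] by (simp add: mult.commute)
      qed
    qed auto
    then show ?thesis by simp
  qed
  have [measurable]: "u t \<in> borel_measurable (circ L)" "w \<in> borel_measurable (circ L)"
    using measurable_circI[OF contu] measurable_circI[OF w] by auto
  let ?K = "\<lambda>m x. cnj (character L n x) * (a m * character L m x * w x)"
  have measK: "case_prod ?K \<in> borel_measurable (count_space UNIV \<Otimes>\<^sub>M circ L)"
    by (intro measurable_pair_measure_countable1) auto
  have fub: "(\<integral>m. (\<integral>x. ?K m x \<partial>circ L) \<partial>count_space UNIV) = (\<integral>x. (\<integral>m. ?K m x \<partial>count_space UNIV) \<partial>circ L)"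
    by (rule int_circ.Fubini_dominated[OF measK integrable_norm[OF inta], where q = "\<lambda>_. B"])
       (auto simp: norm_mult intro!: mult_left_mono B)
  \<comment> \<open>Inversion is available at interior points; the two ends form a null set.\<close>
  have "AE x in circ L. x \<noteq> 0 \<and> x \<noteq> L"
    unfolding circ_def using AE_lborel_singleton[of "0::real"] AE_lborel_singleton[of L]
    by (subst AE_restrict_space_iff) auto
  then have "(\<integral>x. cnj (character L n x) * (u t x * w x) \<partial>circ L) = (\<integral>x. (\<integral>m. ?K m x \<partial>count_space UNIV) \<partial>circ L)"
  proof (rule integral_cong_AE[rotated 2, OF AE_mp[OF _ AE_I2]], intro impI)
    fix x assume "x \<in> space (circ L)" "x \<noteq> 0 \<and> x \<noteq> L"
    then have x: "0 < x" "x < L" by auto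
    have "u t x = (\<integral>m. a m * character L m x \<partial>count_space UNIV)"
      unfolding a_def by (rule fourier_series_inversion[OF L contu x lip inta[unfolded a_def], symmetric])
    then show "cnj (character L n x) * (u t x * w x) = (\<integral>m. ?K m x \<partial>count_space UNIV)"
      by (simp add: integral_mult_right_zero integral_mult_left_zero)
  next
    have "(\<lambda>z. ?K (fst z) (snd z)) \<in> borel_measurable (count_space UNIV \<Otimes>\<^sub>M circ L)"
      using measK by (simp add: case_prod_beta')
    from measurable_compose[OF measurable_pair_swap' this]
    show "(\<lambda>x. \<integral>m. ?K m x \<partial>count_space UNIV) \<in> borel_measurable (circ L)"
      by (intro sigma_finite_measure.borel_measurable_lebesgue_integral[OF sigma_finite_measure_count_space])
         (simp add: case_prod_beta')
  qed measurable
  also have "\<dots> = (\<integral>m. (\<integral>x. ?K m x \<partial>circ L) \<partial>count_space UNIV)"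
    by (rule fub[symmetric])
  also have "\<dots> = (\<integral>m. a m * (of_real L * fourier_coeff L w (n - m)) \<partial>count_space UNIV)"
  proof (rule Bochner_Integration.integral_cong[OF refl])
    fix m
    have "(\<integral>x. ?K m x \<partial>circ L) = (\<integral>x. a m * (cnj (character L (n - m) x) * w x) \<partial>circ L)"
    proof (rule Bochner_Integration.integral_cong[OF refl])
      fix x
      have "cnj (character L (n - m) x) = cnj (character L n x) * character L m x"
        using character_add[of L "- n" m x] by (simp add: cnj_character_minus)
      then show "?K m x = a m * (cnj (character L (n - m) x) * w x)"
        by (simp add: mult_ac)
    qed
    then show "(\<integral>x. ?K m x \<partial>circ L) = a m * (of_real L * fourier_coeff L w (n - m))"
      using L by (simp add: fourier_coeff_circ)
  qed
  also have "\<dots> = of_real L * (\<integral>m. a m * fourier_coeff L w (n - m) \<partial>count_space UNIV)"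
    unfolding integral_mult_right_zero[symmetric] by (simp add: mult_ac)
  finally show ?thesis
    using L by (simp add: fourier_coeff_circ[of L "\<lambda>x. u t x * w x"] a_def)
qed

text \<open>In the absence of integrability the left side is 0 by convention.\<close>

lemma ennreal_norm_integral_le:
  fixes f :: "'a \<Rightarrow> complex"
  shows "ennreal (norm (\<integral>x. f x \<partial>M)) \<le> (\<integral>\<^sup>+x. ennreal (norm (f x)) \<partial>M)"
  by (cases "integrable M f") (auto simp: integral_norm_bound_ennreal not_integrable_integral_eq)

text \<open>Phases are lost in the triangle inequality for convolutions, so only the modulus is
  kept, with values for which Tonelli imposes no integrability condition.\<close>

definition hat :: "real \<Rightarrow> (real \<Rightarrow> real \<Rightarrow> complex) \<Rightarrow> int \<times> real \<Rightarrow> ennreal" where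
  "hat L w z = ennreal (cmod (spacetime_fourier L w (snd z) (fst z)))"

lemma borel_measurable_hat:
  assumes "L > 0" "decaying w"
  shows "hat L w \<in> borel_measurable freq"
proof (rule borel_measurable_freqI)
  fix n
  have [measurable]: "(\<lambda>\<tau>. spacetime_fourier L w \<tau> n) \<in> borel_measurable borel"
    by (rule borel_measurable_spacetime_fourier[OF assms])
  show "(\<lambda>\<tau>. hat L w (n, \<tau>)) \<in> borel_measurable borel"
    unfolding hat_def by simp
qed

text \<open>At each time the coefficients of the product are a discrete convolution; each of its
  terms becomes a convolution in \<tau> under the time transform, and the triangle inequality
  finishes. The roles differ: \<open>u\<close> is inverted in both variables, while \<open>w\<close>
  just decays.\<close>

lemma hat_mult_le:
  assumes L: "L > 0" and u: "u \<in> schwartz_per L" and w: "decaying w"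
  shows "ennreal (2 * pi) * hat L (\<lambda>t x. u t x * w t x) q \<le> (\<integral>\<^sup>+y. hat L u y * hat L w (q - y) \<partial>freq)"
proof -
  obtain n \<tau> where q: "q = (n, \<tau>)" by force
  have du: "decaying u" by (rule schwartz_decaying_derivs(1)[OF u])
  define a where "a m t = fourier_coeff L (u t) m" for m t
  define b where "b m t = fourier_coeff L (w t) m" for m t
  obtain C where C: "C \<ge> 0" "\<And>t n. cmod (a n t) \<le> C * bracket (of_int n) powr (- 2) * bracket t powr (- 2)"
    using schwartz_fourier_coeff_decay[OF L u] unfolding a_def by blast
  obtain D where D: "D \<ge> 0" "\<And>t x. cmod (w t x) \<le> D * bracket t powr (- 2)"
    using decayingE[OF w] by blast
  have conta: "continuous_on UNIV (a m)" and contb: "continuous_on UNIV (b m)" for m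
    unfolding a_def b_def by (intro continuous_fourier_coeff L du w)+
  have [measurable]: "a m \<in> borel_measurable borel" "b m \<in> borel_measurable borel" for m
    using conta contb by (auto intro: borel_measurable_continuous_onI)
  have b_le: "cmod (b m t) \<le> D * bracket t powr (- 2)" for m t
    unfolding b_def by (rule norm_fourier_coeff_decaying[OF L D(2)])
  have intb: "integrable lborel (b m)" for m
    by (rule integrable_bracket_bound[OF _ b_le]) measurable
  have inta: "integrable lborel (a m)" for m
    by (rule integrable_bracket_bound[OF _ C(2)]) measurable
  have a_bd: "cmod (a m t) \<le> C" for m t
  proof -
    have "cmod (a m t) \<le> C * (bracket (of_int m) powr (- 2) * bracket t powr (- 2))"
      using C(2)[of m t] by (simp add: mult.assoc)
    also have "\<dots> \<le> C * (1 * 1)"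
      using C(1) by (intro mult_left_mono mult_mono bracket_powr_m2_le_1) auto
    finally show ?thesis by simp
  qed
  have ha: "ftrans (a m) \<sigma> = spacetime_fourier L u \<sigma> m" "ftrans (b m) \<sigma> = spacetime_fourier L w \<sigma> m" for m \<sigma>
    by (simp_all add: spacetime_fourier_eq_ftrans a_def[abs_def] b_def[abs_def])
  obtain E where E: "\<And>\<tau> n. cmod (spacetime_fourier L u \<tau> n) \<le> E * bracket \<tau> powr (- 2)"
    using schwartz_spacetime_fourier_decay[OF L u] by blast
  have intha: "integrable lborel (ftrans (a m))" for m
    by (rule integrable_bracket_bound[where C = E]) (use E in \<open>auto simp: ha intro!: borel_measurable_ftrans\<close>)
  let ?K = "\<lambda>m t. cis (- (\<tau> * t)) * (a m t * b (n - m) t)"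
  have measK: "case_prod ?K \<in> borel_measurable (count_space UNIV \<Otimes>\<^sub>M lborel)"
    by (intro measurable_pair_measure_countable1) auto
  have "spacetime_fourier L (\<lambda>t x. u t x * w t x) \<tau> n
      = (\<integral>t. cis (- (\<tau> * t)) * (\<integral>m. a m t * b (n - m) t \<partial>count_space UNIV) \<partial>lborel)"
    unfolding spacetime_fourier_def fourier_coeff_mult[OF L u decaying_continuous(1)[OF w]] a_def b_def ..
  also have "\<dots> = (\<integral>t. (\<integral>m. ?K m t \<partial>count_space UNIV) \<partial>lborel)"
    by simp
  also have "\<dots> = (\<integral>m. (\<integral>t. ?K m t \<partial>lborel) \<partial>count_space UNIV)"
  proof (rule int_lborel.Fubini_dominated[OF measK integrable_count_space_bracket[of C] integrable_bracket_powr[of 2 D], symmetric])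
    fix m :: int and t :: real
    have "cmod (a m t) \<le> C * bracket (of_int m) powr (- 2) * 1"
      by (rule order_trans[OF C(2)]) (use C(1) in \<open>intro mult_left_mono bracket_powr_m2_le_1, auto\<close>)
    then have "cmod (a m t) * cmod (b (n - m) t) \<le> (C * bracket (of_int m) powr (- 2)) * (D * bracket t powr (- 2))"
      using C(1) by (intro mult_mono b_le) auto
    then show "norm (?K m t) \<le> C * bracket (of_int m) powr (- 2) * (D * bracket t powr (- 2))"
      by (simp add: norm_mult)
  qed simp
  also have "\<dots> = (\<integral>m. ftrans (\<lambda>t. a m t * b (n - m) t) \<tau> \<partial>count_space UNIV)"
    by (simp add: ftrans_def)
  finally have sf: "spacetime_fourier L (\<lambda>t x. u t x * w t x) \<tau> n
      = (\<integral>m. ftrans (\<lambda>t. a m t * b (n - m) t) \<tau> \<partial>count_space UNIV)" .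
  have "2 * pi * ftrans (\<lambda>t. a m t * b (n - m) t) \<tau>
      = (\<integral>\<sigma>. spacetime_fourier L u \<sigma> m * spacetime_fourier L w (\<tau> - \<sigma>) (n - m) \<partial>lborel)" for m
    unfolding ftrans_mult[OF conta inta a_bd intha intb] ha ..
  then have eq: "2 * pi * spacetime_fourier L (\<lambda>t x. u t x * w t x) \<tau> n
      = (\<integral>m. (\<integral>\<sigma>. spacetime_fourier L u \<sigma> m * spacetime_fourier L w (\<tau> - \<sigma>) (n - m) \<partial>lborel) \<partial>count_space UNIV)"
    by (simp only: sf integral_mult_right_zero[symmetric])
  have "ennreal (2 * pi) * hat L (\<lambda>t x. u t x * w t x) q
      = ennreal (cmod (2 * pi * spacetime_fourier L (\<lambda>t x. u t x * w t x) \<tau> n))"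
    by (simp add: hat_def q norm_mult ennreal_mult)
  also have "\<dots> \<le> (\<integral>\<^sup>+m. (\<integral>\<^sup>+\<sigma>. ennreal (cmod (spacetime_fourier L u \<sigma> m * spacetime_fourier L w (\<tau> - \<sigma>) (n - m))) \<partial>lborel) \<partial>count_space UNIV)"
    unfolding eq by (intro order_trans[OF ennreal_norm_integral_le] nn_integral_mono ennreal_norm_integral_le)
  also have "\<dots> = (\<integral>\<^sup>+y. hat L u y * hat L w (q - y) \<partial>freq)"
  proof -
    have [measurable]: "hat L u \<in> borel_measurable freq" "hat L w \<in> borel_measurable freq"
      by (intro borel_measurable_hat L du w)+
    have "(\<lambda>y. hat L u y * hat L w (q - y)) \<in> borel_measurable freq"
      by measurable
    from nn_integral_freq[OF this] show ?thesis
      by (simp add: hat_def q norm_mult ennreal_mult)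
  qed
  finally show ?thesis .
qed

section \<open>The bilinear estimates\<close>

lemma ennreal_sqrt_mono: "a \<le> b \<Longrightarrow> ennreal_sqrt a \<le> ennreal_sqrt b"
  by (auto simp: ennreal_sqrt_def top_unique less_top[symmetric] intro!: ennreal_leI enn2real_mono)

lemma ennreal_sqrt_power2: "ennreal_sqrt (x\<^sup>2) = x"
  by (cases x) (auto simp: ennreal_sqrt_def ennreal_power)

lemma power2_ennreal_sqrt: "(ennreal_sqrt x)\<^sup>2 = x"
  by (cases x) (auto simp: ennreal_sqrt_def ennreal_power)

lemma ennreal_sqrt_le_mult:
  assumes "a \<le> ennreal (C\<^sup>2) * x * y" "C \<ge> 0"
  shows "ennreal_sqrt a \<le> ennreal C * ennreal_sqrt x * ennreal_sqrt y"
proof -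
  have "a \<le> (ennreal C * ennreal_sqrt x * ennreal_sqrt y)\<^sup>2"
    using assms by (simp add: power_mult_distrib power2_ennreal_sqrt ennreal_power)
  then show ?thesis
    using ennreal_sqrt_mono ennreal_sqrt_power2 by metis
qed

text \<open>The exponents are half of those in the norm, so that a Bourgain norm becomes a weighted
  L2 norm of \<open>hat\<close>.\<close>

definition bourgain_weight :: "(int \<Rightarrow> real) \<Rightarrow> real \<Rightarrow> real \<Rightarrow> int \<times> real \<Rightarrow> real" where
  "bourgain_weight h s b z = bracket (snd z + h (fst z)) powr b * bracket_freq z powr s"

lemma bourgain_weight_nonneg [simp]: "0 \<le> bourgain_weight h s b z"
  by (simp add: bourgain_weight_def)

lemma borel_measurable_bourgain_weight: "bourgain_weight h s b \<in> borel_measurable freq"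
  by (rule borel_measurable_freqI) (simp add: bourgain_weight_def bracket_freq_def)

lemma bourgain_integrand:
  "ennreal (bracket (\<tau> + h n) powr (2 * b) * bracket (of_int n) powr (2 * s) * (cmod (spacetime_fourier L u \<tau> n))\<^sup>2)
    = (ennreal (bourgain_weight h s b (n, \<tau>)) * hat L u (n, \<tau>))\<^sup>2"
proof -
  have sq: "x powr (2 * r) = (x powr r)\<^sup>2" for x r :: real
    by (simp add: power2_eq_square powr_add[symmetric])
  show ?thesis
    unfolding sq
    by (simp add: bourgain_weight_def bracket_freq_def hat_def ennreal_mult[symmetric] ennreal_power power_mult_distrib)
qed

lemma bourgain_norm_eq:
  assumes "hat L u \<in> borel_measurable freq"
  shows "bourgain_norm h L s b u = ennreal_sqrt (l2sq (\<lambda>z. ennreal (bourgain_weight h s b z) * hat L u z))"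
proof -
  have [measurable]: "bourgain_weight h s b \<in> borel_measurable freq" "hat L u \<in> borel_measurable freq"
    by (rule borel_measurable_bourgain_weight, rule assms)
  show ?thesis
    unfolding bourgain_norm_def l2sq_def bourgain_integrand
    by (subst nn_integral_freq) auto
qed

text \<open>The comparison takes place inside the iterated integral that defines the norm, so
  measurability is asked of the majorant \<open>F\<close> and not of the transform of a
  product.\<close>

lemma bourgain_norm_le:
  assumes [measurable]: "F \<in> borel_measurable freq"
    and le: "\<And>z. ennreal (bourgain_weight h s b z) * hat L w z \<le> F z"
  shows "bourgain_norm h L s b w \<le> ennreal_sqrt (l2sq F)"
proof -
  have "l2sq F = (\<integral>\<^sup>+n. (\<integral>\<^sup>+\<tau>. (F (n, \<tau>))\<^sup>2 \<partial>lborel) \<partial>count_space UNIV)"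
    unfolding l2sq_def by (rule nn_integral_freq) measurable
  then show ?thesis
    unfolding bourgain_norm_def bourgain_integrand
    by (auto intro!: ennreal_sqrt_mono nn_integral_mono power_mono_ennreal le)
qed

section \<open>Pointwise comparison of the weights with the interaction kernel\<close>

lemma powr_le_of_le_add:
  fixes a b c s :: real
  assumes "a \<le> b + c" "a > 0" "b > 0" "c > 0" "s \<ge> 0"
  shows "a powr s \<le> 2 powr s * b powr s \<or> a powr s \<le> 2 powr s * c powr s"
proof -
  have "a \<le> 2 * b \<or> a \<le> 2 * c" using assms by linarith
  then have "a powr s \<le> (2 * b) powr s \<or> a powr s \<le> (2 * c) powr s"
    using assms by (auto intro: powr_mono2)
  then show ?thesis
    using assms by (simp add: powr_mult)
qed

lemma bracket_freq_add_le: "bracket_freq (y + p) \<le> bracket_freq y + bracket_freq p"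
  using bracket_add_le[of "of_int (fst y)" "of_int (fst p)"] by (simp add: bracket_freq_def)

lemma bracket_freq_le_add: "bracket_freq y \<le> bracket_freq p + bracket_freq (y + p)"
  using bracket_diff_le[of "of_int (fst (y + p))" "of_int (fst p)"] by (simp add: bracket_freq_def)

text \<open>The larger of the two input frequencies carries the \<open>s\<close> derivatives. If it
  is \<open>y\<close>, the Y norm falls short by half a derivative, which is charged to the kernel;
  the inverse half power of \<open>bracket_freq p\<close> in the kernel is repaid by the weight at
  \<open>p\<close>, as \<open>s \<ge> 1/2\<close>.\<close>

lemma frequency_weight_X:
  assumes s: "s \<ge> 1/2"
  shows "bracket_freq (y + p) powr s \<le> 2 powr s *
    ((1 + bracket_freq y powr (1/2) * inv_sqrt_sum y p) * (bracket_freq y powr (s - 1/2) * bracket_freq p powr s))"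
proof -
  let ?k = "bracket_freq y" and ?p = "bracket_freq p"
  have ge: "1 \<le> ?k powr (s - 1/2)" "1 \<le> ?p powr (s - 1/2)"
    using s by (auto intro!: ge_one_powr_ge_zero)
  have eqs: "?k powr (1/2) * ?k powr (s - 1/2) = ?k powr s" "?p powr (-1/2) * ?p powr s = ?p powr (s - 1/2)"
    by (simp_all add: powr_add[symmetric] add.commute)
  have "?p powr s \<le> ?k powr (s - 1/2) * ?p powr s"
    using mult_right_mono[OF ge(1), of "?p powr s"] by simp
  moreover have "?k powr s \<le> (?k powr (1/2) * inv_sqrt_sum y p) * (?k powr (s - 1/2) * ?p powr s)"
  proof -
    have "?k powr s \<le> ?k powr s * ?p powr (s - 1/2)"
      using mult_left_mono[OF ge(2), of "?k powr s"] by simp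
    also have "\<dots> = (?k powr (1/2) * ?p powr (-1/2)) * (?k powr (s - 1/2) * ?p powr s)"
      unfolding eqs[symmetric] by (simp only: mult_ac)
    also have "\<dots> \<le> (?k powr (1/2) * inv_sqrt_sum y p) * (?k powr (s - 1/2) * ?p powr s)"
      by (intro mult_right_mono mult_left_mono) (auto simp: inv_sqrt_sum_def)
    finally show ?thesis .
  qed
  moreover have "0 \<le> ?k powr (s - 1/2) * ?p powr s"
      "0 \<le> (?k powr (1/2) * inv_sqrt_sum y p) * (?k powr (s - 1/2) * ?p powr s)"
    by auto
  ultimately have le: "?k powr s \<le> (1 + ?k powr (1/2) * inv_sqrt_sum y p) * (?k powr (s - 1/2) * ?p powr s)"
    "?p powr s \<le> (1 + ?k powr (1/2) * inv_sqrt_sum y p) * (?k powr (s - 1/2) * ?p powr s)"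
    by (simp_all only: distrib_right mult_1)
  from powr_le_of_le_add[OF bracket_freq_add_le, of y p s] s
  have "bracket_freq (y + p) powr s \<le> 2 powr s * ?k powr s \<or> bracket_freq (y + p) powr s \<le> 2 powr s * ?p powr s"
    by simp
  then show ?thesis
    by (elim disjE) (erule order_trans[OF _ mult_left_mono[OF le(1)]] order_trans[OF _ mult_left_mono[OF le(2)]], simp)+
qed

text \<open>The spatial derivative raises the weight at \<open>y\<close> to \<open>s + 1/2\<close>.
  Of this, \<open>s\<close> goes to the larger X frequency, and the other X frequency has weight
  enough, as \<open>s \<ge> 1/2\<close>, to repay the inverse half power in
  \<open>inv_sqrt_sum\<close>.\<close>

lemma frequency_weight_Y:
  assumes s: "s \<ge> 1/2"
  shows "\<bar>of_int (fst y)\<bar> * bracket_freq y powr (s - 1/2) \<le> 2 powr s *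
    ((1 + bracket_freq y powr (1/2) * inv_sqrt_sum y p) * (bracket_freq p powr s * bracket_freq (y + p) powr s))"
proof -
  let ?k = "bracket_freq y" and ?p = "bracket_freq p" and ?q = "bracket_freq (y + p)"
  have main: "?k powr (1/2) * a powr s \<le> (1 + ?k powr (1/2) * inv_sqrt_sum y p) * (b powr s * a powr s)"
    if b: "b \<ge> 1" "b powr (-1/2) \<le> inv_sqrt_sum y p" and a: "a > 0" for a b
  proof -
    have "1 \<le> b powr (s - 1/2)" using b s by (auto intro!: ge_one_powr_ge_zero)
    also have "\<dots> = b powr (-1/2) * b powr s"
      by (simp add: powr_add[symmetric] add.commute)
    finally have "1 \<le> b powr (-1/2) * b powr s" .
    then have "(?k powr (1/2) * a powr s) * 1 \<le> (?k powr (1/2) * a powr s) * (b powr (-1/2) * b powr s)"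
      by (intro mult_left_mono) auto
    also have "\<dots> = (?k powr (1/2) * b powr (-1/2)) * (b powr s * a powr s)"
      by (simp only: mult_ac)
    also have "\<dots> \<le> (1 + ?k powr (1/2) * inv_sqrt_sum y p) * (b powr s * a powr s)"
      using mult_left_mono[OF b(2), of "?k powr (1/2)"] by (intro mult_right_mono) auto
    finally show ?thesis by simp
  qed
  have mq: "?k powr (1/2) * ?q powr s \<le> (1 + ?k powr (1/2) * inv_sqrt_sum y p) * (?p powr s * ?q powr s)"
    by (rule main) (auto simp: inv_sqrt_sum_def)
  have mp: "?k powr (1/2) * ?p powr s \<le> (1 + ?k powr (1/2) * inv_sqrt_sum y p) * (?p powr s * ?q powr s)"
    using main[of ?q ?p] by (simp add: inv_sqrt_sum_def mult.commute)
  have "\<bar>of_int (fst y)\<bar> * ?k powr (s - 1/2) \<le> ?k * ?k powr (s - 1/2)"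
    by (intro mult_right_mono) (auto simp: bracket_freq_def bracket_def)
  also have "\<dots> = ?k powr 1 * ?k powr (s - 1/2)"
    by simp
  also have "\<dots> = ?k powr (1/2) * ?k powr s"
    unfolding powr_add[symmetric] by simp
  finally have first: "\<bar>of_int (fst y)\<bar> * ?k powr (s - 1/2) \<le> ?k powr (1/2) * ?k powr s" .
  from powr_le_of_le_add[OF bracket_freq_le_add, of y p s] s
  have "?k powr s \<le> 2 powr s * ?p powr s \<or> ?k powr s \<le> 2 powr s * ?q powr s"
    by simp
  then have "?k powr (1/2) * ?k powr s \<le> 2 powr s * (?k powr (1/2) * ?p powr s)
      \<or> ?k powr (1/2) * ?k powr s \<le> 2 powr s * (?k powr (1/2) * ?q powr s)"
    unfolding mult.left_commute[of "2 powr s"] by (elim disjE) (auto intro!: mult_left_mono)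
  then have "?k powr (1/2) * ?k powr s \<le> 2 powr s *
      ((1 + ?k powr (1/2) * inv_sqrt_sum y p) * (?p powr s * ?q powr s))"
    by (elim disjE) (erule order_trans[OF _ mult_left_mono[OF mp]] order_trans[OF _ mult_left_mono[OF mq]], simp)+
  with first show ?thesis
    by (rule order_trans)
qed

abbreviation weightX :: "real \<Rightarrow> real \<Rightarrow> int \<times> real \<Rightarrow> real" where
  "weightX \<equiv> bourgain_weight (\<lambda>n. (of_int n)\<^sup>2)"

abbreviation weightY :: "real \<Rightarrow> real \<Rightarrow> real \<Rightarrow> int \<times> real \<Rightarrow> real" where
  "weightY \<gamma> \<equiv> bourgain_weight (\<lambda>n. \<gamma> * \<bar>of_int n\<bar> * of_int n)"

lemma weightX_eq: "weightX s b z = bracket (modX z) powr b * bracket_freq z powr s"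
  by (simp add: bourgain_weight_def modX_def)

lemma weightY_eq: "weightY \<gamma> s b z = bracket (modY \<gamma> z) powr b * bracket_freq z powr s"
  by (simp add: bourgain_weight_def modY_def)

text \<open>Lowering an input weight from 1/2 to 7/16 leaves the nonnegative exponent 1/16.\<close>

lemma decay_gain:
  "1 \<le> decayX z * bracket (modX z) powr (1/2)" "1 \<le> decayY \<gamma> z * bracket (modY \<gamma> z) powr (1/2)"
  unfolding decayX_def decayY_def powr_add[symmetric] by (auto intro!: ge_one_powr_ge_zero)

text \<open>The quotient of the output weight by the two input weights is controlled by the kernel.
  The condition on \<epsilon> amounts to \<open>-1/2 + \<epsilon> \<le> -7/16\<close>.\<close>

lemma weightX_le_interaction:
  assumes s: "s \<ge> 1/2" and \<epsilon>: "\<epsilon> \<le> 1/16"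
  shows "weightX s (-1/2 + \<epsilon>) (y + p)
    \<le> 2 powr s * (interaction \<gamma> y p * weightY \<gamma> (s - 1/2) (1/2) y * weightX s (1/2) p)"
proof -
  let ?Z = "1 + bracket_freq y powr (1/2) * inv_sqrt_sum y p"
  let ?w = "bracket_freq y powr (s - 1/2) * bracket_freq p powr s"
  have Z: "?Z \<ge> 0" by simp
  have "bracket (modX (y + p)) powr (-1/2 + \<epsilon>) \<le> decayX (y + p)"
    unfolding decayX_def using \<epsilon> by (intro powr_mono) auto
  then have "weightX s (-1/2 + \<epsilon>) (y + p) \<le> decayX (y + p) * (2 powr s * (?Z * ?w))"
    unfolding weightX_eq by (intro mult_mono frequency_weight_X s) auto
  also have "\<dots> = (2 powr s * decayX (y + p) * ?Z * ?w) * (1 * 1)"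
    by (simp add: mult_ac)
  also have "\<dots> \<le> (2 powr s * decayX (y + p) * ?Z * ?w) *
      ((decayY \<gamma> y * bracket (modY \<gamma> y) powr (1/2)) * (decayX p * bracket (modX p) powr (1/2)))"
  proof (rule mult_left_mono)
    show "1 * 1 \<le> (decayY \<gamma> y * bracket (modY \<gamma> y) powr (1/2)) * (decayX p * bracket (modX p) powr (1/2))"
      by (intro mult_mono decay_gain) simp_all
    show "0 \<le> 2 powr s * decayX (y + p) * ?Z * ?w"
      using Z by (intro mult_nonneg_nonneg) simp_all
  qed
  also have "\<dots> = 2 powr s * (interaction \<gamma> y p * weightY \<gamma> (s - 1/2) (1/2) y * weightX s (1/2) p)"
    unfolding interaction_def weightX_eq weightY_eq by (simp only: mult_ac)
  finally show ?thesis .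
qed

text \<open>Here the output sits at \<open>y\<close>, and the factor produced by the spatial
  derivative is counted with its weight.\<close>

lemma weightY_le_interaction:
  assumes s: "s \<ge> 1/2" and \<epsilon>: "\<epsilon> \<le> 1/16"
  shows "\<bar>of_int (fst y)\<bar> * weightY \<gamma> (s - 1/2) (-1/2 + \<epsilon>) y
    \<le> 2 powr s * (interaction \<gamma> y p * weightX s (1/2) p * weightX s (1/2) (y + p))"
proof -
  let ?Z = "1 + bracket_freq y powr (1/2) * inv_sqrt_sum y p"
  let ?w = "bracket_freq p powr s * bracket_freq (y + p) powr s"
  have Z: "?Z \<ge> 0" by simp
  have "bracket (modY \<gamma> y) powr (-1/2 + \<epsilon>) \<le> decayY \<gamma> y"
    unfolding decayY_def using \<epsilon> by (intro powr_mono) auto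
  then have "bracket (modY \<gamma> y) powr (-1/2 + \<epsilon>) * (\<bar>of_int (fst y)\<bar> * bracket_freq y powr (s - 1/2))
      \<le> decayY \<gamma> y * (2 powr s * (?Z * ?w))"
    by (intro mult_mono frequency_weight_Y s) auto
  also have "\<dots> = (2 powr s * decayY \<gamma> y * ?Z * ?w) * (1 * 1)"
    by (simp add: mult_ac)
  also have "\<dots> \<le> (2 powr s * decayY \<gamma> y * ?Z * ?w) *
      ((decayX p * bracket (modX p) powr (1/2)) * (decayX (y + p) * bracket (modX (y + p)) powr (1/2)))"
  proof (rule mult_left_mono)
    show "1 * 1 \<le> (decayX p * bracket (modX p) powr (1/2)) * (decayX (y + p) * bracket (modX (y + p)) powr (1/2))"
      by (intro mult_mono decay_gain) simp_all
    show "0 \<le> 2 powr s * decayY \<gamma> y * ?Z * ?w"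
      using Z by (intro mult_nonneg_nonneg) simp_all
  qed
  also have "\<dots> = 2 powr s * (interaction \<gamma> y p * weightX s (1/2) p * weightX s (1/2) (y + p))"
    unfolding interaction_def weightX_eq by (simp only: mult_ac)
  finally show ?thesis
    unfolding weightY_eq by (simp only: mult_ac)
qed

section \<open>From the trilinear form to the norms\<close>

lemma l2sq_cmult:
  assumes "F \<in> borel_measurable freq"
  shows "l2sq (\<lambda>z. c * F z) = c\<^sup>2 * l2sq F"
proof -
  have [measurable]: "F \<in> borel_measurable freq" by (rule assms)
  show ?thesis
    unfolding l2sq_def power_mult_distrib by (rule nn_integral_cmult) measurable
qed

lemma ennreal_power2_mult_sqrt:
  assumes "c \<ge> 0" "A \<ge> 0"
  shows "ennreal ((c * sqrt A)\<^sup>2) = (ennreal c)\<^sup>2 * ennreal A"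
  using assms by (simp add: power_mult_distrib ennreal_mult ennreal_power)

lemma estimate_X:
  assumes L: "L > 0" and s: "s \<ge> 1/2" and \<epsilon>: "\<epsilon> \<le> 1/16" and A: "A \<ge> 0"
    and tri: "\<And>f g h. \<lbrakk>f \<in> borel_measurable freq; g \<in> borel_measurable freq; h \<in> borel_measurable freq\<rbrakk>
      \<Longrightarrow> (trilinear (\<lambda>y p. ennreal (interaction \<gamma> y p)) f g h)\<^sup>2 \<le> ennreal A * l2sq f * l2sq g * l2sq h"
    and u: "u \<in> schwartz_per L" and v: "v \<in> schwartz_per L"
  shows "X_norm L s (-1/2 + \<epsilon>) (\<lambda>t x. u t x * v t x)
    \<le> ennreal (2 powr s * sqrt A) * Y_norm \<gamma> L (s - 1/2) (1/2) u * X_norm L s (1/2) v"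
proof -
  have meas_hat [measurable]: "hat L u \<in> borel_measurable freq" "hat L v \<in> borel_measurable freq"
    by (intro borel_measurable_hat L schwartz_decaying_derivs(1)[OF u] schwartz_decaying_derivs(1)[OF v])+
  have [measurable]: "weightX s b \<in> borel_measurable freq" "weightY \<gamma> s b \<in> borel_measurable freq" for s b
    by (rule borel_measurable_bourgain_weight)+
  define f where "f y = ennreal (weightY \<gamma> (s - 1/2) (1/2) y) * hat L u y" for y
  define g where "g p = ennreal (weightX s (1/2) p) * hat L v p" for p
  let ?K = "\<lambda>y p. ennreal (interaction \<gamma> y p)"
  have fg [measurable]: "f \<in> borel_measurable freq" "g \<in> borel_measurable freq"
    unfolding f_def[abs_def] g_def[abs_def] by measurable
  have K: "case_prod ?K \<in> borel_measurable (freq \<Otimes>\<^sub>M freq)"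
    by measurable
  \<comment> \<open>A weighted convolution that dominates the weighted transform of the product; its
    pairing with a test function \<open>h\<close> is exactly the trilinear form.\<close>
  define G where "G q = (\<integral>\<^sup>+y. ?K y (q - y) * f y * g (q - y) \<partial>freq)" for q
  have G [measurable]: "G \<in> borel_measurable freq"
    unfolding G_def[abs_def] by measurable
  have "l2sq G \<le> ennreal A * l2sq f * l2sq g"
  proof (rule l2sq_le_by_duality[OF G])
    fix h :: "int \<times> real \<Rightarrow> ennreal" assume h [measurable]: "h \<in> borel_measurable freq"
    have Kq: "(\<lambda>y. ?K y (q - y) * f y * g (q - y)) \<in> borel_measurable freq" for q
      by measurable
    have "(\<integral>\<^sup>+q. G q * h q \<partial>freq) = trilinear ?K f g h"
      unfolding trilinear_eq_output[OF K fg h] G_def nn_integral_multc[OF Kq] ..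
    then show "(\<integral>\<^sup>+q. G q * h q \<partial>freq)\<^sup>2 \<le> ennreal A * l2sq f * l2sq g * l2sq h"
      using tri[OF fg h] by simp
  qed
  then have "l2sq (\<lambda>q. ennreal (2 powr s) * G q) \<le> (ennreal (2 powr s))\<^sup>2 * (ennreal A * l2sq f * l2sq g)"
    unfolding l2sq_cmult[OF G] by (intro mult_left_mono) auto
  also have "\<dots> = ennreal ((2 powr s * sqrt A)\<^sup>2) * l2sq f * l2sq g"
    using A by (subst ennreal_power2_mult_sqrt) (simp_all only: mult.assoc powr_ge_zero)
  finally have l2: "l2sq (\<lambda>q. ennreal (2 powr s) * G q) \<le> ennreal ((2 powr s * sqrt A)\<^sup>2) * l2sq f * l2sq g" .
  have pointwise: "ennreal (weightX s (-1/2 + \<epsilon>) q) * hat L (\<lambda>t x. u t x * v t x) q \<le> ennreal (2 powr s) * G q" for q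
  proof -
    let ?h = "hat L (\<lambda>t x. u t x * v t x) q"
    \<comment> \<open>The factor \<open>2 * pi\<close> of the convolution bound exceeds 1 and is
      simply given away.\<close>
    have "ennreal 1 \<le> ennreal (2 * pi)"
      by (rule ennreal_leI) (use pi_ge_two in linarith)
    then have "ennreal 1 * ?h \<le> ennreal (2 * pi) * ?h"
      by (rule mult_right_mono) simp
    then have "?h \<le> ennreal (2 * pi) * ?h"
      by simp
    also have "\<dots> \<le> (\<integral>\<^sup>+y. hat L u y * hat L v (q - y) \<partial>freq)"
      by (rule hat_mult_le[OF L u schwartz_decaying_derivs(1)[OF v]])
    finally have "ennreal (weightX s (-1/2 + \<epsilon>) q) * ?h
        \<le> ennreal (weightX s (-1/2 + \<epsilon>) q) * (\<integral>\<^sup>+y. hat L u y * hat L v (q - y) \<partial>freq)"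
      by (rule mult_left_mono) simp
    also have "\<dots> = (\<integral>\<^sup>+y. ennreal (weightX s (-1/2 + \<epsilon>) q) * (hat L u y * hat L v (q - y)) \<partial>freq)"
      by (rule nn_integral_cmult[symmetric]) measurable
    also have "\<dots> \<le> (\<integral>\<^sup>+y. ennreal (2 powr s) * (?K y (q - y) * f y * g (q - y)) \<partial>freq)"
    proof (rule nn_integral_mono)
      fix y
      have "ennreal (weightX s (-1/2 + \<epsilon>) q) \<le> ennreal (2 powr s *
          (interaction \<gamma> y (q - y) * weightY \<gamma> (s - 1/2) (1/2) y * weightX s (1/2) (q - y)))"
        using weightX_le_interaction[OF s \<epsilon>, of y "q - y" \<gamma>] by (intro ennreal_leI) simp
      then have "ennreal (weightX s (-1/2 + \<epsilon>) q) * (hat L u y * hat L v (q - y)) \<le> ennreal (2 powr s *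
          (interaction \<gamma> y (q - y) * weightY \<gamma> (s - 1/2) (1/2) y * weightX s (1/2) (q - y))) * (hat L u y * hat L v (q - y))"
        by (rule mult_right_mono) simp
      then show "ennreal (weightX s (-1/2 + \<epsilon>) q) * (hat L u y * hat L v (q - y))
          \<le> ennreal (2 powr s) * (?K y (q - y) * f y * g (q - y))"
        by (simp add: f_def g_def ennreal_mult mult_ac)
    qed
    also have "\<dots> = ennreal (2 powr s) * G q"
      unfolding G_def by (rule nn_integral_cmult) measurable
    finally show ?thesis .
  qed
  have "X_norm L s (-1/2 + \<epsilon>) (\<lambda>t x. u t x * v t x) \<le> ennreal_sqrt (l2sq (\<lambda>q. ennreal (2 powr s) * G q))"
    unfolding X_norm_def by (rule bourgain_norm_le[OF _ pointwise]) measurable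
  also have "\<dots> \<le> ennreal (2 powr s * sqrt A) * ennreal_sqrt (l2sq f) * ennreal_sqrt (l2sq g)"
    using A by (intro ennreal_sqrt_le_mult[OF l2]) simp
  finally show ?thesis
    unfolding X_norm_def Y_norm_def bourgain_norm_eq[OF meas_hat(1)] bourgain_norm_eq[OF meas_hat(2)] f_def g_def .
qed

lemma fourier_coeff_cnj: "fourier_coeff L (\<lambda>x. cnj (w x)) n = cnj (fourier_coeff L w (- n))"
proof -
  have "(\<integral>x. cnj (character L n x) * cnj (w x) \<partial>circ L) = (\<integral>x. cnj (cnj (character L (- n) x) * w x) \<partial>circ L)"
    by (simp add: cnj_character_minus)
  also have "\<dots> = cnj (\<integral>x. cnj (character L (- n) x) * w x \<partial>circ L)"
    by (rule Bochner_Integration.integral_cnj)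
  finally show ?thesis
    by (simp only: fourier_coeff_circ complex_cnj_divide complex_cnj_complex_of_real)
qed

lemma spacetime_fourier_cnj:
  "spacetime_fourier L (\<lambda>t x. cnj (v t x)) \<tau> n = cnj (spacetime_fourier L v (- \<tau>) (- n))"
proof -
  have "(\<integral>t. cis (- (\<tau> * t)) * cnj (fourier_coeff L (v t) (- n)) \<partial>lborel)
      = (\<integral>t. cnj (cis (- (- \<tau> * t)) * fourier_coeff L (v t) (- n)) \<partial>lborel)"
    by (simp add: cis_cnj)
  also have "\<dots> = cnj (\<integral>t. cis (- (- \<tau> * t)) * fourier_coeff L (v t) (- n) \<partial>lborel)"
    by (rule Bochner_Integration.integral_cnj)
  finally show ?thesis
    by (simp only: spacetime_fourier_def fourier_coeff_cnj)
qed

text \<open>Conjugation reflects frequencies and turns the convolution into a correlation. This is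
  why the X frequencies are \<open>p\<close> and \<open>y + p\<close> in the second estimate
  too.\<close>

lemma hat_cnj: "hat L (\<lambda>t x. cnj (v t x)) z = hat L v (- z)"
  by (simp add: hat_def spacetime_fourier_cnj)

lemma decaying_cnj:
  assumes "decaying v"
  shows "decaying (\<lambda>t x. cnj (v t x))"
proof -
  have "continuous_on UNIV (\<lambda>z. cnj (case_prod v z))"
    using assms by (intro continuous_intros) (simp add: decaying_def)
  then show ?thesis
    using assms by (simp add: decaying_def case_prod_beta')
qed

text \<open>Integration by parts is applied to the product itself: the Leibniz rule shows that its
  derivative is continuous, and its periodicity comes from the factors.\<close>

lemma hat_deriv_x_mult_cnj:
  assumes L: "L > 0" and u: "u \<in> schwartz_per L" and v: "v \<in> schwartz_per L"
  shows "hat L (deriv_x (\<lambda>t x. u t x * cnj (v t x))) z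
    = ennreal (2 * pi * \<bar>of_int (fst z)\<bar> / L) * hat L (\<lambda>t x. u t x * cnj (v t x)) z"
proof -
  let ?w = "\<lambda>t x. u t x * cnj (v t x)"
  have dw: "((\<lambda>x. ?w t x) has_vector_derivative u t x * cnj (deriv_x v t x) + deriv_x u t x * cnj (v t x)) (at x)" for t x
    by (intro has_vector_derivative_mult has_vector_derivative_cnj has_vector_derivative_deriv_x(1)[OF u]
        has_vector_derivative_deriv_x(1)[OF v])
  then have eq: "deriv_x ?w t x = u t x * cnj (deriv_x v t x) + deriv_x u t x * cnj (v t x)" for t x
    unfolding deriv_x_def by (rule vector_derivative_at)
  have "fourier_coeff L (deriv_x ?w t) n = (2 * pi * \<i> * of_int n / of_real L) * fourier_coeff L (?w t) n" for t n
  proof (rule fourier_coeff_deriv[OF L])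
    show "(?w t has_vector_derivative deriv_x ?w t x) (at x within {0..L})" for x
      unfolding eq by (rule has_vector_derivative_at_within[OF dw])
    show "continuous_on {0..L} (deriv_x ?w t)"
      unfolding eq[abs_def]
      by (intro continuous_intros decaying_continuous schwartz_decaying_derivs[OF u] schwartz_decaying_derivs[OF v])
    show "?w t L = ?w t 0"
      using schwartz_periodic(1)[OF u, of t 0] schwartz_periodic(1)[OF v, of t 0] by simp
  qed
  then have "spacetime_fourier L (deriv_x ?w) \<tau> n = (2 * pi * \<i> * of_int n / of_real L) * spacetime_fourier L ?w \<tau> n" for \<tau> n
    unfolding spacetime_fourier_def integral_mult_right_zero[symmetric] by (simp add: mult_ac)
  then show ?thesis
    using L by (simp add: hat_def norm_mult norm_divide ennreal_mult[symmetric])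
qed

lemma estimate_Y:
  assumes L: "L > 0" and s: "s \<ge> 1/2" and \<epsilon>: "\<epsilon> \<le> 1/16" and A: "A \<ge> 0"
    and tri: "\<And>f g h. \<lbrakk>f \<in> borel_measurable freq; g \<in> borel_measurable freq; h \<in> borel_measurable freq\<rbrakk>
      \<Longrightarrow> (trilinear (\<lambda>y p. ennreal (interaction \<gamma> y p)) f g h)\<^sup>2 \<le> ennreal A * l2sq f * l2sq g * l2sq h"
    and u: "u \<in> schwartz_per L" and v: "v \<in> schwartz_per L"
  shows "Y_norm \<gamma> L (s - 1/2) (-1/2 + \<epsilon>) (deriv_x (\<lambda>t x. u t x * cnj (v t x)))
    \<le> ennreal (2 powr s / L * sqrt A) * X_norm L s (1/2) u * X_norm L s (1/2) v"
proof -
  have meas_hat [measurable]: "hat L u \<in> borel_measurable freq" "hat L v \<in> borel_measurable freq"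
    by (intro borel_measurable_hat L schwartz_decaying_derivs(1)[OF u] schwartz_decaying_derivs(1)[OF v])+
  have [measurable]: "weightX s b \<in> borel_measurable freq" for s b
    by (rule borel_measurable_bourgain_weight)
  define h where "h q = ennreal (weightX s (1/2) q) * hat L u q" for q
  define g where "g p = ennreal (weightX s (1/2) p) * hat L v p" for p
  let ?K = "\<lambda>y p. ennreal (interaction \<gamma> y p)"
  let ?c = "2 powr s / L"
  have c: "?c \<ge> 0" using L by simp
  have gh [measurable]: "g \<in> borel_measurable freq" "h \<in> borel_measurable freq"
    unfolding h_def[abs_def] g_def[abs_def] by measurable
  have K [measurable]: "?K y \<in> borel_measurable freq" for y
    using measurable_Pair2[OF borel_measurable_interaction, of y] by simp
  \<comment> \<open>The output now sits at \<open>y\<close>: \<open>u\<close> is taken at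
    \<open>y + p\<close>, \<open>v\<close> at \<open>p\<close>, and the test function of the duality
    argument replaces the Y function.\<close>
  define G where "G y = (\<integral>\<^sup>+p. ?K y p * g p * h (y + p) \<partial>freq)" for y
  have G [measurable]: "G \<in> borel_measurable freq"
    unfolding G_def[abs_def] by measurable
  have "l2sq G \<le> ennreal A * l2sq h * l2sq g"
  proof (rule l2sq_le_by_duality[OF G])
    fix f :: "int \<times> real \<Rightarrow> ennreal" assume f [measurable]: "f \<in> borel_measurable freq"
    have Ky: "(\<lambda>p. ?K y p * g p * h (y + p)) \<in> borel_measurable freq" for y
      by measurable
    have "(\<integral>\<^sup>+y. G y * f y \<partial>freq) = trilinear ?K f g h"
      unfolding trilinear_def G_def nn_integral_multc[OF Ky, symmetric] by (simp only: mult_ac)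
    then show "(\<integral>\<^sup>+y. G y * f y \<partial>freq)\<^sup>2 \<le> ennreal A * l2sq h * l2sq g * l2sq f"
      using tri[OF f gh] by (simp add: mult_ac)
  qed
  then have "l2sq (\<lambda>y. ennreal ?c * G y) \<le> (ennreal ?c)\<^sup>2 * (ennreal A * l2sq h * l2sq g)"
    unfolding l2sq_cmult[OF G] by (intro mult_left_mono) auto
  also have "\<dots> = ennreal ((?c * sqrt A)\<^sup>2) * l2sq h * l2sq g"
    using A c by (subst ennreal_power2_mult_sqrt) (simp_all only: mult.assoc)
  finally have l2: "l2sq (\<lambda>y. ennreal ?c * G y) \<le> ennreal ((?c * sqrt A)\<^sup>2) * l2sq h * l2sq g" .
  have pointwise: "ennreal (weightY \<gamma> (s - 1/2) (-1/2 + \<epsilon>) y) * hat L (deriv_x (\<lambda>t x. u t x * cnj (v t x))) y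
      \<le> ennreal ?c * G y" for y
  proof -
    let ?h = "hat L (\<lambda>t x. u t x * cnj (v t x)) y"
    let ?w = "\<bar>of_int (fst y)\<bar> * weightY \<gamma> (s - 1/2) (-1/2 + \<epsilon>) y"
    have "ennreal (2 * pi) * ?h \<le> (\<integral>\<^sup>+z. hat L u z * hat L v (- (y - z)) \<partial>freq)"
      using hat_mult_le[OF L u decaying_cnj[OF schwartz_decaying_derivs(1)[OF v]], of y] unfolding hat_cnj .
    also have "\<dots> = (\<integral>\<^sup>+p. hat L u (y + p) * hat L v p \<partial>freq)"
    proof -
      have "(\<lambda>z. hat L u z * hat L v (z - y)) \<in> borel_measurable freq"
        by measurable
      from nn_integral_freq_shift[OF this, of y] show ?thesis
        by simp
    qed
    finally have conv: "ennreal (2 * pi) * ?h \<le> (\<integral>\<^sup>+p. hat L u (y + p) * hat L v p \<partial>freq)" .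
    \<comment> \<open>The derivative contributes \<open>2 * pi / L\<close>; its
      \<open>2 * pi\<close> is consumed by the convolution bound, and \<open>1 / L\<close> stays in
      the constant.\<close>
    have "ennreal (weightY \<gamma> (s - 1/2) (-1/2 + \<epsilon>) y) * hat L (deriv_x (\<lambda>t x. u t x * cnj (v t x))) y
        = ennreal (?w / L) * (ennreal (2 * pi) * ?h)"
    proof -
      have "weightY \<gamma> (s - 1/2) (-1/2 + \<epsilon>) y * (2 * pi * \<bar>of_int (fst y)\<bar> / L) = ?w / L * (2 * pi)"
        by simp
      then have "ennreal (weightY \<gamma> (s - 1/2) (-1/2 + \<epsilon>) y) * ennreal (2 * pi * \<bar>of_int (fst y)\<bar> / L)
          = ennreal (?w / L) * ennreal (2 * pi)"
        using L by (simp add: ennreal_mult[symmetric])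
      then show ?thesis
        unfolding hat_deriv_x_mult_cnj[OF L u v] by (simp only: mult.assoc[symmetric])
    qed
    also have "\<dots> \<le> ennreal (?w / L) * (\<integral>\<^sup>+p. hat L u (y + p) * hat L v p \<partial>freq)"
      by (intro mult_left_mono conv) simp
    also have "\<dots> = (\<integral>\<^sup>+p. ennreal (?w / L) * (hat L u (y + p) * hat L v p) \<partial>freq)"
      by (rule nn_integral_cmult[symmetric]) measurable
    also have "\<dots> \<le> (\<integral>\<^sup>+p. ennreal ?c * (?K y p * g p * h (y + p)) \<partial>freq)"
    proof (rule nn_integral_mono)
      fix p
      have "?w / L \<le> (2 powr s * (interaction \<gamma> y p * weightX s (1/2) p * weightX s (1/2) (y + p))) / L"
        using L by (intro divide_right_mono weightY_le_interaction s \<epsilon>) simp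
      then have "ennreal (?w / L) \<le> ennreal (?c * (interaction \<gamma> y p * weightX s (1/2) p * weightX s (1/2) (y + p)))"
        by (intro ennreal_leI) simp
      then have "ennreal (?w / L) * (hat L u (y + p) * hat L v p)
          \<le> ennreal (?c * (interaction \<gamma> y p * weightX s (1/2) p * weightX s (1/2) (y + p))) * (hat L u (y + p) * hat L v p)"
        by (rule mult_right_mono) simp
      also have "\<dots> = ennreal ?c * (?K y p * g p * h (y + p))"
        using c by (subst ennreal_mult[OF c]) (simp_all add: h_def g_def ennreal_mult mult_ac)
      finally show "ennreal (?w / L) * (hat L u (y + p) * hat L v p) \<le> ennreal ?c * (?K y p * g p * h (y + p))" .
    qed
    also have "\<dots> = ennreal ?c * G y"
      unfolding G_def by (rule nn_integral_cmult) measurable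
    finally show ?thesis .
  qed
  have "Y_norm \<gamma> L (s - 1/2) (-1/2 + \<epsilon>) (deriv_x (\<lambda>t x. u t x * cnj (v t x))) \<le> ennreal_sqrt (l2sq (\<lambda>y. ennreal ?c * G y))"
    unfolding Y_norm_def by (rule bourgain_norm_le[OF _ pointwise]) measurable
  also have "\<dots> \<le> ennreal (?c * sqrt A) * ennreal_sqrt (l2sq h) * ennreal_sqrt (l2sq g)"
    using A c by (intro ennreal_sqrt_le_mult[OF l2] mult_nonneg_nonneg) auto
  finally show ?thesis
    unfolding X_norm_def bourgain_norm_eq[OF meas_hat(1)] bourgain_norm_eq[OF meas_hat(2)] h_def g_def .
qed

theorem proposition3p3:
  fixes L \<gamma> s :: real
  assumes "L > 0" and "\<gamma> \<noteq> 0" and "\<bar>\<gamma>\<bar> \<noteq> 1" and "s \<ge> 1/2"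
  shows "\<exists>\<epsilon>\<^sub>0>0. \<forall>\<epsilon>. 0 < \<epsilon> \<and> \<epsilon> < \<epsilon>\<^sub>0 \<longrightarrow>
    (\<exists>C>0. \<forall>u\<in>schwartz_per L. \<forall>v\<in>schwartz_per L.
        X_norm L s (-1/2 + \<epsilon>) (\<lambda>t x. u t x * v t x)
          \<le> ennreal C * Y_norm \<gamma> L (s - 1/2) (1/2) u * X_norm L s (1/2) v) \<and>
    (\<exists>C>0. \<forall>u\<in>schwartz_per L. \<forall>v\<in>schwartz_per L.
        Y_norm \<gamma> L (s - 1/2) (-1/2 + \<epsilon>) (deriv_x (\<lambda>t x. u t x * cnj (v t x)))
          \<le> ennreal C * X_norm L s (1/2) u * X_norm L s (1/2) v)"
proof -
  obtain A0 where A0: "A0 \<ge> 0"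
    "\<And>f g h. \<lbrakk>f \<in> borel_measurable freq; g \<in> borel_measurable freq; h \<in> borel_measurable freq\<rbrakk>
      \<Longrightarrow> (trilinear (\<lambda>y p. ennreal (interaction \<gamma> y p)) f g h)\<^sup>2 \<le> ennreal A0 * l2sq f * l2sq g * l2sq h"
    using trilinear_interaction_bound[OF assms(3)] by blast
  \<comment> \<open>The theorem asks for positive constants, while \<open>A0\<close> may be
    0.\<close>
  define A where "A = A0 + 1"
  have A: "A > 0" "A \<ge> 0" using A0 by (simp_all add: A_def)
  have tri: "(trilinear (\<lambda>y p. ennreal (interaction \<gamma> y p)) f g h)\<^sup>2 \<le> ennreal A * l2sq f * l2sq g * l2sq h"
    if "f \<in> borel_measurable freq" "g \<in> borel_measurable freq" "h \<in> borel_measurable freq" for f g h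
  proof (rule order_trans[OF A0(2)[OF that]])
    have "ennreal A0 \<le> ennreal A"
      by (rule ennreal_leI) (simp add: A_def)
    then show "ennreal A0 * l2sq f * l2sq g * l2sq h \<le> ennreal A * l2sq f * l2sq g * l2sq h"
      by (intro mult_right_mono) simp_all
  qed
  have "2 powr s * sqrt A > 0" "2 powr s / L * sqrt A > 0"
    using A assms(1) by simp_all
  then have est: "(\<exists>C>0. \<forall>u\<in>schwartz_per L. \<forall>v\<in>schwartz_per L.
        X_norm L s (-1/2 + \<epsilon>) (\<lambda>t x. u t x * v t x)
          \<le> ennreal C * Y_norm \<gamma> L (s - 1/2) (1/2) u * X_norm L s (1/2) v) \<and>
    (\<exists>C>0. \<forall>u\<in>schwartz_per L. \<forall>v\<in>schwartz_per L.
        Y_norm \<gamma> L (s - 1/2) (-1/2 + \<epsilon>) (deriv_x (\<lambda>t x. u t x * cnj (v t x)))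
          \<le> ennreal C * X_norm L s (1/2) u * X_norm L s (1/2) v)" if "\<epsilon> \<le> 1/16" for \<epsilon>
    using estimate_X[OF assms(1,4) that A(2) tri] estimate_Y[OF assms(1,4) that A(2) tri] by blast
  \<comment> \<open>The threshold is the gap between 1/2 and the kernel exponent 7/16.\<close>
  show ?thesis
    by (rule exI[of _ "1/16"], intro conjI allI impI est) simp_all
qed

end
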